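(* Let $k\in\mathbb{N}_0$, $r\in(1,\infty)$ with Hölder conjugate $r'=r/(r-1)$, and $s\in\mathbb{R}$. The discrete energy $$E_h(v_h)=\int_\Omega\big(\Psi(\mathrm{D}_hv_h)+\psi_h(x,\Pi^k_{\mathcal M}v_{\mathcal M})\big)\,\mathrm{d}x+\mathrm{s}_h(v_h)/r,\qquad v_h=(v_{\mathcal M},v_\Sigma)\in V_{\mathrm D}(\mathcal M),$$ and the discrete dual energy $$E_h^*(\tau_h)=-\int_\Omega\big(\Psi^*(\mathcal R_h^*\tau_h)+\psi_h^*(x,\mathrm{div}_h\tau_h)\big)\,\mathrm{d}x-\gamma_h(\tau_h)/r',\qquad \tau_h=(\tau_{\mathcal M},\tau_\Sigma)\in W_{\mathrm N}(\mathcal M),$$ satisfy the discrete weak duality $$\max E_h^*(W_{\mathrm N}(\mathcal M))\le\min E_h(V_{\mathrm D}(\mathcal M)).$$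
   Context: Energy densities. $\mathbb M=\mathbb{R}^{m\times n}$ with Frobenius product $A:B$. $\Psi:\mathbb M\to\mathbb{R}\cup\{+\infty\}$ is a proper lower semicontinuous convex energy density; $\psi:\Omega\times\mathbb{R}^m\to\mathbb{R}\cup\{+\infty\}$ is measurable such that $\psi(x,\cdot)$ is proper, lower semicontinuous and convex for a.e. $x\in\Omega$; $\psi_h:\Omega\times\mathbb{R}^m\to\mathbb{R}\cup\{+\infty\}$ is an approximation of $\psi$. (The underlying continuous problem minimizes $\int_\Omega(\Psi(\mathrm Dv)+\psi(x,v))\,\mathrm{d}x$ among Sobolev functions $v\in W^{1,p}(\Omega;\mathbb{R}^m)$, $1<p<\infty$, vanishing on $\Gamma_{\mathrm D}$.) Convex conjugates: $\Psi^*(G)=\sup_{A\in\mathbb M}(A:G-\Psi(A))$ and $\psi_h^*(x,b)=\sup_{a\in\mathbb{R}^m}(a\cdot b-\psi_h(x,a))$. Domain and mesh. $\Omega\subset\mathbb{R}^n$ is an open bounded polyhedral Lipschitz domain with unit normal $\nu$; $\Gamma_{\mathrm D}\subset\partial\Omega$ is non-empty and closed, $\Gamma_{\mathrm N}=\partial\Omega\setminus\Gamma_{\mathrm D}$. $\mathcal M$ is a finite collection of closed polytopes (cells) of positive volume, with overlap of measure zero, covering $\overline\Omega$. A face $S$ is a closed connected subset of a hyperplane with positive $(n-1)$-dimensional surface measure that is contained either in $K_+\cap K_-$ for cells $K_+,K_-\in\mathcal M$ (interior face) or in $K_+\cap\partial\Omega$ for a cell $K_+\in\mathcal M$ (boundary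 face). $\Sigma$ is a finite collection of faces with overlap of $(n-1)$-dimensional measure zero, covering the skeleton $\bigcup_{K\in\mathcal M}\partial K=\bigcup_{S\in\Sigma}S$; $\Sigma(\Omega)$, $\Sigma(\partial\Omega)$ are its interior and boundary faces, $\Sigma_{\mathrm D}=\{S\in\Sigma:S\subset\Gamma_{\mathrm D}\}$, $\Sigma_{\mathrm N}=\Sigma(\partial\Omega)\setminus\Sigma_{\mathrm D}$, and $\Sigma(K)$ is the set of faces of the cell $K$. Each interior face has a fixed unit normal $\nu_S$, and $K_\pm$ are the two adjacent cells with outer normals $\nu_{K_\pm}|_S=\pm\nu_S$; for boundary faces $\nu_S=\nu|_S$ and $K_+$ is the unique adjacent cell. Jump: $[v]_S=v|_{K_+}-v|_{K_-}$ on interior faces, $[v]_S=v|_{K_+}$ on boundary faces. $h_S$ is the diameter of $S$. Spaces. $P_k(\mathcal M;X)$, $P_k(\Sigma;X)$ are the piecewise polynomials of degree at most $k$ on cells, resp. faces, with values in $X$; $\Pi^k_{\mathcal M}$, $\Pi^k_S$ are the $L^2$ projections onto $P_k(\mathcal M)$, $P_k(S)$ (componentwise). $\mathrm D_{\mathrm{pw}}$, $\mathrm{div}_{\mathrm{pw}}$ are the piecewise gradient and (row-wise) divergence. $V(\mathcal M)=P_{k+1}(\mathcal M;\mathbb{R}^m)\times P_k(\Sigma;\mathbb{R}^m)$, $W(\mathcal M)=P_k(\mathcal M;\mathbb M)\times P_k(\Sigma;\mathbb{R}^m)$; $V_{\mathrm D}(\mathcal M)=\{(v_{\mathcal M},v_\Sigma)\in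 V(\mathcal M):v_\Sigma|_S=0\ \forall S\in\Sigma_{\mathrm D}\}$, $W_{\mathrm N}(\mathcal M)=\{(\tau_{\mathcal M},\tau_\Sigma)\in W(\mathcal M):\tau_\Sigma|_S=0\ \forall S\in\Sigma_{\mathrm N}\}$. Write $v_K=v_{\mathcal M}|_K$, $v_S=v_\Sigma|_S$, and similarly $\tau_K,\tau_S$. Reconstructions. $\mathrm D_hv_h\in P_k(\mathcal M;\mathbb M)$ is the unique solution to $\int_\Omega\mathrm D_hv_h:\tau_k\,\mathrm{d}x=-\int_\Omega v_{\mathcal M}\cdot\mathrm{div}_{\mathrm{pw}}\tau_k\,\mathrm{d}x+\sum_{S\in\Sigma}\int_Sv_S\cdot[\tau_k\nu_S]_S\,\mathrm{d}s$ for all $\tau_k\in P_k(\mathcal M;\mathbb M)$. $\mathrm{div}_h\tau_h\in P_k(\mathcal M;\mathbb{R}^m)$ is the unique solution to $\int_\Omega\mathrm{div}_h\tau_h\cdot\varphi_k\,\mathrm{d}x=-\int_\Omega\mathrm D_{\mathrm{pw}}\varphi_k:\tau_{\mathcal M}\,\mathrm{d}x+\sum_{S\in\Sigma}\int_S[\varphi_k]_S\cdot\tau_S\,\mathrm{d}s$ for all $\varphi_k\in P_k(\mathcal M;\mathbb{R}^m)$. Let $Z(\mathcal M)$ be the $L^2$-orthogonal complement of $\mathrm D_{\mathrm{pw}}P_{k+1}(\mathcal M;\mathbb{R}^m)$ in $P_k(\mathcal M;\mathbb M)$, with $L^2$ projection $\Pi_{Z(\mathcal M)}:P_k(\mathcal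 M;\mathbb M)\to Z(\mathcal M)$. $\mathcal R_h^*\tau_h\in P_k(\mathcal M;\mathbb M)$ is the unique function with $\int_\Omega\mathcal R_h^*\tau_h:\mathrm D_{\mathrm{pw}}v_{k+1}\,\mathrm{d}x=-\int_\Omega v_{k+1}\cdot\mathrm{div}_h\tau_h\,\mathrm{d}x+\sum_{S\in\Sigma}\int_S[v_{k+1}]_S\cdot\tau_S\,\mathrm{d}s$ for all $v_{k+1}\in P_{k+1}(\mathcal M;\mathbb{R}^m)$ and $\Pi_{Z(\mathcal M)}\mathcal R_h^*\tau_h=\Pi_{Z(\mathcal M)}\tau_{\mathcal M}$. Stabilizations. $\mathrm s_h(v_h)=\sum_{K\in\mathcal M}\sum_{S\in\Sigma(K)}h_S^{-s}\int_S T_{K,S}v_h\cdot(v_S-\Pi_S^kv_K)\,\mathrm{d}s$ with $T_{K,S}v_h=\Pi_S^k\big(|v_S-\Pi_S^kv_K|^{r-2}(v_S-\Pi_S^kv_K)\big)$, i.e. $\mathrm s_h(v_h)=\sum_{K\in\mathcal M}\sum_{S\in\Sigma(K)}h_S^{-s}\|v_S-\Pi_S^kv_K\|_{L^r(S)}^r$; and $\gamma_h(\tau_h)=\sum_{K\in\mathcal M}\sum_{S\in\Sigma(K)}h_S^{s/(r-1)}\|\tau_S-(\mathcal R_h^*\tau_h)|_K\nu_S\|_{L^{r'}(S)}^{r'}$.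
   Formalization: Max and min are read as supremum and infimum, since under the stated hypotheses the extrema need not be attained; and n ≥ 2 is assumed, since for n = 1 faces are points with h_S = 0 and the powers of h_S are not meaningful. *)

theory Defs
  imports "HOL-Analysis.Analysis"
begin

section \<open>Extended-real-valued functions\<close>

definition proper_fun :: "('a \<Rightarrow> ereal) \<Rightarrow> bool" where
  "proper_fun f \<longleftrightarrow> (\<forall>x. f x \<noteq> -\<infinity>) \<and> (\<exists>x. f x \<noteq> \<infinity>)"

definition lsc_fun :: "('a::topological_space \<Rightarrow> ereal) \<Rightarrow> bool" where
  "lsc_fun f \<longleftrightarrow> (\<forall>x. f x \<le> Liminf (at x) f)"

definition convex_fun :: "('a::real_vector \<Rightarrow> ereal) \<Rightarrow> bool" where
  "convex_fun f \<longleftrightarrow> (\<forall>x y. \<forall>t\<in>{0..1}.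
     f (t *\<^sub>R x + (1 - t) *\<^sub>R y) \<le> ereal t * f x + ereal (1 - t) * f y)"

definition energy_density :: "('a::real_inner \<Rightarrow> ereal) \<Rightarrow> bool" where
  "energy_density f \<longleftrightarrow> proper_fun f \<and> lsc_fun f \<and> convex_fun f"

definition conjugate :: "('a::real_inner \<Rightarrow> ereal) \<Rightarrow> 'a \<Rightarrow> ereal" where
  "conjugate f b = (SUP a. ereal (a \<bullet> b) - f a)"

text \<open>Integral of an extended-real-valued function, with the usual convention of convex analysis
  that the value is \<open>+\<infinity>\<close> unless the positive part is integrable. No measurability of \<open>f\<close> is needed
  for the definition; for measurable \<open>f\<close> it is the Lebesgue integral, see
  \<open>ext_integral_eq\<close> and \<open>ext_integral_eq_lebesgue\<close> below.\<close>

definition ext_integral :: "'a measure \<Rightarrow> ('a \<Rightarrow> ereal) \<Rightarrow> ereal" where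
  "ext_integral M f =
     (INF g \<in> {g :: 'a \<Rightarrow> real. integrable M g \<and> (AE x in M. f x \<le> ereal (g x))}.
        ereal (LINT x|M. g x))"

lemma ext_integral_eq_lebesgue:
  assumes "integrable M f"
  shows "ext_integral M (\<lambda>x. ereal (f x)) = ereal (LINT x|M. f x)"
  unfolding ext_integral_def
proof (rule antisym)
  show "(INF g \<in> {g. integrable M g \<and> (AE x in M. ereal (f x) \<le> ereal (g x))}. ereal (LINT x|M. g x))
        \<le> ereal (LINT x|M. f x)"
    by (rule INF_lower) (use assms in auto)
  show "ereal (LINT x|M. f x)
        \<le> (INF g \<in> {g. integrable M g \<and> (AE x in M. ereal (f x) \<le> ereal (g x))}. ereal (LINT x|M. g x))"
    by (rule INF_greatest) (use assms in \<open>auto intro!: integral_mono_AE\<close>)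
qed

text \<open>Recall that \<open>\<infinity> - \<infinity> = \<infinity>\<close> in \<open>ereal\<close>.\<close>

lemma ext_integral_eq:
  assumes "finite_measure M" and f[measurable]: "f \<in> borel_measurable M"
  shows "ext_integral M f =
    enn2ereal (\<integral>\<^sup>+x. e2ennreal (f x) \<partial>M) - enn2ereal (\<integral>\<^sup>+x. e2ennreal (- f x) \<partial>M)"
    (is "_ = enn2ereal ?P - enn2ereal ?N")
proof (rule antisym)
  interpret finite_measure M by fact
  show "enn2ereal ?P - enn2ereal ?N \<le> ext_integral M f"
    unfolding ext_integral_def
  proof (rule INF_greatest, clarify)
    fix g :: "'a \<Rightarrow> real" assume g: "integrable M g" and le: "AE x in M. f x \<le> ereal (g x)"
    let ?P' = "\<integral>\<^sup>+x. ennreal (g x) \<partial>M" and ?N' = "\<integral>\<^sup>+x. ennreal (- g x) \<partial>M"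
    have fin: "?P' < \<infinity>" "?N' < \<infinity>" using g
      by (auto simp: real_integrable_def less_top)
    have P: "?P \<le> ?P'" using le
      by (intro nn_integral_mono_AE) (auto elim!: eventually_mono dest!: e2ennreal_mono simp: ennreal.abs_eq e2ennreal_def ennreal_def)
    have N: "?N' \<le> ?N" using le
    proof (intro nn_integral_mono_AE, elim eventually_mono)
      fix x assume "f x \<le> ereal (g x)"
      then have "ereal (- g x) \<le> - f x" by (metis ereal_minus_le_minus uminus_ereal.simps(1))
      from e2ennreal_mono[OF this] show "ennreal (- g x) \<le> e2ennreal (- f x)"
        by (simp add: ennreal_def e2ennreal_def)
    qed
    have "ereal (LINT x|M. g x) = enn2ereal ?P' - enn2ereal ?N'"
      using real_lebesgue_integral_def[OF g] fin
      by (cases ?P'; cases ?N') (auto simp: enn2ereal_ennreal)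
    moreover have "enn2ereal ?P - enn2ereal ?N \<le> enn2ereal ?P' - enn2ereal ?N'"
      using P N by (intro ereal_minus_mono) (auto simp: less_eq_ennreal.rep_eq)
    ultimately show "enn2ereal ?P - enn2ereal ?N \<le> ereal (LINT x|M. g x)" by simp
  qed
next
  interpret finite_measure M by fact
  show "ext_integral M f \<le> enn2ereal ?P - enn2ereal ?N"
  proof (cases "?P = \<infinity>")
    case True then show ?thesis by simp
  next
    case False
    have f_fin: "AE x in M. f x < \<infinity>"
    proof -
      have "AE x in M. e2ennreal (f x) \<noteq> \<infinity>"
        using False by (intro nn_integral_noteq_infinite) auto
      then show ?thesis by (auto elim!: eventually_mono)
    qed
    define g where "g n x = real_of_ereal (max (- ereal (real n)) (f x))" for n :: nat and x
    define N where "N n = (\<integral>\<^sup>+x. min (ennreal (real n)) (e2ennreal (- f x)) \<partial>M)" for n :: nat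
    have meas[measurable]: "g n \<in> borel_measurable M" for n
      unfolding g_def by measurable
    have pos: "ennreal (g n x) = e2ennreal (f x)" if "f x < \<infinity>" for n x
      using that by (cases "f x") (auto simp: g_def max_def ennreal_neg e2ennreal_neg e2ennreal_ereal)
    have neg: "ennreal (- g n x) = min (ennreal (real n)) (e2ennreal (- f x))" if "f x < \<infinity>" for n x
      using that by (cases "f x") (auto simp: g_def max_def min_def ennreal_neg e2ennreal_infty e2ennreal_ereal ennreal_le_iff2)
    have P: "(\<integral>\<^sup>+x. ennreal (g n x) \<partial>M) = ?P" for n
      by (rule nn_integral_cong_AE) (use f_fin pos in \<open>auto elim!: eventually_mono\<close>)
    have N: "(\<integral>\<^sup>+x. ennreal (- g n x) \<partial>M) = N n" for n
      unfolding N_def by (rule nn_integral_cong_AE) (use f_fin neg in \<open>auto elim!: eventually_mono\<close>)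
    have N_fin: "N n < \<infinity>" for n
    proof -
      have "N n \<le> (\<integral>\<^sup>+x. ennreal (real n) \<partial>M)"
        unfolding N_def by (intro nn_integral_mono) auto
      also have "\<dots> < \<infinity>" by (simp add: ennreal_mult_less_top emeasure_eq_measure)
      finally show ?thesis .
    qed
    have int: "integrable M (g n)" for n
      using False N_fin[of n] by (auto simp: real_integrable_def P N)
    have val: "ereal (LINT x|M. g n x) = enn2ereal ?P - enn2ereal (N n)" for n
      using real_lebesgue_integral_def[OF int[of n]] False N_fin[of n] P[of n] N[of n]
      by (cases ?P; cases "N n") (auto simp: enn2ereal_ennreal)
    have fg: "AE x in M. f x \<le> ereal (g n x)" for n
      using f_fin
    proof (elim eventually_mono)
      fix x assume "f x < \<infinity>"
      then show "f x \<le> ereal (g n x)" by (cases "f x") (auto simp: g_def max_def)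
    qed
    have upper: "ext_integral M f \<le> enn2ereal ?P - enn2ereal (N n)" for n
      unfolding ext_integral_def val[of n, symmetric]
      by (rule INF_lower) (use int fg in auto)
    have N_sup: "?N = (SUP n. N n)"
    proof -
      have "?N = (\<integral>\<^sup>+x. (SUP n. min (ennreal (real n)) (e2ennreal (- f x))) \<partial>M)"
      proof (rule nn_integral_cong)
        fix x
        have "(SUP n. min (ennreal (real n)) (e2ennreal (- f x)))
              = min (SUP n. ennreal (real n)) (e2ennreal (- f x))"
          by (simp add: inf_min[symmetric] inf_Sup image_comp SUP_inf)
        also have "\<dots> = e2ennreal (- f x)"
          by (simp add: ennreal_SUP_of_nat_eq_top flip: ennreal_of_nat_eq_real_of_nat)
        finally show "e2ennreal (- f x) = (SUP n. min (ennreal (real n)) (e2ennreal (- f x)))" by simp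
      qed
      also have "\<dots> = (SUP n. N n)"
        unfolding N_def
        by (rule nn_integral_monotone_convergence_SUP)
           (auto simp: incseq_def le_fun_def intro: min.coboundedI1 ennreal_leI)
      finally show ?thesis .
    qed
    obtain p where p: "enn2ereal ?P = ereal p"
      using False by (cases ?P) (auto simp: enn2ereal_ennreal)
    define y where "y = ereal p - ext_integral M f"
    have Ny: "enn2ereal (N n) \<le> y" for n
      using upper[of n] unfolding p y_def
      by (cases "enn2ereal (N n)"; cases "ext_integral M f") auto
    have y0: "0 \<le> y" using Ny[of 0] enn2ereal_nonneg order_trans by blast
    have "N n \<le> e2ennreal y" for n
      using e2ennreal_mono[OF Ny[of n]] by simp
    then have "?N \<le> e2ennreal y"
      unfolding N_sup by (rule SUP_least)
    then have "enn2ereal ?N \<le> ereal p - ext_integral M f"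
      using y0 by (simp add: less_eq_ennreal.rep_eq enn2ereal_e2ennreal y_def)
    then show ?thesis unfolding p
      by (cases "enn2ereal ?N"; cases "ext_integral M f") auto
  qed
qed

section \<open>Domain and mesh\<close>

definition lipschitz_domain :: "'a::euclidean_space set \<Rightarrow> bool" where
  "lipschitz_domain \<Omega> \<longleftrightarrow> open \<Omega> \<and> connected \<Omega> \<and> \<Omega> \<noteq> {} \<and>
     (\<forall>x\<in>frontier \<Omega>. \<exists>U e g L. open U \<and> x \<in> U \<and> norm e = 1 \<and> L-lipschitz_on UNIV (g :: 'a \<Rightarrow> real) \<and>
        (\<forall>y\<in>U. y \<in> \<Omega> \<longleftrightarrow> y \<bullet> e < g (y - (y \<bullet> e) *\<^sub>R e)))"

definition polyhedral_boundary :: "'a::euclidean_space set \<Rightarrow> bool" where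
  "polyhedral_boundary \<Omega> \<longleftrightarrow> (\<exists>\<P>. finite \<P> \<and> (\<forall>P\<in>\<P>. polytope P) \<and> frontier \<Omega> = \<Union>\<P>)"

text \<open>For a unit vector \<open>e\<close>, the \<open>(n - 1)\<close>-dimensional surface measure on the hyperplane
  \<open>H = {x. e \<bullet> x = c}\<close>: the measure of \<open>A \<subseteq> H\<close> is the volume of the right prism
  \<open>{x + t *\<^sub>R e | x \<in> A, t \<in> [0, 1]}\<close> of height one over \<open>A\<close>.\<close>

definition hyperplane_measure :: "'a::euclidean_space \<Rightarrow> real \<Rightarrow> 'a measure" where
  "hyperplane_measure e c =
     distr (restrict_space lborel {x. c \<le> e \<bullet> x \<and> e \<bullet> x \<le> c + 1}) borel
           (\<lambda>x. x - (e \<bullet> x - c) *\<^sub>R e)"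

text \<open>Surface measure on a subset \<open>S\<close> of a hyperplane with unit normal \<open>e\<close>.\<close>

definition surface_measure :: "'a::euclidean_space \<Rightarrow> 'a set \<Rightarrow> 'a measure" where
  "surface_measure e S = restrict_space (hyperplane_measure e (e \<bullet> (SOME x. x \<in> S))) S"

text \<open>On \<open>S\<close>, a subset of the boundary of \<open>A\<close> and of a hyperplane, the outer unit normal of \<open>A\<close>
  is almost everywhere \<open>e\<close>.\<close>

definition outer_normal_on :: "'a::euclidean_space set \<Rightarrow> 'a set \<Rightarrow> 'a \<Rightarrow> bool" where
  "outer_normal_on A S e \<longleftrightarrow> norm e = 1 \<and> (\<exists>c. S \<subseteq> {x. e \<bullet> x = c}) \<and>
     (AE x in surface_measure e S. \<exists>\<epsilon>>0. \<forall>t\<in>{0<..<\<epsilon>}. x - t *\<^sub>R e \<in> A \<and> x + t *\<^sub>R e \<notin> A)"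

record 'n mesh =
  omega :: "(real, 'n::finite) vec set"
  dirichlet :: "(real, 'n) vec set"
  cells :: "(real, 'n) vec set set"
  faces :: "(real, 'n) vec set set"
  fnormal :: "(real, 'n) vec set \<Rightarrow> (real, 'n) vec"

definition interior_faces :: "'n::finite mesh \<Rightarrow> (real^'n) set set" where
  "interior_faces T = {S \<in> faces T. \<exists>K\<in>cells T. \<exists>L\<in>cells T. K \<noteq> L \<and> S \<subseteq> K \<inter> L}"

definition boundary_faces :: "'n::finite mesh \<Rightarrow> (real^'n) set set" where
  "boundary_faces T = {S \<in> faces T. \<exists>K\<in>cells T. S \<subseteq> K \<inter> frontier (omega T)}"

definition dirichlet_faces :: "'n::finite mesh \<Rightarrow> (real^'n) set set" where
  "dirichlet_faces T = {S \<in> faces T. S \<subseteq> dirichlet T}"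

definition neumann_faces :: "'n::finite mesh \<Rightarrow> (real^'n) set set" where
  "neumann_faces T = boundary_faces T - dirichlet_faces T"

text \<open>Cells are convex with null overlaps, so a face contained in \<open>K\<close> lies in \<open>frontier K\<close>, and a
  face not contained in \<open>K\<close> meets \<open>frontier K\<close> in a null set of the face.\<close>

definition faces_of_cell :: "'n::finite mesh \<Rightarrow> (real^'n) set \<Rightarrow> (real^'n) set set" where
  "faces_of_cell T K = {S \<in> faces T. S \<subseteq> K}"

abbreviation ds :: "'n::finite mesh \<Rightarrow> (real^'n) set \<Rightarrow> (real^'n) measure" where
  "ds T S \<equiv> surface_measure (fnormal T S) S"

abbreviation dx :: "'n::finite mesh \<Rightarrow> (real^'n) measure" where
  "dx T \<equiv> lebesgue_on (omega T)"

definition admissible_domain :: "'n::finite mesh \<Rightarrow> bool" where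
  "admissible_domain T \<longleftrightarrow>
     bounded (omega T) \<and> lipschitz_domain (omega T) \<and> polyhedral_boundary (omega T) \<and>
     dirichlet T \<noteq> {} \<and> closed (dirichlet T) \<and> dirichlet T \<subseteq> frontier (omega T)"

definition admissible_cells :: "'n::finite mesh \<Rightarrow> bool" where
  "admissible_cells T \<longleftrightarrow>
     finite (cells T) \<and>
     (\<forall>K\<in>cells T. polytope K \<and> emeasure lborel K > 0) \<and>
     (\<forall>K\<in>cells T. \<forall>L\<in>cells T. K \<noteq> L \<longrightarrow> emeasure lborel (K \<inter> L) = 0) \<and>
     \<Union>(cells T) = closure (omega T)"

definition admissible_faces :: "'n::finite mesh \<Rightarrow> bool" where
  "admissible_faces T \<longleftrightarrow>
     finite (faces T) \<and>
     (\<forall>S\<in>faces T. closed S \<and> connected S \<and>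
        norm (fnormal T S) = 1 \<and> (\<exists>c. S \<subseteq> {x. fnormal T S \<bullet> x = c}) \<and>
        emeasure (ds T S) S > 0 \<and>
        S \<in> interior_faces T \<union> boundary_faces T) \<and>
     (\<forall>S\<in>faces T. \<forall>S'\<in>faces T. S \<noteq> S' \<longrightarrow> emeasure (ds T S) (S \<inter> S') = 0) \<and>
     (\<Union>K\<in>cells T. frontier K) = \<Union>(faces T) \<and>
     (\<forall>S\<in>boundary_faces T. outer_normal_on (omega T) S (fnormal T S))"

definition admissible_mesh :: "'n::finite mesh \<Rightarrow> bool" where
  "admissible_mesh T \<longleftrightarrow> admissible_domain T \<and> admissible_cells T \<and> admissible_faces T"

definition cell_plus :: "'n::finite mesh \<Rightarrow> (real^'n) set \<Rightarrow> (real^'n) set" where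
  "cell_plus T S = (THE K. K \<in> cells T \<and> S \<subseteq> K \<and>
     (S \<in> interior_faces T \<longrightarrow> outer_normal_on K S (fnormal T S)))"

definition cell_minus :: "'n::finite mesh \<Rightarrow> (real^'n) set \<Rightarrow> (real^'n) set" where
  "cell_minus T S = (THE K. K \<in> cells T \<and> S \<subseteq> K \<and> outer_normal_on K S (- fnormal T S))"

section \<open>Piecewise polynomials\<close>

definition polys :: "nat \<Rightarrow> (real^'n \<Rightarrow> 'b::real_vector) set" where
  "polys k = {p. \<exists>c. \<forall>x. p x =
     (\<Sum>\<alpha> | (\<Sum>i\<in>UNIV. \<alpha> i) \<le> k. (\<Prod>i\<in>UNIV. (x $ i) ^ \<alpha> i) *\<^sub>R c (\<alpha> :: 'n \<Rightarrow> nat))}"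

text \<open>A piecewise function is the family of its restrictions to the cells. As cells have
  nonempty interior, a polynomial on a cell is identified with a polynomial on the whole space;
  this makes its trace on the boundary of the cell available. A polynomial on a face,
  in contrast, is the restriction of a polynomial to the face.\<close>

definition cell_polys :: "'n::finite mesh \<Rightarrow> nat \<Rightarrow> ((real^'n) set \<Rightarrow> real^'n \<Rightarrow> 'b::real_vector) set" where
  "cell_polys T k = cells T \<rightarrow>\<^sub>E polys k"

definition polys_on :: "(real^'n) set \<Rightarrow> nat \<Rightarrow> (real^'n \<Rightarrow> 'b::real_vector) set" where
  "polys_on S k = (\<lambda>p. restrict p S) ` polys k"

definition face_polys :: "'n::finite mesh \<Rightarrow> nat \<Rightarrow> ((real^'n) set \<Rightarrow> real^'n \<Rightarrow> 'b::real_vector) set" where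
  "face_polys T k = (\<Pi>\<^sub>E S\<in>faces T. polys_on S k)"

text \<open>The almost everywhere well-defined function on the domain given by a family on the cells.\<close>

definition glue :: "'n::finite mesh \<Rightarrow> ((real^'n) set \<Rightarrow> real^'n \<Rightarrow> 'b) \<Rightarrow> real^'n \<Rightarrow> 'b" where
  "glue T v x = v (SOME K. K \<in> cells T \<and> x \<in> K) x"

definition jump :: "'n::finite mesh \<Rightarrow> ((real^'n) set \<Rightarrow> real^'n \<Rightarrow> 'b::real_vector)
    \<Rightarrow> (real^'n) set \<Rightarrow> real^'n \<Rightarrow> 'b" where
  "jump T v S x = (if S \<in> interior_faces T then v (cell_plus T S) x - v (cell_minus T S) x
                   else v (cell_plus T S) x)"

definition grad_pw :: "'n::finite mesh \<Rightarrow> ((real^'n) set \<Rightarrow> real^'n \<Rightarrow> real^'m)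
    \<Rightarrow> (real^'n) set \<Rightarrow> real^'n \<Rightarrow> real^'n^'m" where
  "grad_pw T v = (\<lambda>K\<in>cells T. \<lambda>x. jacobian (v K) (at x))"

definition div_pw :: "'n::finite mesh \<Rightarrow> ((real^'n) set \<Rightarrow> real^'n \<Rightarrow> real^'n^'m)
    \<Rightarrow> (real^'n) set \<Rightarrow> real^'n \<Rightarrow> real^'m" where
  "div_pw T \<tau> = (\<lambda>K\<in>cells T. \<lambda>x.
     \<chi> i. \<Sum>j\<in>UNIV. frechet_derivative (\<tau> K) (at x) (axis j 1) $ i $ j)"

definition int_inner :: "'n::finite mesh \<Rightarrow> ((real^'n) set \<Rightarrow> real^'n \<Rightarrow> 'b::real_inner)
    \<Rightarrow> ((real^'n) set \<Rightarrow> real^'n \<Rightarrow> 'b) \<Rightarrow> real" where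
  "int_inner T v w = (LINT x|dx T. glue T v x \<bullet> glue T w x)"

definition cell_proj :: "'n::finite mesh \<Rightarrow> ((real^'n) set \<Rightarrow> real^'n \<Rightarrow> 'b::real_inner) set
    \<Rightarrow> ((real^'n) set \<Rightarrow> real^'n \<Rightarrow> 'b) \<Rightarrow> (real^'n) set \<Rightarrow> real^'n \<Rightarrow> 'b" where
  "cell_proj T W v = (THE w. w \<in> W \<and> (\<forall>\<phi>\<in>W. int_inner T w \<phi> = int_inner T v \<phi>))"

definition face_proj :: "'n::finite mesh \<Rightarrow> nat \<Rightarrow> (real^'n) set \<Rightarrow> (real^'n \<Rightarrow> 'b::real_inner)
    \<Rightarrow> real^'n \<Rightarrow> 'b" where
  "face_proj T k S f = (THE w. w \<in> polys_on S k \<and>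
     (\<forall>\<phi>\<in>polys_on S k. (LINT x|ds T S. w x \<bullet> \<phi> x) = (LINT x|ds T S. f x \<bullet> \<phi> x)))"

section \<open>Discrete spaces, reconstructions and stabilizations\<close>

type_synonym ('n, 'b) pw = "(real, 'n) vec set \<Rightarrow> (real, 'n) vec \<Rightarrow> 'b"

definition V_D :: "'n::finite mesh \<Rightarrow> nat \<Rightarrow> (('n, real^'m) pw \<times> ('n, real^'m) pw) set" where
  "V_D T k = {(v\<^sub>M, v\<^sub>\<Sigma>). v\<^sub>M \<in> cell_polys T (k + 1) \<and> v\<^sub>\<Sigma> \<in> face_polys T k \<and>
     (\<forall>S\<in>dirichlet_faces T. \<forall>x\<in>S. v\<^sub>\<Sigma> S x = 0)}"

definition W_N :: "'n::finite mesh \<Rightarrow> nat \<Rightarrow> (('n, real^'n^'m) pw \<times> ('n, real^'m) pw) set" where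
  "W_N T k = {(\<tau>\<^sub>M, \<tau>\<^sub>\<Sigma>). \<tau>\<^sub>M \<in> cell_polys T k \<and> \<tau>\<^sub>\<Sigma> \<in> face_polys T k \<and>
     (\<forall>S\<in>neumann_faces T. \<forall>x\<in>S. \<tau>\<^sub>\<Sigma> S x = 0)}"

definition grad_h :: "'n::finite mesh \<Rightarrow> nat \<Rightarrow> ('n, real^'m) pw \<times> ('n, real^'m) pw
    \<Rightarrow> ('n, real^'n^'m) pw" where
  "grad_h T k v = (THE D. D \<in> cell_polys T k \<and>
     (\<forall>\<tau>\<in>cell_polys T k. int_inner T D \<tau> =
        - int_inner T (fst v) (div_pw T \<tau>)
        + (\<Sum>S\<in>faces T. LINT x|ds T S. snd v S x \<bullet> jump T (\<lambda>K x. \<tau> K x *v fnormal T S) S x)))"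

definition div_h :: "'n::finite mesh \<Rightarrow> nat \<Rightarrow> ('n, real^'n^'m) pw \<times> ('n, real^'m) pw
    \<Rightarrow> ('n, real^'m) pw" where
  "div_h T k \<tau> = (THE d. d \<in> cell_polys T k \<and>
     (\<forall>\<phi>\<in>cell_polys T k. int_inner T d \<phi> =
        - int_inner T (grad_pw T \<phi>) (fst \<tau>)
        + (\<Sum>S\<in>faces T. LINT x|ds T S. jump T \<phi> S x \<bullet> snd \<tau> S x)))"

definition Z_space :: "'n::finite mesh \<Rightarrow> nat \<Rightarrow> ('n, real^'n^'m) pw set" where
  "Z_space T k = {\<zeta> \<in> cell_polys T k. \<forall>v\<in>cell_polys T (k + 1). int_inner T \<zeta> (grad_pw T v) = 0}"

definition stress_rec :: "'n::finite mesh \<Rightarrow> nat \<Rightarrow> ('n, real^'n^'m) pw \<times> ('n, real^'m) pw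
    \<Rightarrow> ('n, real^'n^'m) pw" where
  "stress_rec T k \<tau> = (THE R. R \<in> cell_polys T k \<and>
     (\<forall>v\<in>cell_polys T (k + 1). int_inner T R (grad_pw T v) =
        - int_inner T v (div_h T k \<tau>)
        + (\<Sum>S\<in>faces T. LINT x|ds T S. jump T v S x \<bullet> snd \<tau> S x)) \<and>
     cell_proj T (Z_space T k) R = cell_proj T (Z_space T k) (fst \<tau>))"

definition face_residual :: "'n::finite mesh \<Rightarrow> nat \<Rightarrow> ('n, real^'m) pw \<times> ('n, real^'m) pw
    \<Rightarrow> (real^'n) set \<Rightarrow> (real^'n) set \<Rightarrow> real^'n \<Rightarrow> real^'m" where
  "face_residual T k v K S x = snd v S x - face_proj T k S (fst v K) x"

definition T_stab :: "'n::finite mesh \<Rightarrow> nat \<Rightarrow> real \<Rightarrow> ('n, real^'m) pw \<times> ('n, real^'m) pw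
    \<Rightarrow> (real^'n) set \<Rightarrow> (real^'n) set \<Rightarrow> real^'n \<Rightarrow> real^'m" where
  "T_stab T k r v K S = face_proj T k S
     (\<lambda>x. norm (face_residual T k v K S x) powr (r - 2) *\<^sub>R face_residual T k v K S x)"

definition s_h :: "'n::finite mesh \<Rightarrow> nat \<Rightarrow> real \<Rightarrow> real \<Rightarrow> ('n, real^'m) pw \<times> ('n, real^'m) pw \<Rightarrow> real" where
  "s_h T k r s v = (\<Sum>K\<in>cells T. \<Sum>S\<in>faces_of_cell T K. diameter S powr (- s) *
     (LINT x|ds T S. T_stab T k r v K S x \<bullet> face_residual T k v K S x))"

definition gamma_h :: "'n::finite mesh \<Rightarrow> nat \<Rightarrow> real \<Rightarrow> real \<Rightarrow> ('n, real^'n^'m) pw \<times> ('n, real^'m) pw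
    \<Rightarrow> real" where
  "gamma_h T k r s \<tau> = (\<Sum>K\<in>cells T. \<Sum>S\<in>faces_of_cell T K. diameter S powr (s / (r - 1)) *
     (LINT x|ds T S. norm (snd \<tau> S x - stress_rec T k \<tau> K x *v fnormal T S) powr (r / (r - 1))))"

section \<open>Energies\<close>

definition E_h :: "'n::finite mesh \<Rightarrow> nat \<Rightarrow> real \<Rightarrow> real \<Rightarrow> (real^'n^'m \<Rightarrow> ereal)
    \<Rightarrow> (real^'n \<Rightarrow> real^'m \<Rightarrow> ereal) \<Rightarrow> ('n, real^'m) pw \<times> ('n, real^'m) pw \<Rightarrow> ereal" where
  "E_h T k r s \<Psi> \<psi>\<^sub>h v =
     ext_integral (dx T) (\<lambda>x. \<Psi> (glue T (grad_h T k v) x)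
                            + \<psi>\<^sub>h x (glue T (cell_proj T (cell_polys T k) (fst v)) x))
     + ereal (s_h T k r s v / r)"

definition E_h_dual :: "'n::finite mesh \<Rightarrow> nat \<Rightarrow> real \<Rightarrow> real \<Rightarrow> (real^'n^'m \<Rightarrow> ereal)
    \<Rightarrow> (real^'n \<Rightarrow> real^'m \<Rightarrow> ereal) \<Rightarrow> ('n, real^'n^'m) pw \<times> ('n, real^'m) pw \<Rightarrow> ereal" where
  "E_h_dual T k r s \<Psi> \<psi>\<^sub>h \<tau> =
     - ext_integral (dx T) (\<lambda>x. conjugate \<Psi> (glue T (stress_rec T k \<tau>) x)
                              + conjugate (\<psi>\<^sub>h x) (glue T (div_h T k \<tau>) x))
     - ereal (gamma_h T k r s \<tau> / (r / (r - 1)))"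

end

theory Submission
  imports Defs
begin

text \<open>
Fix \<open>v\<close> and \<open>\<tau>\<close>, and write \<open>D\<close>, \<open>R\<close>, \<open>d\<close> and \<open>P\<close> for the discrete gradient of \<open>v\<close>, the stress
reconstruction and the discrete divergence of \<open>\<tau>\<close>, and the cell projection of \<open>v\<close>. The pointwise
Fenchel-Young inequality bounds the sum of the two energy integrals from below by
\<open>Q = \<integral> (D : R + P \<bullet> d)\<close>. Weak duality is therefore the bound of \<open>- Q\<close> by the stabilizations.

The number \<open>Q\<close> is a sum over faces. Testing the definition of \<open>D\<close> with \<open>R\<close>, integrating by parts on
each cell and testing the definition of \<open>R\<close> with the piecewise gradient of \<open>v\<close> leaves the sum over
all cells \<open>K\<close> and faces \<open>S\<close> of \<open>K\<close> of \<open>\<plusminus> \<integral> (v\<^sub>K - v\<^sub>S) \<bullet> (\<tau>\<^sub>S - R\<^sub>K \<nu>\<^sub>S)\<close>: the terms \<open>\<plusminus> \<integral> v\<^sub>S \<bullet> \<tau>\<^sub>S\<close>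
that complete the product cancel between the two neighbours of an interior face, and on a boundary
face one of the two factors vanishes. The second factor is a polynomial of degree \<open>k\<close> on \<open>S\<close>, so
\<open>v\<^sub>K\<close> can be replaced by its projection (\<open>discrete_integration_by_parts\<close>). Young's inequality with a
power of the diameter of \<open>S\<close> as weight then produces the summands of the two stabilizations
(\<open>stabilization_bound\<close>).

Three facts support this computation.

The first is a divergence theorem for convex bodies (\<open>divergence_theorem_convex\<close>). The surface measure
of a flat set is the volume of the prism of height one over it, and a shear maps this prism to the
slanted prism in direction \<open>a\<close> with Jacobian \<open>\<bar>a \<bullet> \<nu>\<bar>\<close>. The theorem follows by integrating the
fundamental theorem of calculus over all segments from \<open>x\<close> to \<open>x + a\<close>: almost every segment crosses
the boundary transversally and through one face at a time.

The second is the position of cells relative to faces. A face is merely a closed flat set of positive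
surface measure, but at almost all of its points a cell containing it also contains a short segment
in normal direction. Hence every such cell lies on one side of the face, two cells lie on opposite
sides, and a face of another cell meets the boundary of a cell in a null set (\<open>cell_divergence\<close>).

The third is that the definite descriptions of the reconstructions denote. Existence is a Riesz
representation for positive semidefinite forms on finitely many coefficients (\<open>riesz_coefficients\<close>);
uniqueness holds because a nonzero polynomial vanishes only on a null set
(\<open>AE_polynomial_nonzero\<close>). For the stress reconstruction, the data must not see the kernel of the
piecewise gradient, which is what the definition of the discrete divergence provides.\<close>

section \<open>Surface measure and projection along a direction\<close>

text \<open>After a rotation that moves a coordinate axis to \<open>e\<close>, only one column of the matrix differs from
the identity matrix, and Cramer's lemma gives the determinant.\<close>

lemma det_rank_one_update:
  fixes e w :: "real^'n"
  assumes "norm e = 1"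
  shows "det (matrix (\<lambda>y. y - (e \<bullet> y) *\<^sub>R w)) = 1 - e \<bullet> w"
proof -
  let ?L = "\<lambda>y. y - (e \<bullet> y) *\<^sub>R w"
  obtain k :: 'n where True by simp
  obtain q :: "real^'n \<Rightarrow> real^'n" where q: "orthogonal_transformation q" "q (axis k 1) = e"
    using orthogonal_transformation_exists[of "axis k 1" e] assms by (auto simp: norm_axis_1)
  have lin_q: "linear q" using q(1) by (rule orthogonal_transformation_linear)
  define Q where "Q = matrix q"
  have Q: "orthogonal_matrix Q" unfolding Q_def
    using q(1) orthogonal_transformation_matrix by blast
  have q_eq: "q x = Q *v x" for x
    unfolding Q_def using lin_q by (simp add: matrix_works)
  have lin_L: "linear ?L"
    by (auto intro!: linearI simp: inner_add_right algebra_simps)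
  define u where "u = axis k 1 - transpose Q *v w"
  have eq: "transpose Q ** matrix ?L ** Q = (\<chi> i j. if j = k then (mat 1 *v u) $ i else mat 1 $ i $ j)"
  proof -
    have "(transpose Q ** matrix ?L ** Q) *v x
        = (\<chi> i j. if j = k then (mat 1 *v u) $ i else mat 1 $ i $ j) *v x" for x
    proof -
      have "(transpose Q ** matrix ?L ** Q) *v x = transpose Q *v ?L (Q *v x)"
        using matrix_works[of ?L] lin_L by (simp add: matrix_vector_mul_assoc[symmetric] )
      also have "\<dots> = x - (e \<bullet> (Q *v x)) *\<^sub>R (transpose Q *v w)"
        using Q by (simp add: matrix_vector_mult_diff_distrib matrix_vector_mul_assoc
            orthogonal_matrix_def matrix_vector_mult_scaleR)
      also have "e \<bullet> (Q *v x) = x $ k"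
        using q(1) by (simp add: q(2)[symmetric] q_eq[symmetric] orthogonal_transformation_def inner_axis')
      also have "x - (x $ k) *\<^sub>R (transpose Q *v w)
          = (\<chi> i j. if j = k then (mat 1 *v u) $ i else mat 1 $ i $ j) *v x"
      proof (subst vec_eq_iff, rule allI)
        fix i
        have "(\<Sum>j\<in>UNIV. (if j = k then u $ i else mat 1 $ i $ j) * x $ j)
            = (\<Sum>j\<in>UNIV. (if j = k then (u $ i - mat 1 $ i $ j) * x $ j else 0) + mat 1 $ i $ j * x $ j)"
          by (rule sum.cong) (auto simp: algebra_simps)
        also have "\<dots> = (u $ i - mat 1 $ i $ k) * x $ k + (mat 1 *v x) $ i"
          by (simp add: sum.distrib matrix_vector_mult_def)
        also have "\<dots> = (x - (x $ k) *\<^sub>R (transpose Q *v w)) $ i"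
          by (simp only: matrix_vector_mul_lid) (auto simp: u_def axis_def mat_def algebra_simps)
        finally show "(x - (x $ k) *\<^sub>R (transpose Q *v w)) $ i
          = ((\<chi> i j. if j = k then (mat 1 *v u) $ i else mat 1 $ i $ j) *v x) $ i"
          by (simp only: matrix_vector_mult_def[of "\<chi> i j. if j = k then u $ i else mat 1 $ i $ j"]
              vec_lambda_beta matrix_vector_mul_lid)
      qed
      finally show ?thesis .
    qed
    then show ?thesis by (simp add: matrix_eq)
  qed
  have "det (transpose Q ** matrix ?L ** Q) = det (matrix ?L)"
  proof -
    have "det (transpose Q) * det Q = 1"
      using Q by (metis det_I det_mul orthogonal_matrix_def)
    then show ?thesis by (simp add: det_mul mult.commute mult.left_commute)
  qed
  moreover have "det (transpose Q ** matrix ?L ** Q) = u $ k"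
    unfolding eq by (subst cramer_lemma) simp
  moreover have "u $ k = 1 - e \<bullet> w"
  proof -
    have "(transpose Q *v w) $ k = axis k 1 \<bullet> (transpose Q *v w)" by (simp add: inner_axis')
    also have "\<dots> = (Q *v axis k 1) \<bullet> w"
      by (metis dot_lmul_matrix  transpose_matrix_vector vector_transpose_matrix inner_commute)
    also have "\<dots> = e \<bullet> w" using q(2) by (simp add: q_eq)
    finally show ?thesis by (simp add: u_def)
  qed
  ultimately show ?thesis by simp
qed

text \<open>The map sends the point at height \<open>t\<close> over \<open>p\<close>, where \<open>e \<bullet> p = c\<close>, to \<open>p - t *\<^sub>R a\<close>. It fixes the
hyperplane and turns the normal direction \<open>e\<close> into \<open>- a\<close>.\<close>

lemma lborel_shear_wellorder:
  fixes a e :: "real^('n::{finite,wellorder})"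
  assumes e: "norm e = 1" and a: "e \<bullet> a \<noteq> 0"
  shows "lborel = density (distr lborel borel (\<lambda>y. y - (e \<bullet> y - c) *\<^sub>R (e + a))) (\<lambda>_. ennreal \<bar>e \<bullet> a\<bar>)"
    (is "_ = density (distr _ _ ?\<Lambda>) _")
proof (rule lborel_eqI)
  let ?L = "\<lambda>y. y - (e \<bullet> y) *\<^sub>R (e + a)"
  \<comment> \<open>the inverse of the linear part \<open>?L\<close>\<close>
  let ?M = "\<lambda>z. z - ((e \<bullet> z) / (e \<bullet> a)) *\<^sub>R (e + a)"
  have ee: "e \<bullet> e = 1" using e by (simp add: norm_eq_1)
  have lin: "linear ?L" "linear ?M"
    by (auto intro!: linearI simp: inner_add_right algebra_simps add_divide_distrib)
  have det: "\<bar>det (matrix ?L)\<bar> = \<bar>e \<bullet> a\<bar>"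
    using det_rank_one_update[OF e, of "e + a"] ee by (simp add: inner_add_right)
  have inv1: "?M (?L y) = y" for y
    using a ee by (auto simp: inner_add_right inner_diff_right field_simps)
  have inv2: "?L (?M z) = z" for z
    using a ee by (auto simp: inner_add_right inner_diff_right field_simps)
  have meas[measurable]: "?\<Lambda> \<in> borel_measurable borel" by measurable
  fix l u :: "real^('n::{finite,wellorder})" assume lu: "\<And>b. b \<in> Basis \<Longrightarrow> l \<bullet> b \<le> u \<bullet> b"
  define P where "P = ?\<Lambda> -` box l u"
  have P_eq: "P = ?M ` ((\<lambda>z. - (c *\<^sub>R (e + a)) + z) ` box l u)"
  proof (safe)
    fix y assume "y \<in> P"
    then have "?\<Lambda> y \<in> box l u" by (simp add: P_def)
    moreover have "y = ?M (- (c *\<^sub>R (e + a)) + ?\<Lambda> y)"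
      using inv1[of y] by (simp add: algebra_simps)
    ultimately show "y \<in> ?M ` ((\<lambda>z. - (c *\<^sub>R (e + a)) + z) ` box l u)" by blast
  next
    fix z assume z: "z \<in> box l u"
    have "?\<Lambda> (?M (- (c *\<^sub>R (e + a)) + z)) = ?L (?M (- (c *\<^sub>R (e + a)) + z)) + c *\<^sub>R (e + a)"
      by (simp add: algebra_simps)
    also have "\<dots> = z" by (subst inv2) simp
    finally have "?\<Lambda> (?M (- (c *\<^sub>R (e + a)) + z)) = z" .
    then show "?M (- (c *\<^sub>R (e + a)) + z) \<in> P" unfolding P_def vimage_eq using z by (simp only:)
  qed
  have LP: "?L ` P = (\<lambda>z. - (c *\<^sub>R (e + a)) + z) ` box l u"
    unfolding P_eq image_image[of ?L ?M] inv2 by simp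
  have P_borel: "P \<in> sets borel"
    using measurable_sets[OF meas, of "box l u"] by (simp add: P_def)
  have P_lmeas: "P \<in> lmeasurable"
    unfolding P_eq by (intro measurable_linear_image lin measurable_translation lmeasurable_box)
  have "measure lebesgue (?L ` P) = \<bar>e \<bullet> a\<bar> * measure lebesgue P"
    using measure_linear_image[OF lin(1) P_lmeas] det by simp
  moreover have "measure lebesgue (?L ` P) = (\<Prod>b\<in>Basis. (u - l) \<bullet> b)"
    unfolding LP measure_translation using lu by (simp add: measure_completion measure_lborel_box_eq)
  ultimately have m: "\<bar>e \<bullet> a\<bar> * measure lebesgue P = (\<Prod>b\<in>Basis. (u - l) \<bullet> b)" by simp
  have "emeasure (density (distr lborel borel ?\<Lambda>) (\<lambda>_. ennreal \<bar>e \<bullet> a\<bar>)) (box l u)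
      = ennreal \<bar>e \<bullet> a\<bar> * emeasure lborel P"
    by (subst emeasure_density) (auto simp: nn_integral_cmult_indicator emeasure_distr P_def)
  also have "emeasure lborel P = emeasure lebesgue P" using P_borel by simp
  also have "\<dots> = ennreal (measure lebesgue P)" using P_lmeas by (simp add: emeasure_eq_measure2)
  also have "ennreal \<bar>e \<bullet> a\<bar> * ennreal (measure lebesgue P) = ennreal (\<Prod>b\<in>Basis. (u - l) \<bullet> b)"
    by (simp add: ennreal_mult[symmetric] m)
  finally show "emeasure (density (distr lborel borel ?\<Lambda>) (\<lambda>_. ennreal \<bar>e \<bullet> a\<bar>)) (box l u)
     = (\<Prod>b\<in>Basis. (u - l) \<bullet> b)" .
qed simp


text \<open>A copy of a finite type, ordered by an injection into the natural numbers. Relabelling the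
coordinates transfers the previous lemma to index types without an order.\<close>

typedef 'a ranked = "UNIV :: 'a set" morphisms unrank rank by simp

definition rank_code :: "'a::finite \<Rightarrow> nat" where
  "rank_code = (SOME f. inj f)"

lemma inj_rank_code: "inj rank_code"
  unfolding rank_code_def
  using finite_imp_inj_to_nat_seg[of "UNIV :: 'a set"] by (intro someI_ex[of inj]) auto

instance ranked :: (finite) finite
proof
  have "(UNIV :: 'a ranked set) = rank ` UNIV" by (metis UNIV_eq_I rangeI unrank_inverse)
  then show "finite (UNIV :: 'a ranked set)" by (metis finite finite_imageI)
qed

instantiation ranked :: (finite) wellorder
begin

definition less_eq_ranked :: "'a ranked \<Rightarrow> 'a ranked \<Rightarrow> bool" where
  "less_eq_ranked x y \<longleftrightarrow> rank_code (unrank x) \<le> rank_code (unrank y)"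

definition less_ranked :: "'a ranked \<Rightarrow> 'a ranked \<Rightarrow> bool" where
  "less_ranked x y \<longleftrightarrow> rank_code (unrank x) < rank_code (unrank y)"

instance
proof
  fix x y :: "'a ranked"
  assume "x \<le> y" "y \<le> x"
  then show "x = y"
    by (metis antisym inj_eq inj_rank_code less_eq_ranked_def unrank_inject)
next
  fix P :: "'a ranked \<Rightarrow> bool" and x
  assume ih: "\<And>x. (\<And>y. y < x \<Longrightarrow> P y) \<Longrightarrow> P x"
  show "P x"
  proof (induction x rule: measure_induct_rule[of "\<lambda>x. rank_code (unrank x)"])
    case (less x)
    show ?case by (rule ih, rule less.IH) (simp add: less_ranked_def)
  qed
qed (auto simp: less_eq_ranked_def less_ranked_def)

end

lemma bij_unrank: "bij unrank"
  by (rule bij_betw_byWitness[of _ rank]) (simp_all add: rank_inverse unrank_inverse)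

lemma all_ranked_iff: "(\<forall>i. P i) \<longleftrightarrow> (\<forall>j. P (rank j))"
proof safe
  fix i assume "\<forall>j. P (rank j)"
  then have "P (rank (unrank i))" by blast
  then show "P i" by (simp add: unrank_inverse)
qed simp

definition relabel :: "real^'n \<Rightarrow> real^('n ranked)" where
  "relabel x = (\<chi> i. x $ unrank i)"

definition unrelabel :: "real^('n ranked) \<Rightarrow> real^'n" where
  "unrelabel x = (\<chi> i. x $ rank i)"

lemma unrelabel_relabel [simp]: "unrelabel (relabel x) = x"
  and relabel_unrelabel [simp]: "relabel (unrelabel y) = y"
  by (simp_all add: unrelabel_def relabel_def rank_inverse unrank_inverse)

lemma inner_relabel: "relabel x \<bullet> relabel y = x \<bullet> y"
  unfolding relabel_def inner_vec_def vec_lambda_beta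
  using sum.reindex_bij_betw[OF bij_unrank, of "\<lambda>i. x $ i \<bullet> y $ i"] by simp

lemma norm_relabel: "norm (relabel x) = norm x"
  by (simp add: norm_eq_sqrt_inner inner_relabel)

lemma linear_unrelabel: "linear unrelabel"
  by (rule linearI) (simp_all add: unrelabel_def vec_eq_iff)

lemma linear_relabel: "linear relabel"
  by (rule linearI) (simp_all add: relabel_def vec_eq_iff)

lemma relabel_measurable [measurable]: "relabel \<in> borel_measurable borel"
  by (intro borel_measurable_continuous_onI linear_continuous_on) (simp add: linear_relabel linear_linear)

lemma unrelabel_measurable [measurable]: "unrelabel \<in> borel_measurable borel"
  by (intro borel_measurable_continuous_onI linear_continuous_on) (simp add: linear_unrelabel linear_linear)

lemma distr_relabel: "distr lborel borel relabel = (lborel :: (real^('n::finite ranked)) measure)"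
proof (rule lborel_eqI[symmetric])
  fix l u :: "real^('n ranked)" assume lu: "\<And>b. b \<in> Basis \<Longrightarrow> l \<bullet> b \<le> u \<bullet> b"
  have le: "l $ i \<le> u $ i" for i using lu[of "axis i 1"] by (simp add: inner_axis axis_in_Basis_iff)
  have box_eq: "relabel -` box l u = box (unrelabel l) (unrelabel u)"
    by (auto simp: mem_box_cart relabel_def unrelabel_def all_ranked_iff rank_inverse)
  have prod_cart: "(\<Prod>b\<in>Basis. (x :: real^'k) \<bullet> b) = (\<Prod>i\<in>UNIV. x $ i)" for x
    unfolding Basis_vec_def
    by (simp add: prod.UNION_disjoint axis_eq_axis inner_axis)
  have "emeasure (distr lborel borel relabel) (box l u) = emeasure lborel (box (unrelabel l) (unrelabel u))"
    by (subst emeasure_distr) (auto simp: box_eq)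
  also have "\<dots> = (\<Prod>i\<in>UNIV. (unrelabel u - unrelabel l) $ i)"
  proof (subst emeasure_lborel_box)
    show "unrelabel l \<bullet> b \<le> unrelabel u \<bullet> b" if "b \<in> Basis" for b
      using that le by (auto simp: Basis_vec_def inner_axis unrelabel_def)
  qed (simp add: prod_cart)
  also have "(\<Prod>i\<in>UNIV. (unrelabel u - unrelabel l) $ i) = (\<Prod>i\<in>UNIV. (u - l) $ i)"
    using prod.reindex_bij_betw[OF bij_unrank, of "\<lambda>i. (unrelabel u - unrelabel l) $ i"]
    by (simp add: unrelabel_def unrank_inverse)
  finally show "emeasure (distr lborel borel relabel) (box l u) = (\<Prod>b\<in>Basis. (u - l) \<bullet> b)"
    by (simp add: prod_cart)
qed simp

lemma distr_unrelabel: "distr lborel borel unrelabel = (lborel :: (real^'n) measure)"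
proof -
  have "(lborel :: (real^'n) measure) = distr lborel borel (unrelabel \<circ> relabel)"
    by (simp add: comp_def distr_id2)
  also have "\<dots> = distr (distr lborel borel relabel) borel unrelabel"
    by (subst distr_distr) auto
  finally show ?thesis by (simp add: distr_relabel)
qed

lemma lborel_shear:
  fixes a e :: "real^'n"
  assumes e: "norm e = 1" and a: "e \<bullet> a \<noteq> 0"
  shows "lborel = density (distr lborel borel (\<lambda>y. y - (e \<bullet> y - c) *\<^sub>R (e + a))) (\<lambda>_. ennreal \<bar>e \<bullet> a\<bar>)"
    (is "_ = density (distr _ _ ?\<Lambda>) _")
proof -
  let ?\<Lambda>' = "\<lambda>y. y - (relabel e \<bullet> y - c) *\<^sub>R (relabel e + relabel a)"
  have comm: "unrelabel (?\<Lambda>' y) = ?\<Lambda> (unrelabel y)" for y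
  proof -
    have "relabel e \<bullet> y = e \<bullet> unrelabel y"
      using inner_relabel[of e "unrelabel y"] by simp
    then show ?thesis
      by (simp add: linear_diff[OF linear_unrelabel] linear_add[OF linear_unrelabel] linear_scale[OF linear_unrelabel])
  qed
  have sh: "lborel = density (distr lborel borel ?\<Lambda>') (\<lambda>_. ennreal \<bar>e \<bullet> a\<bar>)"
    using lborel_shear_wellorder[of "relabel e" "relabel a" c] e a by (simp add: norm_relabel inner_relabel)
  have "lborel = distr (lborel :: (real^('n ranked)) measure) borel unrelabel"
    by (simp add: distr_unrelabel)
  also have "\<dots> = distr (density (distr lborel borel ?\<Lambda>') (\<lambda>_. ennreal \<bar>e \<bullet> a\<bar>)) borel unrelabel"
    by (subst sh) simp
  also have "\<dots> = density (distr (distr lborel borel ?\<Lambda>') borel unrelabel) (\<lambda>_. ennreal \<bar>e \<bullet> a\<bar>)"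
    by (rule density_distr[symmetric]) auto
  also have "distr (distr lborel borel ?\<Lambda>') borel unrelabel = distr (distr lborel borel unrelabel) borel ?\<Lambda>"
    by (subst (1 2) distr_distr) (auto simp: comp_def comm)
  finally show ?thesis by (simp add: distr_unrelabel)
qed

definition foot :: "'a::euclidean_space \<Rightarrow> real \<Rightarrow> 'a \<Rightarrow> 'a" where
  "foot e c y = y - (e \<bullet> y - c) *\<^sub>R e"

lemma foot_measurable [measurable]: "foot e c \<in> borel_measurable borel"
  unfolding foot_def by measurable

text \<open>The definition reads the offset of the hyperplane off a chosen point of the set; every point gives
the same value.\<close>

lemma surface_measure_eq:
  assumes "S \<noteq> {}" "S \<subseteq> {x. e \<bullet> x = c}"
  shows "surface_measure e S = restrict_space (hyperplane_measure e c) S"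
proof -
  have "(SOME x. x \<in> S) \<in> S" using assms(1) by (simp add: some_in_eq)
  then have "e \<bullet> (SOME x. x \<in> S) = c" using assms(2) by blast
  then show ?thesis by (simp add: surface_measure_def)
qed

lemma sets_hyperplane_measure [simp, measurable_cong]: "sets (hyperplane_measure e c) = sets borel"
  and space_hyperplane_measure [simp]: "space (hyperplane_measure e c) = UNIV"
  by (auto simp: hyperplane_measure_def)

lemma sets_surface_measure [measurable_cong]:
  "sets (surface_measure e S) = sets (restrict_space borel S)"
  unfolding surface_measure_def by (rule sets_restrict_space_cong) simp

lemma space_surface_measure [simp]: "space (surface_measure e S) = S"
  by (simp add: surface_measure_def space_restrict_space)

lemma foot_measurable_strip:
  "foot e c \<in> restrict_space lborel {x. c \<le> e \<bullet> x \<and> e \<bullet> x \<le> c + 1} \<rightarrow>\<^sub>M borel"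
  by (rule measurable_restrict_space1) simp

lemma hyperplane_measure_foot: "hyperplane_measure e c =
  distr (restrict_space lborel {x. c \<le> e \<bullet> x \<and> e \<bullet> x \<le> c + 1}) borel (foot e c)"
  by (simp add: hyperplane_measure_def foot_def[abs_def])

lemma emeasure_surface_measure:
  assumes "S \<in> sets borel" "S \<subseteq> {x. e \<bullet> x = c}" "B \<in> sets borel" "B \<subseteq> S" "S \<noteq> {}"
  shows "emeasure (surface_measure e S) B = emeasure lborel {y. c \<le> e \<bullet> y \<and> e \<bullet> y \<le> c + 1 \<and> foot e c y \<in> B}"
proof -
  have [measurable]: "B \<in> sets borel" by fact
  have "emeasure (surface_measure e S) B = emeasure (hyperplane_measure e c) B"
    unfolding surface_measure_eq[OF assms(5,2)] using assms by (subst emeasure_restrict_space) auto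
  also have "\<dots> = emeasure (restrict_space lborel {x. c \<le> e \<bullet> x \<and> e \<bullet> x \<le> c + 1})
     (foot e c -` B \<inter> space (restrict_space lborel {x. c \<le> e \<bullet> x \<and> e \<bullet> x \<le> c + 1}))"
    unfolding hyperplane_measure_foot using assms foot_measurable_strip by (subst emeasure_distr) auto
  also have "\<dots> = emeasure lborel {y. c \<le> e \<bullet> y \<and> e \<bullet> y \<le> c + 1 \<and> foot e c y \<in> B}"
    by (subst emeasure_restrict_space)
      (auto simp: space_restrict_space intro!: arg_cong[where f="emeasure lborel"])
  finally show ?thesis .
qed

lemma finite_measure_surface_measure:
  assumes "norm e = 1" "S \<in> sets borel" "S \<subseteq> {x. e \<bullet> x = c}" "bounded S" "S \<noteq> {}"
  shows "finite_measure (surface_measure e S)"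
proof
  obtain b where b: "\<And>x. x \<in> S \<Longrightarrow> norm x \<le> b" using assms(4) by (auto simp: bounded_iff)
  let ?B = "{y. c \<le> e \<bullet> y \<and> e \<bullet> y \<le> c + 1 \<and> foot e c y \<in> S}"
  have "norm y \<le> b + 1" if "y \<in> ?B" for y
  proof -
    have "norm y \<le> norm (foot e c y) + norm ((e \<bullet> y - c) *\<^sub>R e)"
      using norm_triangle_ineq[of "foot e c y" "(e \<bullet> y - c) *\<^sub>R e"] by (simp add: foot_def)
    also have "norm ((e \<bullet> y - c) *\<^sub>R e) \<le> 1" using that assms(1) by simp
    finally show ?thesis using b that by fastforce
  qed
  then have "bounded ?B" by (auto simp: bounded_iff)
  then have "emeasure lborel ?B < \<infinity>"
    by (metis emeasure_bounded_finite)
  then show "emeasure (surface_measure e S) (space (surface_measure e S)) \<noteq> \<infinity>"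
    using emeasure_surface_measure[OF assms(2,3,2) _ assms(5)] by simp
qed

lemma AE_surface_measureI:
  assumes "S \<in> sets borel" "S \<subseteq> {x. e \<bullet> x = c}" "S \<noteq> {}" "B \<in> sets borel"
    and "AE y in lborel. c \<le> e \<bullet> y \<and> e \<bullet> y \<le> c + 1 \<longrightarrow> foot e c y \<in> S \<inter> B \<longrightarrow> False"
    and "\<And>x. x \<in> S \<Longrightarrow> x \<notin> B \<Longrightarrow> P x"
  shows "AE x in surface_measure e S. P x"
proof (rule AE_I)
  have [measurable]: "S \<inter> B \<in> sets borel" using assms by simp
  show "{x \<in> space (surface_measure e S). \<not> P x} \<subseteq> S \<inter> B" using assms(6) by auto
  show "S \<inter> B \<in> sets (surface_measure e S)"
    using assms(1,4) by (auto simp: sets_surface_measure sets_restrict_space)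
  have "emeasure (surface_measure e S) (S \<inter> B)
    = emeasure lborel {y. c \<le> e \<bullet> y \<and> e \<bullet> y \<le> c + 1 \<and> foot e c y \<in> S \<inter> B}"
    using assms by (intro emeasure_surface_measure) auto
  also have "\<dots> = 0"
    using emeasure_eq_0_AE[of "\<lambda>y. c \<le> e \<bullet> y \<and> e \<bullet> y \<le> c + 1 \<and> foot e c y \<in> S \<inter> B" lborel]
      eventually_mono[OF assms(5)] by auto
  finally show "emeasure (surface_measure e S) (S \<inter> B) = 0" .
qed

lemma integral_surface_measure:
  fixes f :: "'a::euclidean_space \<Rightarrow> real"
  assumes "S \<in> sets borel" "S \<subseteq> {x. e \<bullet> x = c}" "S \<noteq> {}" and [measurable]: "f \<in> borel_measurable borel"
  shows "(LINT x|surface_measure e S. f x) =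
    (LINT y|lborel. indicator {y. c \<le> e \<bullet> y \<and> e \<bullet> y \<le> c + 1 \<and> foot e c y \<in> S} y * f (foot e c y))"
proof -
  have [measurable]: "S \<in> sets borel" by fact
  have "(LINT x|surface_measure e S. f x) = (LINT x|hyperplane_measure e c. indicator S x *\<^sub>R f x)"
    unfolding surface_measure_eq[OF assms(3,2)] by (rule integral_restrict_space) simp
  also have "\<dots> = (LINT y|restrict_space lborel {x. c \<le> e \<bullet> x \<and> e \<bullet> x \<le> c + 1}.
      indicator S (foot e c y) *\<^sub>R f (foot e c y))"
    unfolding hyperplane_measure_foot by (rule integral_distr[OF foot_measurable_strip]) measurable
  also have "\<dots> = (LINT y|lborel. indicator {x. c \<le> e \<bullet> x \<and> e \<bullet> x \<le> c + 1} y *\<^sub>R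
      (indicator S (foot e c y) *\<^sub>R f (foot e c y)))"
    by (rule integral_restrict_space) simp
  also have "\<dots> = (LINT y|lborel. indicator {y. c \<le> e \<bullet> y \<and> e \<bullet> y \<le> c + 1 \<and> foot e c y \<in> S} y * f (foot e c y))"
    by (intro Bochner_Integration.integral_cong) (auto simp: indicator_def)
  finally show ?thesis .
qed

text \<open>The parameter \<open>t\<close> at which the line \<open>x + t *\<^sub>R a\<close> crosses the hyperplane \<open>e \<bullet> y = c\<close>.\<close>

definition hit :: "'a::euclidean_space \<Rightarrow> real \<Rightarrow> 'a \<Rightarrow> 'a \<Rightarrow> real" where
  "hit e c a x = (c - e \<bullet> x) / (e \<bullet> a)"

lemma hit_unique:
  assumes "e \<bullet> a \<noteq> 0" "e \<bullet> (x + t *\<^sub>R a) = c"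
  shows "hit e c a x = t"
  using assms by (auto simp: hit_def inner_add_right field_simps)

lemma hit_measurable [measurable]: "hit e c a \<in> borel_measurable borel"
  unfolding hit_def by measurable

text \<open>The points \<open>x\<close> for which the segment from \<open>x\<close> to \<open>x + a\<close> meets the subset \<open>B\<close> of the hyperplane.\<close>

definition slanted_prism :: "'a::euclidean_space \<Rightarrow> real \<Rightarrow> 'a \<Rightarrow> 'a set \<Rightarrow> 'a set" where
  "slanted_prism e c a B = {x. hit e c a x \<in> {0..1} \<and> x + hit e c a x *\<^sub>R a \<in> B}"

lemma slanted_prism_measurable [measurable]:
  assumes [measurable]: "B \<in> sets borel"
  shows "slanted_prism e c a B \<in> sets borel"
proof -
  have "slanted_prism e c a B = {x\<in>space borel. hit e c a x \<in> {0..1} \<and> x + hit e c a x *\<^sub>R a \<in> B}"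
    by (simp add: slanted_prism_def)
  also have "\<dots> \<in> sets borel" by measurable
  finally show ?thesis .
qed

lemma hit_shear:
  fixes a e :: "'a::euclidean_space" and c :: real
  assumes "norm e = 1" and "e \<bullet> a \<noteq> 0"
  defines "\<Lambda> \<equiv> \<lambda>y. y - (e \<bullet> y - c) *\<^sub>R (e + a)"
  shows "hit e c a (\<Lambda> y) = e \<bullet> y - c" and "\<Lambda> y + hit e c a (\<Lambda> y) *\<^sub>R a = foot e c y"
proof -
  show h: "hit e c a (\<Lambda> y) = e \<bullet> y - c"
    using assms(1,2) by (simp add: hit_def \<Lambda>_def inner_add_right inner_diff_right norm_eq_1 field_simps)
  show "\<Lambda> y + hit e c a (\<Lambda> y) *\<^sub>R a = foot e c y"
    unfolding h by (simp add: \<Lambda>_def foot_def algebra_simps)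
qed

lemma shear_in_slanted_prism_iff:
  fixes a e :: "'a::euclidean_space" and c :: real
  assumes "norm e = 1" and "e \<bullet> a \<noteq> 0"
  shows "y - (e \<bullet> y - c) *\<^sub>R (e + a) \<in> slanted_prism e c a B \<longleftrightarrow>
    c \<le> e \<bullet> y \<and> e \<bullet> y \<le> c + 1 \<and> foot e c y \<in> B"
  unfolding slanted_prism_def mem_Collect_eq hit_shear(2)[OF assms] unfolding hit_shear(1)[OF assms] by auto

text \<open>The shear maps the straight prism, whose volume defines the surface measure, to the slanted one,
and the point where the segment of the image meets \<open>S\<close> is the foot of the original point.\<close>

lemma integral_slanted_prism:
  fixes a e :: "real^'n" and f :: "real^'n \<Rightarrow> real"
  assumes e: "norm e = 1" and a: "e \<bullet> a \<noteq> 0"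
    and S: "S \<in> sets borel" "S \<subseteq> {x. e \<bullet> x = c}" "S \<noteq> {}" and f[measurable]: "f \<in> borel_measurable borel"
  shows "(LINT x|lborel. indicator (slanted_prism e c a S) x * f (x + hit e c a x *\<^sub>R a))
    = \<bar>e \<bullet> a\<bar> * (LINT x|surface_measure e S. f x)"
proof -
  have [measurable]: "S \<in> sets borel" by fact
  let ?g = "\<lambda>x. indicator (slanted_prism e c a S) x * f (x + hit e c a x *\<^sub>R a)"
  let ?\<Lambda> = "\<lambda>y. y - (e \<bullet> y - c) *\<^sub>R (e + a)"
  have [measurable]: "?g \<in> borel_measurable borel" by measurable
  have "(LINT x|lborel. ?g x) = (LINT x|density (distr lborel borel ?\<Lambda>) (\<lambda>_. ennreal \<bar>e \<bullet> a\<bar>). ?g x)"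
    using lborel_shear[OF e a, of c] by simp
  also have "\<dots> = (LINT x|distr lborel borel ?\<Lambda>. \<bar>e \<bullet> a\<bar> *\<^sub>R ?g x)"
    by (rule integral_density) auto
  also have "\<dots> = (LINT y|lborel. \<bar>e \<bullet> a\<bar> *\<^sub>R ?g (?\<Lambda> y))"
    by (rule integral_distr) measurable
  also have "\<dots> = \<bar>e \<bullet> a\<bar> * (LINT y|lborel. ?g (?\<Lambda> y))" by simp
  also have "(LINT y|lborel. ?g (?\<Lambda> y)) = (LINT x|surface_measure e S. f x)"
    unfolding integral_surface_measure[OF S f]
    unfolding hit_shear(2)[OF e a] indicator_def shear_in_slanted_prism_iff[OF e a] by simp
  finally show ?thesis .
qed

lemma integrable_slanted_prism:
  fixes a e :: "real^'n" and f :: "real^'n \<Rightarrow> real"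
  assumes e: "norm e = 1" and a: "e \<bullet> a \<noteq> 0" and S: "compact S" and f: "continuous_on UNIV f"
  shows "integrable lborel (\<lambda>x. indicator (slanted_prism e c a S) x * f (x + hit e c a x *\<^sub>R a))"
proof -
  have cont: "continuous_on UNIV (\<lambda>x. hit e c a x)"
    unfolding hit_def using a by (intro continuous_intros) auto
  have "closed (slanted_prism e c a S)"
  proof -
    have eq: "slanted_prism e c a S = (\<lambda>x. hit e c a x) -` {0..1} \<inter> (\<lambda>x. x + hit e c a x *\<^sub>R a) -` S"
      by (auto simp: slanted_prism_def)
    show ?thesis unfolding eq
      by (intro closed_Int closed_vimage closed_atLeastAtMost compact_imp_closed[OF S] continuous_intros cont)
  qed
  moreover have "bounded (slanted_prism e c a S)"
  proof -
    have "slanted_prism e c a S \<subseteq> (\<lambda>(y, t). y - t *\<^sub>R a) ` (S \<times> {0..1})"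
    proof
      fix x assume "x \<in> slanted_prism e c a S"
      then have "(x + hit e c a x *\<^sub>R a, hit e c a x) \<in> S \<times> {0..1}"
        and "x = (\<lambda>(y, t). y - t *\<^sub>R a) (x + hit e c a x *\<^sub>R a, hit e c a x)"
        by (auto simp: slanted_prism_def)
      then show "x \<in> (\<lambda>(y, t). y - t *\<^sub>R a) ` (S \<times> {0..1})" by blast
    qed
    moreover have "compact ((\<lambda>(y, t). y - t *\<^sub>R a) ` (S \<times> {0..1::real}))"
      using S by (intro compact_continuous_image compact_Times) (auto simp: case_prod_unfold intro!: continuous_intros)
    ultimately show ?thesis using bounded_subset compact_imp_bounded by blast
  qed
  ultimately have "compact (slanted_prism e c a S)" by (simp add: compact_eq_bounded_closed)
  moreover have "continuous_on (slanted_prism e c a S) (\<lambda>x. f (x + hit e c a x *\<^sub>R a))"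
    by (intro continuous_on_compose2[OF f] continuous_intros continuous_on_subset[OF cont]) auto
  ultimately show ?thesis using borel_integrable_compact by fastforce
qed

text \<open>The exceptional points form the slanted prism over \<open>B\<close>, a sheared image of the straight prism,
which is a null set by definition of the surface measure.\<close>

lemma AE_line_misses_null_set:
  fixes a e :: "real^'n"
  assumes e: "norm e = 1" and a: "e \<bullet> a \<noteq> 0"
    and S: "S \<in> sets borel" "S \<subseteq> {x. e \<bullet> x = c}"
    and B: "B \<in> sets borel" "B \<subseteq> S" "emeasure (surface_measure e S) B = 0"
  shows "AE x in lborel. \<forall>t\<in>{0..1}. x + t *\<^sub>R a \<notin> B"
proof (cases "B = {}")
  case False
  then have ne: "S \<noteq> {}" using B(2) by blast
  have [measurable]: "B \<in> sets borel" by fact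
  let ?\<Lambda> = "\<lambda>y. y - (e \<bullet> y - c) *\<^sub>R (e + a)"
  have "emeasure lborel {y. c \<le> e \<bullet> y \<and> e \<bullet> y \<le> c + 1 \<and> foot e c y \<in> B} = 0"
    using emeasure_surface_measure[OF S B(1,2) ne] B(3) by simp
  then have "{y. c \<le> e \<bullet> y \<and> e \<bullet> y \<le> c + 1 \<and> foot e c y \<in> B} \<in> null_sets lborel"
    by (auto simp: null_sets_def)
  then have ae: "AE y in lborel. y \<notin> {y. c \<le> e \<bullet> y \<and> e \<bullet> y \<le> c + 1 \<and> foot e c y \<in> B}"
    by (rule AE_not_in)
  have "AE x in density (distr lborel borel ?\<Lambda>) (\<lambda>_. ennreal \<bar>e \<bullet> a\<bar>). x \<notin> slanted_prism e c a B"
  proof (subst AE_density, simp, rule AE_I2[THEN AE_mp])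
    show "AE x in distr lborel borel ?\<Lambda>. True \<longrightarrow> 0 < ennreal \<bar>e \<bullet> a\<bar> \<longrightarrow> x \<notin> slanted_prism e c a B"
      using ae by (subst AE_distr_iff) (simp_all add: shear_in_slanted_prism_iff[OF e a])
  qed simp
  then have "AE x in lborel. x \<notin> slanted_prism e c a B"
    by (subst lborel_shear[OF e a, of c])
  then show ?thesis
  proof (rule eventually_mono, safe)
    fix x t assume "x \<notin> slanted_prism e c a B" "t \<in> {0..1::real}" "x + t *\<^sub>R a \<in> B"
    moreover have "hit e c a x = t" using calculation B(2) S(2) by (intro hit_unique a) auto
    ultimately show False by (auto simp: slanted_prism_def)
  qed
qed simp

section \<open>Convex sets on the two sides of a hyperplane\<close>

lemma AE_not_in_closed_negligible:
  assumes "negligible N" "closed N"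
  shows "AE x in lborel. x \<notin> N"
proof (rule AE_not_in)
  have "N \<in> null_sets lebesgue" using assms(1) by (simp add: negligible_iff_null_sets)
  then show "N \<in> null_sets lborel"
    using assms(2) by (simp add: null_sets_completion_iff borel_closed)
qed

text \<open>The starting points of segments that meet the interior of \<open>K\<close> form an open convex set \<open>U\<close>, and
those of segments that meet \<open>K\<close> lie in its closure. The frontier of a convex set is negligible.\<close>

lemma AE_segment_meets_interior:
  fixes a :: "'a::euclidean_space"
  assumes K: "convex K" "interior K \<noteq> {}"
  shows "AE z in lborel. (\<exists>t\<in>{0..1}. z + t *\<^sub>R a \<in> K) \<longrightarrow> (\<exists>t\<in>{0..1}. z + t *\<^sub>R a \<in> interior K)"
proof -
  define U where "U = {z. \<exists>t\<in>{0..1}. z + t *\<^sub>R a \<in> interior K}"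
  have "convex U"
  proof (rule convexI)
    fix x y :: 'a and u v :: real
    assume uv: "0 \<le> u" "0 \<le> v" "u + v = 1" and "x \<in> U" "y \<in> U"
    then obtain s t where st: "s \<in> {0..1}" "x + s *\<^sub>R a \<in> interior K" "t \<in> {0..1}" "y + t *\<^sub>R a \<in> interior K"
      by (auto simp: U_def)
    have "u *\<^sub>R (x + s *\<^sub>R a) + v *\<^sub>R (y + t *\<^sub>R a) \<in> interior K"
      using convexD[OF convex_interior[OF K(1)] st(2,4) uv] .
    also have "u *\<^sub>R (x + s *\<^sub>R a) + v *\<^sub>R (y + t *\<^sub>R a) = (u *\<^sub>R x + v *\<^sub>R y) + (u * s + v * t) *\<^sub>R a"
      by (simp add: algebra_simps)
    finally have "(u *\<^sub>R x + v *\<^sub>R y) + (u * s + v * t) *\<^sub>R a \<in> interior K" .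
    moreover have "u * s + v * t \<in> {0..1}"
      using convexD[OF convex_real_interval(5)[of 0 1] st(1,3) uv] by simp
    ultimately show "u *\<^sub>R x + v *\<^sub>R y \<in> U" unfolding U_def by blast
  qed
  moreover have U_eq: "U = (\<Union>t\<in>{0..1}. (\<lambda>z. z + t *\<^sub>R a) -` interior K)"
    by (auto simp: U_def)
  have "open U"
    unfolding U_eq by (intro open_UN ballI open_vimage continuous_intros) auto
  ultimately have "AE z in lborel. z \<notin> frontier U"
    by (intro AE_not_in_closed_negligible negligible_convex_frontier frontier_closed)
  then show ?thesis
  proof (rule eventually_mono, intro impI, elim bexE)
    fix z t assume z: "z \<notin> frontier U" and t: "t \<in> {0..1::real}" "z + t *\<^sub>R a \<in> K"
    have "z + t *\<^sub>R a \<in> closure (interior K)"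
      using t(2) convex_closure_interior[OF K] closure_subset by blast
    then have "- (t *\<^sub>R a) + (z + t *\<^sub>R a) \<in> closure ((\<lambda>x. - (t *\<^sub>R a) + x) ` interior K)"
      unfolding closure_translation by blast
    moreover have "(\<lambda>x. - (t *\<^sub>R a) + x) ` interior K \<subseteq> U"
      using t(1) by (auto simp: U_def intro!: bexI[of _ t])
    ultimately have "z \<in> closure U" using closure_mono[of "(\<lambda>x. - (t *\<^sub>R a) + x) ` interior K" U] by auto
    then have "z \<in> U" using z \<open>open U\<close> by (simp add: frontier_def interior_open)
    then show "\<exists>t\<in>{0..1}. z + t *\<^sub>R a \<in> interior K" by (simp add: U_def)
  qed
qed

text \<open>The previous lemma for segments in normal direction: the points of the prism over an exceptional
set start segments that meet \<open>K\<close> but not its interior.\<close>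

lemma AE_surface_near_interior:
  fixes e :: "'a::euclidean_space"
  assumes e: "norm e = 1" and S: "closed S" "S \<subseteq> {x. e \<bullet> x = c}" "S \<noteq> {}"
    and K: "convex K" "closed K" "interior K \<noteq> {}"
  shows "AE x in surface_measure e S. x \<in> K \<longrightarrow> (\<exists>t\<in>{-1..1}. x + t *\<^sub>R e \<in> interior K)"
proof (rule AE_surface_measureI[OF _ S(2,3)])
  \<comment> \<open>\<open>?G\<close> is open, so the exceptional set is a Borel set\<close>
  let ?G = "\<Union>t\<in>{-1..1}. (\<lambda>x. x + t *\<^sub>R e) -` interior K"
  have "open ?G" by (intro open_UN ballI open_vimage continuous_intros) auto
  then show "K - ?G \<in> sets borel" using K(2) by (simp add: borel_closed borel_open sets.Diff)
  show "S \<in> sets borel" using S(1) by (rule borel_closed)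
  show "x \<in> K \<longrightarrow> (\<exists>t\<in>{-1..1}. x + t *\<^sub>R e \<in> interior K)" if "x \<notin> K - ?G" for x
    using that by auto
  show "AE y in lborel. c \<le> e \<bullet> y \<and> e \<bullet> y \<le> c + 1 \<longrightarrow> foot e c y \<in> S \<inter> (K - ?G) \<longrightarrow> False"
    using AE_segment_meets_interior[OF K(1,3), of "- e"]
  proof (rule eventually_mono, intro impI)
    fix y assume y: "c \<le> e \<bullet> y \<and> e \<bullet> y \<le> c + 1" "foot e c y \<in> S \<inter> (K - ?G)"
      and impl: "(\<exists>t\<in>{0..1}. y + t *\<^sub>R - e \<in> K) \<longrightarrow> (\<exists>t\<in>{0..1}. y + t *\<^sub>R - e \<in> interior K)"
    have "y + (e \<bullet> y - c) *\<^sub>R - e \<in> K" using y(2) by (simp add: foot_def)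
    moreover have "e \<bullet> y - c \<in> {0..1}" using y(1) by simp
    ultimately obtain t where t: "t \<in> {0..1}" "y + t *\<^sub>R - e \<in> interior K"
      using impl by blast
    have "foot e c y + (e \<bullet> y - c - t) *\<^sub>R e \<in> interior K"
      using t(2) by (simp add: foot_def algebra_simps)
    moreover have "e \<bullet> y - c - t \<in> {-1..1}" using t(1) y(1) by auto
    ultimately show False using y(2) by blast
  qed
qed

lemma AE_ex:
  assumes "AE x in M. P x" "emeasure M (space M) > 0"
  obtains x where "x \<in> space M" "P x"
proof -
  have "AE x in M. x \<in> space M \<and> P x" using assms(1) AE_space by eventually_elim simp
  moreover have "ae_filter M \<noteq> bot" using assms(2) by (simp add: ae_filter_eq_bot_iff)
  ultimately show ?thesis using that eventually_happens' by blast
qed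

lemma interior_shrink:
  fixes K :: "'a::euclidean_space set"
  assumes "convex K" "x \<in> K" "x + t *\<^sub>R e \<in> interior K" "0 < s" "s \<le> 1"
  shows "x + (s * t) *\<^sub>R e \<in> interior K"
  using mem_interior_closure_convex_shrink[OF assms(1,3) _ assms(4,5), of x] assms(2) closure_subset
  by (auto simp: algebra_simps)

lemma interior_halfspace_less:
  fixes e :: "'a::euclidean_space"
  assumes "K \<subseteq> {y. e \<bullet> y \<le> c}" "e \<noteq> 0"
  shows "interior K \<subseteq> {y. e \<bullet> y < c}"
  using interior_mono[OF assms(1)] assms(2) by simp

lemma interior_Int_halfspace_ne:
  fixes e :: "'a::euclidean_space"
  assumes "convex K" "interior K \<noteq> {}" "p \<in> K" "e \<bullet> p < c" "e \<noteq> 0"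
  shows "interior (K \<inter> {y. e \<bullet> y \<le> c}) \<noteq> {}"
proof -
  have "p \<in> closure (interior K)" using assms(1-3) closure_subset by (simp add: convex_closure_interior) blast
  moreover have "open {y. e \<bullet> y < c}" by (rule open_halfspace_lt)
  ultimately have "interior K \<inter> {y. e \<bullet> y < c} \<noteq> {}"
    using assms(4) open_Int_closure_eq_empty by fastforce
  then show ?thesis using assms(5) by (simp add: interior_Int)
qed

text \<open>If \<open>K\<close> had points strictly on both sides, then both halves of \<open>K\<close> would have interior, and from
almost every point of \<open>S\<close> the normal line would reach interior points of \<open>K\<close> in both directions. By
convexity these points of \<open>S\<close> would be interior points of \<open>K\<close>.\<close>

lemma one_sided:
  fixes e :: "'a::euclidean_space"
  assumes e: "norm e = 1" and S: "closed S" "S \<subseteq> {x. e \<bullet> x = c}"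
    and pos: "emeasure (surface_measure e S) S > 0"
    and K: "convex K" "closed K" "interior K \<noteq> {}" and SK: "S \<subseteq> K" "S \<inter> interior K = {}"
  shows "K \<subseteq> {y. e \<bullet> y \<le> c} \<or> K \<subseteq> {y. - e \<bullet> y \<le> - c}"
proof (rule ccontr)
  assume "\<not> ?thesis"
  then obtain p q where p: "p \<in> K" "e \<bullet> p < c" and q: "q \<in> K" "c < e \<bullet> q" by force
  have e0: "e \<noteq> 0" using e by auto
  have S0: "S \<noteq> {}" using pos by auto
  let ?K1 = "K \<inter> {y. e \<bullet> y \<le> c}" and ?K2 = "K \<inter> {y. - e \<bullet> y \<le> - c}"
  have conv: "convex ?K1" "convex ?K2" "closed ?K1" "closed ?K2"
    using K by (intro convex_Int closed_Int convex_halfspace_le closed_halfspace_le; simp)+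
  have "interior ?K1 \<noteq> {}" by (rule interior_Int_halfspace_ne[OF K(1,3) p e0])
  moreover have "interior ?K2 \<noteq> {}"
    using q e0 by (intro interior_Int_halfspace_ne[OF K(1,3) q(1)]) auto
  ultimately have ae: "AE x in surface_measure e S.
      (x \<in> ?K1 \<longrightarrow> (\<exists>t\<in>{-1..1}. x + t *\<^sub>R e \<in> interior ?K1)) \<and>
      (x \<in> ?K2 \<longrightarrow> (\<exists>t\<in>{-1..1}. x + t *\<^sub>R e \<in> interior ?K2))"
    by (intro AE_conjI AE_surface_near_interior[OF e S S0] conv)
  have pos': "emeasure (surface_measure e S) (space (surface_measure e S)) > 0" using pos by simp
  obtain x where x': "x \<in> space (surface_measure e S)"
    and x12: "(x \<in> ?K1 \<longrightarrow> (\<exists>t\<in>{-1..1}. x + t *\<^sub>R e \<in> interior ?K1)) \<and>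
      (x \<in> ?K2 \<longrightarrow> (\<exists>t\<in>{-1..1}. x + t *\<^sub>R e \<in> interior ?K2))"
    by (rule AE_ex[OF ae pos'])
  have x: "x \<in> S" using x' by simp
  have exc: "e \<bullet> x = c" and xK: "x \<in> K" using x S(2) SK(1) by auto
  obtain t where t: "x + t *\<^sub>R e \<in> interior ?K1" using x12 exc xK by auto
  obtain u where u: "x + u *\<^sub>R e \<in> interior ?K2" using x12 exc xK by auto
  have "t < 0" using t interior_halfspace_less[of ?K1 e c] e0 exc e by (auto simp: inner_add_right norm_eq_1)
  have "u > 0" using u interior_halfspace_less[of ?K2 "- e" "- c"] e0 exc e by (auto simp: inner_add_right norm_eq_1)
  have "x + t *\<^sub>R e \<in> interior K" "x + u *\<^sub>R e \<in> interior K"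
    using t u by (auto simp: interior_Int)
  have sum1: "u / (u - t) + (- t / (u - t)) = 1"
    using \<open>t < 0\<close> \<open>u > 0\<close> by (simp flip: diff_divide_distrib)
  from \<open>x + t *\<^sub>R e \<in> interior K\<close> \<open>x + u *\<^sub>R e \<in> interior K\<close>
    convexD[OF convex_interior[OF K(1)], of "x + t *\<^sub>R e" "x + u *\<^sub>R e" "u / (u - t)" "- t / (u - t)"]
  have "(u / (u - t)) *\<^sub>R (x + t *\<^sub>R e) + (- t / (u - t)) *\<^sub>R (x + u *\<^sub>R e) \<in> interior K"
    using \<open>t < 0\<close> \<open>u > 0\<close> sum1 by (simp add: divide_le_0_iff)
  also have "(u / (u - t)) *\<^sub>R (x + t *\<^sub>R e) + (- t / (u - t)) *\<^sub>R (x + u *\<^sub>R e)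
    = (u / (u - t) + (- t / (u - t))) *\<^sub>R x + (u / (u - t) * t + (- t / (u - t)) * u) *\<^sub>R e"
    by (simp add: algebra_simps)
  also note sum1
  also have "u / (u - t) * t + (- t / (u - t)) * u = 0" by simp
  finally have "x \<in> interior K" by simp
  with x SK(2) show False by blast
qed

lemma interior_Int_eq_empty:
  fixes K :: "'a::euclidean_space set"
  assumes "emeasure lborel (K \<inter> L) = 0" "closed K" "closed L"
  shows "interior K \<inter> interior L = {}"
proof (rule ccontr)
  assume "interior K \<inter> interior L \<noteq> {}"
  moreover have "interior K \<inter> interior L \<subseteq> K \<inter> L" using interior_subset by blast
  moreover have "negligible (K \<inter> L)"
    using assms by (auto simp: negligible_iff_null_sets null_sets_completion_iff null_sets_def borel_closed)
  ultimately show False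
    using open_not_negligible[of "interior K \<inter> interior L"] negligible_subset by (metis open_Int open_interior)
qed

text \<open>Every point of the convex set \<open>L\<close> is a limit of interior points of \<open>L\<close>.\<close>

lemma touching_misses_interior:
  fixes K :: "'a::euclidean_space set"
  assumes "interior K \<inter> interior L = {}" "convex L" "interior L \<noteq> {}" "S \<subseteq> L"
  shows "S \<inter> interior K = {}"
proof -
  have "interior K \<inter> closure (interior L) = {}"
    using assms(1) open_Int_closure_eq_empty[OF open_interior] by blast
  then show ?thesis using assms closure_subset[of L] convex_closure_interior[of L] by blast
qed

lemma interiors_meet_on_same_side:
  fixes K :: "'a::euclidean_space set"
  assumes "convex K" "convex L" "x \<in> K" "x \<in> L" "x + t *\<^sub>R e \<in> interior K" "x + u *\<^sub>R e \<in> interior L" "t * u > 0"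
  shows "interior K \<inter> interior L \<noteq> {}"
proof (cases "\<bar>t\<bar> \<le> \<bar>u\<bar>")
  case True
  have "u \<noteq> 0" using assms(7) by auto
  then have "x + (t / u * u) *\<^sub>R e \<in> interior L"
    using assms True by (intro interior_shrink[OF assms(2,4,6)])
      (auto simp: zero_less_mult_iff zero_less_divide_iff divide_le_eq)
  then show ?thesis using \<open>u \<noteq> 0\<close> assms(5) by auto
next
  case False
  have "t \<noteq> 0" using assms(7) by auto
  then have "x + (u / t * t) *\<^sub>R e \<in> interior K"
    using assms False by (intro interior_shrink[OF assms(1,3,5)])
      (auto simp: zero_less_mult_iff zero_less_divide_iff divide_le_eq)
  then show ?thesis using \<open>t \<noteq> 0\<close> assms(6) by auto
qed

lemma AE_surface_inside:
  fixes e :: "'a::euclidean_space"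
  assumes e: "norm e = 1" and S: "closed S" "S \<subseteq> {x. e \<bullet> x = c}" "S \<noteq> {}"
    and K: "convex K" "closed K" "interior K \<noteq> {}" and side: "K \<subseteq> {y. e \<bullet> y \<le> c}"
  shows "AE x in surface_measure e S. x \<in> K \<longrightarrow>
    (\<exists>\<epsilon>>0. \<forall>t\<in>{0<..<\<epsilon>}. x - t *\<^sub>R e \<in> interior K \<and> x + t *\<^sub>R e \<notin> K)"
  using AE_surface_near_interior[OF e S K] AE_space
proof eventually_elim
  case (elim x)
  show ?case
  proof
    assume xK: "x \<in> K"
    have exc: "e \<bullet> x = c" using elim(2) S(2) by auto
    obtain t where t: "x + t *\<^sub>R e \<in> interior K" using elim(1) xK by auto
    have "e \<noteq> 0" using e by auto
    then have "t < 0" using t interior_halfspace_less[OF side] exc e by (auto simp: inner_add_right norm_eq_1)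
    show "\<exists>\<epsilon>>0. \<forall>t\<in>{0<..<\<epsilon>}. x - t *\<^sub>R e \<in> interior K \<and> x + t *\<^sub>R e \<notin> K"
    proof (intro exI[of _ "- t"] conjI ballI)
      fix u assume u: "u \<in> {0<..<- t}"
      have "x + (u / (- t) * t) *\<^sub>R e \<in> interior K"
        using u \<open>t < 0\<close> by (intro interior_shrink[OF K(1) xK t]) (auto simp: field_simps)
      then show "x - u *\<^sub>R e \<in> interior K" using \<open>t < 0\<close> by simp
      show "x + u *\<^sub>R e \<notin> K" using side u exc e by (auto simp: inner_add_right norm_eq_1)
    qed (use \<open>t < 0\<close> in auto)
  qed
qed

text \<open>The two prisms, built on opposite sides of the hyperplane, are translates of each other.\<close>

lemma surface_measure_uminus:
  assumes e: "norm (e :: 'a::euclidean_space) = 1" and S: "closed S" "S \<subseteq> {x. e \<bullet> x = c}" "S \<noteq> {}"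
  shows "surface_measure (- e) S = surface_measure e S"
proof (rule measure_eqI)
  show "sets (surface_measure (- e) S) = sets (surface_measure e S)"
    by (simp add: sets_surface_measure)
  fix B assume "B \<in> sets (surface_measure (- e) S)"
  then have B: "B \<subseteq> S" "B \<in> sets borel"
    using borel_closed[OF S(1)] by (auto simp: sets_surface_measure sets_restrict_space)
  note B(2)[measurable]
  have Sb: "S \<in> sets borel" using S(1) by (rule borel_closed)
  have foot_eq: "foot (- e) (- c) = foot e c" by (auto simp: foot_def algebra_simps)
  have shift: "foot e c (e + y) = foot e c y" for y
    using e by (simp add: foot_def inner_add_right norm_eq_1 algebra_simps)
  have ee: "e \<bullet> e = 1" using e by (simp add: norm_eq_1)
  have "emeasure (surface_measure e S) B = emeasure lborel {y. c \<le> e \<bullet> y \<and> e \<bullet> y \<le> c + 1 \<and> foot e c y \<in> B}"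
    using Sb S(2,3) B by (intro emeasure_surface_measure) auto
  also have "\<dots> = emeasure (distr lborel borel ((+) e)) {y. c \<le> e \<bullet> y \<and> e \<bullet> y \<le> c + 1 \<and> foot e c y \<in> B}"
    by (simp add: lborel_distr_plus)
  also have "\<dots> = emeasure lborel {y. c - 1 \<le> e \<bullet> y \<and> e \<bullet> y \<le> c \<and> foot e c y \<in> B}"
    by (subst emeasure_distr)
       (auto simp: shift inner_add_right ee vimage_def intro!: arg_cong[where f="emeasure lborel"])
  also have "\<dots> = emeasure (surface_measure (- e) S) B"
    using Sb S(2,3) B by (subst emeasure_surface_measure[of S "- e" "- c"])
      (auto simp: foot_eq intro!: arg_cong[where f="emeasure lborel"])
  finally show "emeasure (surface_measure (- e) S) B = emeasure (surface_measure e S) B" ..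
qed

text \<open>Both sets are one-sided. If they were on the same side, then from a common point of \<open>S\<close> the normal
line would enter both interiors in the same direction.\<close>

lemma opposite_sides:
  fixes e :: "'a::euclidean_space"
  assumes e: "norm e = 1" and S: "closed S" "S \<subseteq> {x. e \<bullet> x = c}"
    and pos: "emeasure (surface_measure e S) S > 0"
    and K: "convex K" "closed K" "interior K \<noteq> {}" "S \<subseteq> K"
    and L: "convex L" "closed L" "interior L \<noteq> {}" "S \<subseteq> L"
    and disj: "interior K \<inter> interior L = {}"
  shows "K \<subseteq> {y. e \<bullet> y \<le> c} \<and> L \<subseteq> {y. - e \<bullet> y \<le> - c} \<or> K \<subseteq> {y. - e \<bullet> y \<le> - c} \<and> L \<subseteq> {y. e \<bullet> y \<le> c}"
proof -
  have S0: "S \<noteq> {}" using pos by auto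
  have e0: "e \<noteq> 0" using e by auto
  have ee: "e \<bullet> e = 1" using e by (simp add: norm_eq_1)
  have "S \<inter> interior K = {}" using touching_misses_interior[OF disj L(1,3,4)] .
  then have K1: "K \<subseteq> {y. e \<bullet> y \<le> c} \<or> K \<subseteq> {y. - e \<bullet> y \<le> - c}"
    using one_sided[OF e S pos K] by blast
  have "S \<inter> interior L = {}" using touching_misses_interior[OF _ K(1,3,4)] disj by blast
  then have L1: "L \<subseteq> {y. e \<bullet> y \<le> c} \<or> L \<subseteq> {y. - e \<bullet> y \<le> - c}"
    using one_sided[OF e S pos L] by blast
  have ae: "AE x in surface_measure e S. (x \<in> K \<longrightarrow> (\<exists>t\<in>{-1..1}. x + t *\<^sub>R e \<in> interior K)) \<and>
      (x \<in> L \<longrightarrow> (\<exists>t\<in>{-1..1}. x + t *\<^sub>R e \<in> interior L))"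
    using K L by (intro AE_conjI AE_surface_near_interior[OF e S S0]) auto
  have pos': "emeasure (surface_measure e S) (space (surface_measure e S)) > 0" using pos by simp
  obtain x where x': "x \<in> space (surface_measure e S)"
    and xKL: "(x \<in> K \<longrightarrow> (\<exists>t\<in>{-1..1}. x + t *\<^sub>R e \<in> interior K)) \<and>
      (x \<in> L \<longrightarrow> (\<exists>t\<in>{-1..1}. x + t *\<^sub>R e \<in> interior L))"
    by (rule AE_ex[OF ae pos'])
  have x: "x \<in> S" using x' by simp
  have mem: "x \<in> K" "x \<in> L" and exc: "e \<bullet> x = c" using x K(4) L(4) S(2) by auto
  obtain t u where t: "x + t *\<^sub>R e \<in> interior K" and u: "x + u *\<^sub>R e \<in> interior L"
    using xKL mem by auto
  have no: "\<not> t * u > 0"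
    using interiors_meet_on_same_side[OF K(1) L(1) mem t u] disj by blast
  have neg: "s < 0" if "x + s *\<^sub>R e \<in> interior A" "A \<subseteq> {y. e \<bullet> y \<le> c}" for s A
    using that(1) interior_halfspace_less[OF that(2) e0] exc ee by (auto simp: inner_add_right)
  have ps: "s > 0" if "x + s *\<^sub>R e \<in> interior A" "A \<subseteq> {y. - e \<bullet> y \<le> - c}" for s A
    using that(1) interior_halfspace_less[OF that(2)] e0 exc ee by (auto simp: inner_add_right)
  show ?thesis
    using K1 L1 neg[OF t] neg[OF u] ps[OF t] ps[OF u] no by (auto simp: zero_less_mult_iff)
qed

section \<open>The divergence theorem for convex bodies\<close>

text \<open>The last point of a segment in \<open>K\<close> is the end point of the segment if that lies in \<open>K\<close>, and
otherwise the point at which the segment leaves \<open>K\<close> through a face whose outer normal \<open>n S\<close> makes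
an acute angle with \<open>a\<close>. All other such faces are missed by the segment, so that the sum over the
faces has at most one nonzero summand. Points of entry are covered by reversing the segment.\<close>

lemma exit_point:
  fixes f :: "'a::euclidean_space \<Rightarrow> real" and F :: "'a set set"
  assumes K: "convex K" "compact K" and F: "finite F"
    and face: "\<And>S. S \<in> F \<Longrightarrow> S \<subseteq> K \<and> S \<subseteq> {y. n S \<bullet> y = c S} \<and> K \<subseteq> {y. n S \<bullet> y \<le> c S} \<and> n S \<noteq> 0"
    and end_pt: "x + a \<notin> frontier K"
    and meets: "t0 \<in> {0..1}" "x + t0 *\<^sub>R a \<in> interior K"
    and transversal: "\<And>S t. S \<in> F \<Longrightarrow> n S \<bullet> a = 0 \<Longrightarrow> t \<in> {0..1} \<Longrightarrow> x + t *\<^sub>R a \<notin> S"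
    and cover: "\<And>t. t \<in> {0..1} \<Longrightarrow> x + t *\<^sub>R a \<in> frontier K \<Longrightarrow> \<exists>S\<in>F. x + t *\<^sub>R a \<in> S"
    and unique: "\<And>S S' t. S \<in> F \<Longrightarrow> S' \<in> F \<Longrightarrow> S \<noteq> S' \<Longrightarrow> t \<in> {0..1} \<Longrightarrow> x + t *\<^sub>R a \<in> S \<Longrightarrow> x + t *\<^sub>R a \<notin> S'"
    and seg: "{t \<in> {0..1}. x + t *\<^sub>R a \<in> K} = {\<alpha>..\<beta>}"
  shows "f (x + \<beta> *\<^sub>R a) = indicator K (x + a) * f (x + a) +
    (\<Sum>S\<in>F. if n S \<bullet> a > 0
       then indicator (slanted_prism (n S) (c S) a S) x * f (x + hit (n S) (c S) a x *\<^sub>R a) else 0)"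
    (is "_ = _ + (\<Sum>S\<in>F. ?g S)")
proof -
  have t0J: "t0 \<in> {\<alpha>..\<beta>}" using seg meets interior_subset by blast
  then have "\<beta> \<in> {\<alpha>..\<beta>}" by simp
  then have \<beta>: "\<beta> \<in> {0..1}" "x + \<beta> *\<^sub>R a \<in> K" using seg by blast+
  have le_\<beta>: "t \<le> \<beta>" if "t \<in> {0..1}" "x + t *\<^sub>R a \<in> K" for t
  proof -
    have "t \<in> {\<alpha>..\<beta>}" using that seg by blast
    then show ?thesis by simp
  qed
  have strict: "n S \<bullet> y < c S" if "S \<in> F" "y \<in> interior K" for S y
    using interior_halfspace_less[of K "n S" "c S"] face[OF that(1)] that(2) by auto
  have hits: "?g S = (if n S \<bullet> a > 0 then f (x + t *\<^sub>R a) else 0)"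
    if "S \<in> F" "t \<in> {0..1}" "x + t *\<^sub>R a \<in> S" for S t
  proof (cases "n S \<bullet> a > 0")
    case True
    have "hit (n S) (c S) a x = t"
      using True face[OF that(1)] that(3) by (intro hit_unique) auto
    then show ?thesis using True that by (simp add: slanted_prism_def)
  qed simp
  have hit_last: "t = \<beta>" if "S \<in> F" "n S \<bullet> a > 0" "t \<in> {0..1}" "x + t *\<^sub>R a \<in> S" for S t
  proof -
    have "t \<le> \<beta>" using le_\<beta> that face by blast
    moreover have "\<beta> \<le> t"
    proof -
      have "n S \<bullet> (x + \<beta> *\<^sub>R a) \<le> n S \<bullet> (x + t *\<^sub>R a)" proof -
        have "n S \<bullet> (x + \<beta> *\<^sub>R a) \<le> c S" "n S \<bullet> (x + t *\<^sub>R a) = c S"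
          using face[OF that(1)] \<beta>(2) that(4) by blast+
        then show ?thesis by simp
      qed
      then show ?thesis using that(2) by (simp add: inner_add_right)
    qed
    ultimately show ?thesis by simp
  qed
  have no_hit: "?g S = 0" if "S \<in> F" "\<not> (n S \<bullet> a > 0 \<and> x + \<beta> *\<^sub>R a \<in> S)" for S
  proof -
    have "x \<notin> slanted_prism (n S) (c S) a S" if "n S \<bullet> a > 0"
      using hit_last[OF \<open>S \<in> F\<close> that] \<open>\<not> (_ \<and> _)\<close> that by (auto simp: slanted_prism_def)
    then show ?thesis by simp
  qed
  show ?thesis
  proof (cases "x + a \<in> K")
    case True
    then have "\<beta> = 1" using le_\<beta>[of 1] \<beta>(1) by simp
    have "x + a \<in> interior K" using True end_pt K(2) by (simp add: frontier_def compact_imp_closed)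
    then have "x + a \<notin> S" if "S \<in> F" for S using strict[OF that] face[OF that] by fastforce
    then have "(\<Sum>S\<in>F. ?g S) = 0" using \<open>\<beta> = 1\<close> by (intro sum.neutral) (auto simp: no_hit)
    then show ?thesis using True \<open>\<beta> = 1\<close> by simp
  next
    case False
    then have "\<beta> < 1" using \<beta> by (cases "\<beta> = 1") auto
    \<comment> \<open>otherwise the segment would stay in \<open>K\<close> beyond \<open>\<beta>\<close>\<close>
    have "x + \<beta> *\<^sub>R a \<notin> interior K"
    proof
      have tend: "((\<lambda>t. x + t *\<^sub>R a) \<longlongrightarrow> x + \<beta> *\<^sub>R a) (at_right \<beta>)"
        by (intro tendsto_intros)
      assume "x + \<beta> *\<^sub>R a \<in> interior K"
      then have "\<forall>\<^sub>F t in at_right \<beta>. x + t *\<^sub>R a \<in> interior K"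
        by (rule topological_tendstoD[OF tend open_interior])
      then have "\<forall>\<^sub>F t in at_right \<beta>. t \<in> {\<beta><..<1} \<and> x + t *\<^sub>R a \<in> interior K"
        using eventually_at_right_real[OF \<open>\<beta> < 1\<close>] by eventually_elim simp
      then obtain t where "t \<in> {\<beta><..<1}" "x + t *\<^sub>R a \<in> interior K"
        using eventually_happens[of _ "at_right \<beta>"] by (auto simp: trivial_limit_at_right_real)
      then show False using le_\<beta>[of t] \<beta>(1) interior_subset by force
    qed
    then have "x + \<beta> *\<^sub>R a \<in> frontier K" using \<beta>(2) closure_subset by (auto simp: frontier_def)
    then obtain S where S: "S \<in> F" "x + \<beta> *\<^sub>R a \<in> S" using cover \<beta>(1) by blast
    have "n S \<bullet> a > 0"
    proof -
      have "n S \<bullet> (x + t0 *\<^sub>R a) < n S \<bullet> (x + \<beta> *\<^sub>R a)"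
        using strict[OF S(1) meets(2)] face[OF S(1)] S(2) by auto
      then have "0 < (\<beta> - t0) * (n S \<bullet> a)" by (simp add: inner_add_right algebra_simps)
      then show ?thesis using t0J by (auto simp: zero_less_mult_iff)
    qed
    have "(\<Sum>S\<in>F. ?g S) = ?g S + (\<Sum>S\<in>F - {S}. ?g S)" using F S(1) by (rule sum.remove)
    also have "(\<Sum>S\<in>F - {S}. ?g S) = 0"
    proof (intro sum.neutral ballI)
      fix S' assume "S' \<in> F - {S}"
      then show "?g S' = 0" using unique[OF S(1) _ _ \<beta>(1) S(2)] by (intro no_hit) auto
    qed
    also have "?g S = f (x + \<beta> *\<^sub>R a)" using hits[OF S(1) \<beta>(1) S(2)] \<open>n S \<bullet> a > 0\<close> by simp
    finally show ?thesis using False by simp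
  qed
qed

lemma hit_reverse: "e \<bullet> a \<noteq> 0 \<Longrightarrow> hit e c (- a) (x + a) = 1 - hit e c a x"
  by (simp add: hit_def inner_add_right field_simps)

lemma slanted_prism_reverse:
  "e \<bullet> a \<noteq> 0 \<Longrightarrow> x + a \<in> slanted_prism e c (- a) B \<longleftrightarrow> x \<in> slanted_prism e c a B"
  unfolding slanted_prism_def mem_Collect_eq hit_reverse by (auto simp: algebra_simps)

text \<open>The empty set is treated separately because the surface measure locates the hyperplane by a point
of the set.\<close>

definition flat_null :: "'a::euclidean_space set \<Rightarrow> bool" where
  "flat_null B \<longleftrightarrow> B \<in> sets borel \<and> (\<exists>e c. norm e = 1 \<and> B \<subseteq> {x. e \<bullet> x = c} \<and>
     (B \<noteq> {} \<longrightarrow> emeasure (surface_measure e B) B = 0))"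

lemma AE_line_misses_hyperplane:
  assumes "norm e = 1" "e \<bullet> a = 0"
  shows "AE x in lborel. \<forall>t::real. e \<bullet> (x + t *\<^sub>R a) \<noteq> c"
proof -
  have "negligible {x. e \<bullet> x = c}" "closed {x. e \<bullet> x = c}"
    using assms(1) by (auto intro!: negligible_hyperplane closed_hyperplane)
  from AE_not_in_closed_negligible[OF this] show ?thesis
    by (rule eventually_mono) (use assms(2) in \<open>simp add: inner_add_right\<close>)
qed

lemma AE_line_misses_flat_null:
  fixes a :: "real^'n"
  assumes "flat_null B"
  shows "AE x in lborel. \<forall>t\<in>{0..1}. x + t *\<^sub>R a \<notin> B"
proof (cases "B = {}")
  case False
  from assms False obtain e c where e: "norm e = 1" "B \<subseteq> {x. e \<bullet> x = c}" "emeasure (surface_measure e B) B = 0"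
    and B: "B \<in> sets borel" by (auto simp: flat_null_def)
  show ?thesis
  proof (cases "e \<bullet> a = 0")
    case True
    show ?thesis using AE_line_misses_hyperplane[OF e(1) True, of c]
      by (rule eventually_mono) (use e(2) in auto)
  qed (use AE_line_misses_null_set[OF e(1) _ B e(2) B order_refl e(3)] in blast)
qed simp

lemma integral_translate_lborel:
  fixes f :: "'a::euclidean_space \<Rightarrow> real"
  assumes [measurable]: "f \<in> borel_measurable borel"
  shows "(LINT x|lborel. f (x + v)) = (LINT x|lborel. f x)"
    and "integrable lborel f \<Longrightarrow> integrable lborel (\<lambda>x. f (x + v))"
proof -
  have eq: "lborel = distr lborel borel ((+) v)" by (simp add: lborel_distr_plus)
  have "(LINT x|lborel. f x) = (LINT x|distr lborel borel ((+) v). f x)"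
    using eq by simp
  also have "\<dots> = (LINT x|lborel. f (x + v))"
    by (subst integral_distr) (auto simp: add.commute)
  finally show "(LINT x|lborel. f (x + v)) = (LINT x|lborel. f x)" ..
  assume "integrable lborel f"
  then have "integrable (distr lborel borel ((+) v)) f" using eq by simp
  then show "integrable lborel (\<lambda>x. f (x + v))"
    by (subst (asm) integrable_distr_eq) (auto simp: add.commute)
qed

text \<open>Translation invariance and Fubini: for each fixed parameter \<open>t\<close>, the integral over \<open>x\<close> does not depend
on \<open>t\<close>.\<close>

lemma integral_along_segments:
  fixes f :: "'a::euclidean_space \<Rightarrow> real"
  assumes K: "compact K" and f: "continuous_on UNIV f"
  shows "(LINT x|lborel. (LINT t|lborel. indicator {0..1} t * (indicator K (x + t *\<^sub>R a) * f (x + t *\<^sub>R a))))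
    = (LINT x|lborel. indicator K x * f x)"
    and "(\<lambda>x. LINT t|lborel. indicator {0..1} t * (indicator K (x + t *\<^sub>R a) * f (x + t *\<^sub>R a)))
      \<in> borel_measurable lborel"
proof -
  let ?h = "\<lambda>x t. indicator {0..1} t * (indicator K (x + t *\<^sub>R a) * f (x + t *\<^sub>R a)) :: real"
  let ?C = "(\<lambda>(y, t). (y - t *\<^sub>R a, t)) ` (K \<times> {0..1::real})"
  have Kb[measurable]: "K \<in> sets borel" using K by (simp add: borel_compact)
  have fb[measurable]: "f \<in> borel_measurable borel" using f by (rule borel_measurable_continuous_onI)
  have "compact ?C"
    using K by (intro compact_continuous_image compact_Times) (auto simp: case_prod_unfold intro!: continuous_intros)
  moreover have "continuous_on ?C (\<lambda>(x, t). f (x + t *\<^sub>R a))"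
    unfolding case_prod_unfold by (intro continuous_on_compose2[OF f] continuous_intros) auto
  ultimately have "integrable lborel (\<lambda>z. indicator ?C z *\<^sub>R (\<lambda>(x, t). f (x + t *\<^sub>R a)) z)"
    by (rule borel_integrable_compact)
  moreover have "indicator ?C z *\<^sub>R (\<lambda>(x, t). f (x + t *\<^sub>R a)) z = (\<lambda>(x, t). ?h x t) z" for z
  proof -
    have "z \<in> ?C \<longleftrightarrow> snd z \<in> {0..1} \<and> fst z + snd z *\<^sub>R a \<in> K"
      by (cases z) (force simp: image_iff)
    then show ?thesis by (auto simp: indicator_def case_prod_unfold)
  qed
  ultimately have int: "integrable (lborel \<Otimes>\<^sub>M lborel) (\<lambda>(x, t). ?h x t)"
    by (simp add: lborel_prod)
  show "(\<lambda>x. LINT t|lborel. ?h x t) \<in> borel_measurable lborel" by measurable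
  have "(LINT x|lborel. LINT t|lborel. ?h x t) = (LINT t|lborel. LINT x|lborel. ?h x t)"
    by (rule lborel_pair.Fubini_integral[OF int, symmetric])
  also have "\<dots> = (LINT t|lborel. indicator {0..1::real} t * (LINT x|lborel. indicator K x * f x))"
    using integral_translate_lborel(1)[of "\<lambda>x. indicator K x * f x"] by simp
  also have "\<dots> = (LINT x|lborel. indicator K x * f x)" by (simp add: measure_lborel_Icc)
  finally show "(LINT x|lborel. LINT t|lborel. ?h x t) = (LINT x|lborel. indicator K x * f x)" .
qed

text \<open>By the fundamental theorem of calculus, the integral of the derivative over the part of the segment
from \<open>x\<close> to \<open>x + a\<close> in \<open>K\<close> is the difference of \<open>f\<close> at the last and at the first point of that part.
Integrating over all \<open>x\<close>, the contributions of end points in \<open>K\<close> cancel by translation invariance;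
those of exit and entry points are integrals over slanted prisms. The family \<open>G\<close> collects parts of
the boundary that may be left uncovered by the faces.\<close>

theorem divergence_theorem_convex:
  fixes K :: "(real^'n) set" and f :: "real^'n \<Rightarrow> real"
  assumes K: "compact K" "convex K" "interior K \<noteq> {}"
    and F: "finite F" and G: "finite G"
    and face: "\<And>S. S \<in> F \<Longrightarrow> closed S \<and> S \<noteq> {} \<and> S \<subseteq> K \<and> norm (n S) = 1 \<and>
      S \<subseteq> {y. n S \<bullet> y = c S} \<and> K \<subseteq> {y. n S \<bullet> y \<le> c S}"
    and cover: "frontier K \<subseteq> \<Union>F \<union> \<Union>G"
    and null: "\<And>B. B \<in> G \<Longrightarrow> flat_null B"
    and overlap: "\<And>S S'. S \<in> F \<Longrightarrow> S' \<in> F \<Longrightarrow> S \<noteq> S' \<Longrightarrow> flat_null (S \<inter> S')"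
    and D: "\<And>y. (f has_derivative D y) (at y)" and cont: "continuous_on UNIV (\<lambda>y. D y a)"
  shows "(LINT x|lborel. indicator K x * D x a) =
    (\<Sum>S\<in>F. (n S \<bullet> a) * (LINT x|surface_measure (n S) S. f x))"
proof -
  let ?L = "\<lambda>x. LINT t|lborel. indicator {0..1} t * (indicator K (x + t *\<^sub>R a) * D (x + t *\<^sub>R a) a)"
  let ?g = "\<lambda>S x. indicator (slanted_prism (n S) (c S) a S) x * f (x + hit (n S) (c S) a x *\<^sub>R a)"
  let ?R = "\<lambda>x. (indicator K (x + a) * f (x + a) - indicator K x * f x) + (\<Sum>S\<in>F. sgn (n S \<bullet> a) * ?g S x)"
  have contf: "continuous_on UNIV f"
    using has_derivative_continuous[OF D] by (simp add: continuous_at_imp_continuous_on)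
  note [measurable] = borel_measurable_continuous_onI[OF contf]
  have Kb[measurable]: "K \<in> sets borel" using K(1) by (simp add: borel_compact)
  have ne0: "n S \<noteq> 0" if "S \<in> F" for S using face[OF that] by auto
  have face': "S \<subseteq> K \<and> S \<subseteq> {y. n S \<bullet> y = c S} \<and> K \<subseteq> {y. n S \<bullet> y \<le> c S} \<and> n S \<noteq> 0" if "S \<in> F" for S
    using face[OF that] ne0[OF that] by simp
  \<comment> \<open>the identity on a single segment in general position\<close>
  have segment: "?L x = ?R x"
    if ends: "x \<notin> frontier K" "x + a \<notin> frontier K"
      and meet: "(\<exists>t\<in>{0..1}. x + t *\<^sub>R a \<in> K) \<longrightarrow> (\<exists>t\<in>{0..1}. x + t *\<^sub>R a \<in> interior K)"
      and G0: "\<forall>B\<in>G. \<forall>t\<in>{0..1}. x + t *\<^sub>R a \<notin> B"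
      and F2: "\<forall>p\<in>F \<times> F. fst p \<noteq> snd p \<longrightarrow> (\<forall>t\<in>{0..1}. x + t *\<^sub>R a \<notin> fst p \<inter> snd p)"
      and par: "\<forall>S\<in>F. n S \<bullet> a = 0 \<longrightarrow> (\<forall>t. n S \<bullet> (x + t *\<^sub>R a) \<noteq> c S)" for x
  proof (cases "\<exists>t\<in>{0..1}. x + t *\<^sub>R a \<in> K")
    case False
    have "indicator {0..1} t * (indicator K (x + t *\<^sub>R a) * D (x + t *\<^sub>R a) a) = 0" for t :: real
      using False by (auto simp: indicator_def)
    then have "?L x = (LINT t|(lborel :: real measure). 0)" by (intro Bochner_Integration.integral_cong refl)
    then have "?L x = 0" by simp
    moreover have "x \<notin> K" "x + a \<notin> K"
      using False bexI[of "\<lambda>t. x + t *\<^sub>R a \<in> K" 0 "{0..1}"] bexI[of "\<lambda>t. x + t *\<^sub>R a \<in> K" 1 "{0..1}"] by auto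
    moreover have "?g S x = 0" if "S \<in> F" for S
      using False face[OF that] by (auto simp: slanted_prism_def indicator_def)
    then have "(\<Sum>S\<in>F. sgn (n S \<bullet> a) * ?g S x) = 0" by (intro sum.neutral) auto
    ultimately show ?thesis by simp
  next
    case True
    define J where "J = {t \<in> {0..1}. x + t *\<^sub>R a \<in> K}"
    have J_eq: "J = {0..1} \<inter> (\<lambda>t. x + t *\<^sub>R a) -` K" by (auto simp: J_def)
    have "closed J" unfolding J_eq
      by (intro closed_Int closed_vimage compact_imp_closed[OF K(1)] continuous_intros closed_atLeastAtMost)
    then have "compact J" unfolding compact_eq_bounded_closed
      by (auto simp: J_eq intro: bounded_subset[OF bounded_closed_interval])
    moreover have "convex J"
    proof (rule convexI)
      fix s t u v :: real assume st: "s \<in> J" "t \<in> J" and uv: "0 \<le> u" "0 \<le> v" "u + v = 1"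
      have "u *\<^sub>R (x + s *\<^sub>R a) + v *\<^sub>R (x + t *\<^sub>R a) = (u + v) *\<^sub>R x + (u *\<^sub>R s + v *\<^sub>R t) *\<^sub>R a"
        by (simp add: algebra_simps)
      then have "x + (u *\<^sub>R s + v *\<^sub>R t) *\<^sub>R a \<in> K"
        using convexD[OF K(2) _ _ uv, of "x + s *\<^sub>R a" "x + t *\<^sub>R a"] st uv(3) by (simp add: J_def)
      then show "u *\<^sub>R s + v *\<^sub>R t \<in> J"
        using convexD[OF convex_real_interval(5)[of 0 1] _ _ uv, of s t] st by (simp add: J_def)
    qed
    ultimately obtain \<alpha> \<beta> where \<alpha>\<beta>: "J = {\<alpha>..\<beta>}"
      using connected_compact_interval_1[of J] convex_connected by blast
    have "J \<noteq> {}" using True by (auto simp: J_def)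
    then have "\<alpha> \<le> \<beta>" using \<alpha>\<beta> by simp
    obtain t0 where t0: "t0 \<in> {0..1}" "x + t0 *\<^sub>R a \<in> interior K" using True meet by blast
    have cov: "\<exists>S\<in>F. x + t *\<^sub>R a \<in> S" if "t \<in> {0..1}" "x + t *\<^sub>R a \<in> frontier K" for t
      using that cover G0 by blast
    have uni: "x + t *\<^sub>R a \<notin> S'" if "S \<in> F" "S' \<in> F" "S \<noteq> S'" "t \<in> {0..1}" "x + t *\<^sub>R a \<in> S" for S S' t
      using bspec[OF F2, of "(S, S')"] that by simp
    have trans: "x + t *\<^sub>R a \<notin> S" if "S \<in> F" "n S \<bullet> a = 0" for S t
      using that par face by blast
    have "f (x + \<beta> *\<^sub>R a) = indicator K (x + a) * f (x + a) + (\<Sum>S\<in>F. if n S \<bullet> a > 0 then ?g S x else 0)"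
    proof (rule exit_point[where n = n and c = c, OF K(2,1) F face' ends(2) t0])
      show "{t \<in> {0..1}. x + t *\<^sub>R a \<in> K} = {\<alpha>..\<beta>}" using \<alpha>\<beta> by (simp only: J_def)
      show "x + t *\<^sub>R a \<notin> S" if "S \<in> F" "n S \<bullet> a = 0" for S t using that by (rule trans)
    qed (assumption | erule cov | erule uni)+
    moreover have "f (x + \<alpha> *\<^sub>R a) = indicator K x * f x + (\<Sum>S\<in>F. if n S \<bullet> a < 0 then ?g S x else 0)"
    proof -
      have rev: "x + a + t *\<^sub>R - a = x + (1 - t) *\<^sub>R a" for t by (simp add: algebra_simps)
      have rev': "x + a + - a = x" by simp
      have seg: "{t \<in> {0..1}. x + (1 - t) *\<^sub>R a \<in> K} = {1 - \<beta>..1 - \<alpha>}"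
      proof (rule set_eqI)
        fix t
        have "t \<in> {t \<in> {0..1}. x + (1 - t) *\<^sub>R a \<in> K} \<longleftrightarrow> 1 - t \<in> J" by (auto simp: J_def)
        also have "\<dots> \<longleftrightarrow> t \<in> {1 - \<beta>..1 - \<alpha>}" unfolding \<alpha>\<beta> by auto
        finally show "t \<in> {t \<in> {0..1}. x + (1 - t) *\<^sub>R a \<in> K} \<longleftrightarrow> t \<in> {1 - \<beta>..1 - \<alpha>}" .
      qed
      have "f (x + a + (1 - \<alpha>) *\<^sub>R - a) = indicator K (x + a + - a) * f (x + a + - a) +
        (\<Sum>S\<in>F. if n S \<bullet> (- a) > 0 then indicator (slanted_prism (n S) (c S) (- a) S) (x + a)
           * f (x + a + hit (n S) (c S) (- a) (x + a) *\<^sub>R - a) else 0)"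
      proof (rule exit_point[where n = n and c = c, OF K(2,1) F face'])
        show "1 - t0 \<in> {0..1}" "x + a + (1 - t0) *\<^sub>R - a \<in> interior K"
          using t0 unfolding rev by auto
        show "{t \<in> {0..1}. x + a + t *\<^sub>R - a \<in> K} = {1 - \<beta>..1 - \<alpha>}" unfolding rev by (rule seg)
        show "x + a + t *\<^sub>R - a \<notin> S" if "S \<in> F" "n S \<bullet> - a = 0" for S t
          unfolding rev using trans[OF that(1)] that(2) by simp
        show "\<exists>S\<in>F. x + a + t *\<^sub>R - a \<in> S" if "t \<in> {0..1}" "x + a + t *\<^sub>R - a \<in> frontier K" for t
          using that cov[of "1 - t"] unfolding rev by simp
        show "x + a + t *\<^sub>R - a \<notin> S'" if "S \<in> F" "S' \<in> F" "S \<noteq> S'" "t \<in> {0..1}" "x + a + t *\<^sub>R - a \<in> S" for S S' t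
          using that uni[of S S' "1 - t"] unfolding rev by simp
        show "x + a + - a \<notin> frontier K" using ends(1) by simp
      qed
      moreover have "(if n S \<bullet> (- a) > 0 then indicator (slanted_prism (n S) (c S) (- a) S) (x + a)
           * f (x + a + hit (n S) (c S) (- a) (x + a) *\<^sub>R - a) else 0) = (if n S \<bullet> a < 0 then ?g S x else 0)" for S
        unfolding rev by (auto simp: hit_reverse indicator_def slanted_prism_reverse)
      ultimately show ?thesis unfolding rev by simp
    qed
    moreover have "?L x = f (x + \<beta> *\<^sub>R a) - f (x + \<alpha> *\<^sub>R a)"
    proof -
      have "?L x = (LINT t|lborel. D (x + t *\<^sub>R a) a * indicator {\<alpha>..\<beta>} t)"
        unfolding \<alpha>\<beta>[symmetric] J_def
        by (intro Bochner_Integration.integral_cong) (auto simp: indicator_def)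
      also have "\<dots> = f (x + \<beta> *\<^sub>R a) - f (x + \<alpha> *\<^sub>R a)"
      proof (rule integral_FTC_Icc_real[OF \<open>\<alpha> \<le> \<beta>\<close>])
        fix t
        have "((\<lambda>t. f (x + t *\<^sub>R a)) has_derivative (\<lambda>h. D (x + t *\<^sub>R a) (h *\<^sub>R a))) (at t)"
          by (rule has_derivative_compose[OF _ D]) (auto intro!: derivative_eq_intros)
        moreover have "D y (h *\<^sub>R a) = D y a * h" for y h
          using linear_scale[OF has_derivative_linear[OF D]] by (simp add: mult.commute)
        ultimately show "((\<lambda>t. f (x + t *\<^sub>R a)) has_real_derivative D (x + t *\<^sub>R a) a) (at t)"
          by (simp add: has_field_derivative_def)
        have "continuous_on UNIV (\<lambda>t. D (x + t *\<^sub>R a) a)"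
          by (intro continuous_on_compose2[OF cont] continuous_intros) auto
        then show "isCont (\<lambda>t. D (x + t *\<^sub>R a) a) t" by (simp add: continuous_on_eq_continuous_at)
      qed
      finally show ?thesis .
    qed
    moreover have "(\<Sum>S\<in>F. if n S \<bullet> a > 0 then ?g S x else 0) - (\<Sum>S\<in>F. if n S \<bullet> a < 0 then ?g S x else 0)
      = (\<Sum>S\<in>F. sgn (n S \<bullet> a) * ?g S x)"
      unfolding sum_subtractf[symmetric] by (intro sum.cong) (auto simp: sgn_if)
    ultimately show ?thesis by simp
  qed
  have ae: "AE x in lborel. ?L x = ?R x"
  proof -
    have front: "AE x in lborel. x \<notin> frontier K"
      by (intro AE_not_in_closed_negligible negligible_convex_frontier K frontier_closed)
    have "AE x in lborel. x + a \<notin> frontier K"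
    proof -
      have "frontier ((\<lambda>x. - a + x) ` K) = (\<lambda>x. - a + x) ` frontier K" by (rule frontier_translation)
      moreover have "AE x in lborel. x \<notin> frontier ((\<lambda>x. - a + x) ` K)"
        by (intro AE_not_in_closed_negligible negligible_convex_frontier convex_translation K frontier_closed)
      ultimately show ?thesis
        by (elim eventually_mono) (auto simp: image_iff algebra_simps)
    qed
    moreover have "AE x in lborel. \<forall>B\<in>G. \<forall>t\<in>{0..1}. x + t *\<^sub>R a \<notin> B"
      using null by (intro AE_finite_allI G AE_line_misses_flat_null)
    moreover have "AE x in lborel. \<forall>p\<in>F \<times> F. fst p \<noteq> snd p \<longrightarrow> (\<forall>t\<in>{0..1}. x + t *\<^sub>R a \<notin> fst p \<inter> snd p)"
    proof (rule AE_finite_allI)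
      fix p assume "p \<in> F \<times> F"
      then show "AE x in lborel. fst p \<noteq> snd p \<longrightarrow> (\<forall>t\<in>{0..1}. x + t *\<^sub>R a \<notin> fst p \<inter> snd p)"
        using AE_line_misses_flat_null[OF overlap[of "fst p" "snd p"]] by (cases "fst p = snd p") auto
    qed (use F in simp)
    moreover have "AE x in lborel. \<forall>S\<in>F. n S \<bullet> a = 0 \<longrightarrow> (\<forall>t. n S \<bullet> (x + t *\<^sub>R a) \<noteq> c S)"
    proof (rule AE_finite_allI[OF F])
      fix S assume "S \<in> F"
      then show "AE x in lborel. n S \<bullet> a = 0 \<longrightarrow> (\<forall>t. n S \<bullet> (x + t *\<^sub>R a) \<noteq> c S)"
        using AE_line_misses_hyperplane[of "n S" a "c S"] face by (cases "n S \<bullet> a = 0") auto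
    qed
    ultimately show ?thesis
      using front AE_segment_meets_interior[OF K(2,3), of a] by eventually_elim (rule segment)
  qed
  have intK: "integrable lborel (\<lambda>x. indicator K x * f x)"
    using borel_integrable_compact[OF K(1) continuous_on_subset[OF contf]] by simp
  have intg: "integrable lborel (\<lambda>x. sgn (n S \<bullet> a) * ?g S x)"
    and valg: "(LINT x|lborel. sgn (n S \<bullet> a) * ?g S x) = (n S \<bullet> a) * (LINT x|surface_measure (n S) S. f x)"
    if "S \<in> F" for S
  proof -
    have cS: "compact S" using face[OF that] K(1) by (metis compact_Int_closed inf.absorb_iff2)
    have Sb: "S \<in> sets borel" using cS by (rule borel_compact)
    show "integrable lborel (\<lambda>x. sgn (n S \<bullet> a) * ?g S x)"
      using integrable_slanted_prism[OF _ _ cS contf, of "n S" a "c S"] face[OF that]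
      by (cases "n S \<bullet> a = 0") auto
    show "(LINT x|lborel. sgn (n S \<bullet> a) * ?g S x) = (n S \<bullet> a) * (LINT x|surface_measure (n S) S. f x)"
    proof (cases "n S \<bullet> a = 0")
      case False
      have "(LINT x|lborel. ?g S x) = \<bar>n S \<bullet> a\<bar> * (LINT x|surface_measure (n S) S. f x)"
        using face[OF that] by (intro integral_slanted_prism False Sb) auto
      moreover have "(LINT x|lborel. sgn (n S \<bullet> a) * ?g S x) = sgn (n S \<bullet> a) * (LINT x|lborel. ?g S x)"
        by (rule integral_mult_right_zero)
      ultimately show ?thesis by (simp only: mult.assoc[symmetric] sgn_mult_abs)
    qed simp
  qed
  have intT: "integrable lborel (\<lambda>x. indicator K (x + a) * f (x + a))"
    by (rule integral_translate_lborel(2)[OF _ intK]) measurable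
  have "(LINT x|lborel. indicator K x * D x a) = (LINT x|lborel. ?L x)"
    using integral_along_segments(1)[OF K(1) cont, of a] by simp
  also have "\<dots> = (LINT x|lborel. ?R x)"
    using integral_along_segments(2)[OF K(1) cont, of a] ae
  proof (intro integral_cong_AE)
    show "?R \<in> borel_measurable lborel"
      using intg intK intT by (intro borel_measurable_add borel_measurable_diff borel_measurable_sum borel_measurable_integrable)
  qed
  also have "\<dots> = (LINT x|lborel. indicator K (x + a) * f (x + a)) - (LINT x|lborel. indicator K x * f x)
      + (\<Sum>S\<in>F. LINT x|lborel. sgn (n S \<bullet> a) * ?g S x)"
    using intg intK intT
    by (subst Bochner_Integration.integral_add) (auto simp: Bochner_Integration.integral_sum)
  also have "(LINT x|lborel. indicator K (x + a) * f (x + a)) = (LINT x|lborel. indicator K x * f x)"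
    by (rule integral_translate_lborel(1)) measurable
  also have "(\<Sum>S\<in>F. LINT x|lborel. sgn (n S \<bullet> a) * ?g S x)
    = (\<Sum>S\<in>F. (n S \<bullet> a) * (LINT x|surface_measure (n S) S. f x))"
    by (intro sum.cong valg refl)
  finally show ?thesis by simp
qed

section \<open>Geometry of the mesh\<close>

text \<open>Arbitrarily close to a frontier point, above the graph of the boundary function, there are open sets
disjoint from the domain, so the point cannot be interior to the closure. In particular slits are excluded.\<close>

lemma lipschitz_frontier_Int_interior_closure:
  fixes \<Omega> :: "'a::euclidean_space set"
  assumes "lipschitz_domain \<Omega>"
  shows "frontier \<Omega> \<inter> interior (closure \<Omega>) = {}"
proof (rule ccontr)
  assume "frontier \<Omega> \<inter> interior (closure \<Omega>) \<noteq> {}"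
  then obtain x where x: "x \<in> frontier \<Omega>" "x \<in> interior (closure \<Omega>)" by blast
  have op: "open \<Omega>" using assms by (simp add: lipschitz_domain_def)
  from assms x(1) obtain U e g L where U: "open U" "x \<in> U" "norm e = 1"
    and lip: "L-lipschitz_on UNIV (g :: 'a \<Rightarrow> real)"
    and loc: "\<forall>y\<in>U. y \<in> \<Omega> \<longleftrightarrow> y \<bullet> e < g (y - (y \<bullet> e) *\<^sub>R e)"
    unfolding lipschitz_domain_def by meson
  have contg: "continuous_on UNIV g" using lip by (rule lipschitz_on_continuous_on)
  have "x \<notin> \<Omega>" using x(1) op by (simp add: frontier_def interior_open)
  then have ge: "x \<bullet> e \<ge> g (x - (x \<bullet> e) *\<^sub>R e)" using loc U(2) by force
  have ee: "e \<bullet> e = 1" using U(3) by (simp add: norm_eq_1)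
  let ?W = "U \<inter> interior (closure \<Omega>)"
  have tend: "((\<lambda>t. x + t *\<^sub>R e) \<longlongrightarrow> x + 0 *\<^sub>R e) (at_right 0)" by (intro tendsto_intros)
  have "\<forall>\<^sub>F t in at_right 0. x + t *\<^sub>R e \<in> ?W"
    by (rule topological_tendstoD[OF tend]) (use U x in auto)
  then have "\<forall>\<^sub>F t in at_right (0::real). t > 0 \<and> x + t *\<^sub>R e \<in> ?W"
    using eventually_at_right_less by eventually_elim simp
  then obtain t where t: "t > 0" "x + t *\<^sub>R e \<in> ?W"
    using eventually_happens[of _ "at_right (0::real)"] by (auto simp: trivial_limit_at_right_real)
  let ?V = "U \<inter> {z. g (z - (z \<bullet> e) *\<^sub>R e) < z \<bullet> e}"
  have "open {z. g (z - (z \<bullet> e) *\<^sub>R e) < z \<bullet> e}"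
    by (intro open_Collect_less continuous_on_compose2[OF contg] continuous_intros) auto
  then have "open ?V" using U(1) by blast
  moreover have "?V \<inter> \<Omega> = {}" using loc by force
  ultimately have "?V \<inter> closure \<Omega> = {}" using open_Int_closure_eq_empty by blast
  moreover have eq: "x + t *\<^sub>R e - ((x + t *\<^sub>R e) \<bullet> e) *\<^sub>R e = x - (x \<bullet> e) *\<^sub>R e"
    by (simp add: inner_add_left ee algebra_simps)
  then have "g (x + t *\<^sub>R e - ((x + t *\<^sub>R e) \<bullet> e) *\<^sub>R e) < (x + t *\<^sub>R e) \<bullet> e"
    unfolding eq using ge t(1) by (simp add: inner_add_left ee)
  then have "x + t *\<^sub>R e \<in> ?V" using t(2) by blast
  moreover have "x + t *\<^sub>R e \<in> closure \<Omega>" using t(2) interior_subset by blast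
  ultimately show False by blast
qed

definition offset :: "'n::finite mesh \<Rightarrow> (real^'n) set \<Rightarrow> real" where
  "offset T S = fnormal T S \<bullet> (SOME x. x \<in> S)"

definition on_side :: "'n::finite mesh \<Rightarrow> (real^'n) set \<Rightarrow> real \<Rightarrow> (real^'n) set \<Rightarrow> bool" where
  "on_side T S \<sigma> K \<longleftrightarrow> K \<subseteq> {y. (\<sigma> *\<^sub>R fnormal T S) \<bullet> y \<le> \<sigma> * offset T S}"

abbreviation below :: "'n::finite mesh \<Rightarrow> (real^'n) set \<Rightarrow> (real^'n) set \<Rightarrow> bool" where
  "below T S \<equiv> on_side T S 1"

abbreviation above :: "'n::finite mesh \<Rightarrow> (real^'n) set \<Rightarrow> (real^'n) set \<Rightarrow> bool" where
  "above T S \<equiv> on_side T S (- 1)"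

definition orient :: "'n::finite mesh \<Rightarrow> (real^'n) set \<Rightarrow> (real^'n) set \<Rightarrow> real" where
  "orient T K S = (if below T S K then 1 else - 1)"

locale admissible =
  fixes T :: "'n::finite mesh"
  assumes adm: "admissible_mesh T"
begin

lemma admissible_parts: "admissible_domain T" "admissible_cells T" "admissible_faces T"
  using adm by (simp_all only: admissible_mesh_def)

lemma finite_cells [simp, intro]: "finite (cells T)"
  and Union_cells: "\<Union>(cells T) = closure (omega T)"
  using admissible_parts(2) by (simp_all only: admissible_cells_def)

lemma finite_faces [simp, intro]: "finite (faces T)"
  and skeleton: "(\<Union>K\<in>cells T. frontier K) = \<Union>(faces T)"
  using admissible_parts(3) by (simp_all only: admissible_faces_def)

lemma lipschitz: "lipschitz_domain (omega T)"
  using admissible_parts(1) by (simp only: admissible_domain_def)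

lemma open_omega: "open (omega T)"
  using lipschitz by (simp only: lipschitz_domain_def)

lemma cell_properties:
  "K \<in> cells T \<Longrightarrow> polytope K \<and> emeasure lborel K > 0"
  "K \<in> cells T \<Longrightarrow> L \<in> cells T \<Longrightarrow> K \<noteq> L \<Longrightarrow> emeasure lborel (K \<inter> L) = 0"
  using admissible_parts(2) unfolding admissible_cells_def by (elim conjE; simp)+

lemma face_properties:
  "S \<in> faces T \<Longrightarrow> closed S \<and> connected S \<and>
     norm (fnormal T S) = 1 \<and> (\<exists>c. S \<subseteq> {x. fnormal T S \<bullet> x = c}) \<and>
     emeasure (ds T S) S > 0 \<and> S \<in> interior_faces T \<union> boundary_faces T"
  "S \<in> faces T \<Longrightarrow> S' \<in> faces T \<Longrightarrow> S \<noteq> S' \<Longrightarrow> emeasure (ds T S) (S \<inter> S') = 0"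
  "S \<in> boundary_faces T \<Longrightarrow> outer_normal_on (omega T) S (fnormal T S)"
  using admissible_parts(3) unfolding admissible_faces_def by (elim conjE; simp)+

lemma cell_compact: "K \<in> cells T \<Longrightarrow> compact K"
  and cell_convex: "K \<in> cells T \<Longrightarrow> convex K"
  using cell_properties(1)[of K] by (simp_all add: polytope_imp_compact polytope_imp_convex)

lemma cell_closed: "K \<in> cells T \<Longrightarrow> closed K"
  by (simp add: cell_compact compact_imp_closed)

lemma cell_interior: assumes "K \<in> cells T" shows "interior K \<noteq> {}"
proof
  assume "interior K = {}"
  then have "K \<in> null_sets lebesgue"
    using negligible_convex_interior[OF cell_convex[OF assms]] by (simp add: negligible_iff_null_sets)
  then have "emeasure lborel K = 0"
    using cell_closed[OF assms] by (simp add: null_sets_completion_iff borel_closed null_sets_def)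
  then show False using cell_properties(1)[OF assms] by simp
qed

lemma cells_disjoint: "K \<in> cells T \<Longrightarrow> L \<in> cells T \<Longrightarrow> K \<noteq> L \<Longrightarrow> interior K \<inter> interior L = {}"
  by (intro interior_Int_eq_empty cell_closed cell_properties(2))

lemma interior_closure_omega: "interior (closure (omega T)) \<subseteq> omega T"
proof
  fix x assume x: "x \<in> interior (closure (omega T))"
  then have "x \<notin> frontier (omega T)"
    using lipschitz_frontier_Int_interior_closure[OF lipschitz] by blast
  moreover have "x \<in> closure (omega T)" using x interior_subset by blast
  ultimately show "x \<in> omega T" using open_omega by (simp add: frontier_def interior_open)
qed

lemma interior_cell_subset_omega: "K \<in> cells T \<Longrightarrow> interior K \<subseteq> omega T"
  using interior_closure_omega interior_mono[of K "closure (omega T)"] Union_cells by blast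

lemma face_closed: "S \<in> faces T \<Longrightarrow> closed S"
  and face_normal: "S \<in> faces T \<Longrightarrow> norm (fnormal T S) = 1"
  and face_pos: "S \<in> faces T \<Longrightarrow> emeasure (ds T S) S > 0"
  and face_cases: "S \<in> faces T \<Longrightarrow> S \<in> interior_faces T \<union> boundary_faces T"
  and face_overlap: "S \<in> faces T \<Longrightarrow> S' \<in> faces T \<Longrightarrow> S \<noteq> S' \<Longrightarrow> emeasure (ds T S) (S \<inter> S') = 0"
  and boundary_normal: "S \<in> boundary_faces T \<Longrightarrow> outer_normal_on (omega T) S (fnormal T S)"
  using face_properties[of S] face_properties(2)[of S S'] by simp_all

lemma face_ne: "S \<in> faces T \<Longrightarrow> S \<noteq> {}"
  using face_pos by fastforce

lemma face_plane: assumes "S \<in> faces T" shows "S \<subseteq> {x. fnormal T S \<bullet> x = offset T S}"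
proof -
  obtain c where c: "S \<subseteq> {x. fnormal T S \<bullet> x = c}"
    using face_properties(1)[OF assms] by blast
  have "(SOME x. x \<in> S) \<in> S" using face_ne[OF assms] by (simp add: some_in_eq)
  then have "offset T S = c" using c by (auto simp: offset_def)
  then show ?thesis using c by simp
qed

lemma face_in_cell: assumes "S \<in> faces T" obtains K where "K \<in> cells T" "S \<subseteq> K"
  using face_cases[OF assms] unfolding interior_faces_def boundary_faces_def by blast

lemma face_compact: assumes "S \<in> faces T" shows "compact S"
proof -
  obtain K where "K \<in> cells T" "S \<subseteq> K" using face_in_cell[OF assms] .
  then show ?thesis using face_closed[OF assms] cell_compact by (metis compact_Int_closed inf.absorb_iff2)
qed

lemma face_borel [simp]: "S \<in> faces T \<Longrightarrow> S \<in> sets borel"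
  by (simp add: face_closed borel_closed)

lemma finite_measure_face: "S \<in> faces T \<Longrightarrow> finite_measure (ds T S)"
  by (intro finite_measure_surface_measure[OF face_normal _ face_plane] face_borel compact_imp_bounded
      face_compact face_ne)

lemma oriented_normal:
  assumes "\<sigma> \<in> {1, - 1}" "S \<in> faces T"
  shows "norm (\<sigma> *\<^sub>R fnormal T S) = 1" and "S \<subseteq> {x. (\<sigma> *\<^sub>R fnormal T S) \<bullet> x = \<sigma> * offset T S}"
    and "surface_measure (\<sigma> *\<^sub>R fnormal T S) S = ds T S"
  using assms(1) face_normal[OF assms(2)] face_plane[OF assms(2)]
    surface_measure_uminus[OF face_normal face_closed face_plane face_ne] assms(2) by auto

lemma not_below_above: assumes "K \<in> cells T" "S \<in> faces T" "below T S K" shows "\<not> above T S K"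
proof
  assume "above T S K"
  have nz: "fnormal T S \<noteq> 0" using face_normal[OF assms(2)] by auto
  obtain x where x: "x \<in> interior K" using cell_interior[OF assms(1)] by blast
  have "(\<sigma> *\<^sub>R fnormal T S) \<bullet> x < \<sigma> * offset T S" if "on_side T S \<sigma> K" "\<sigma> \<noteq> 0" for \<sigma>
    using interior_halfspace_less[OF that(1)[unfolded on_side_def]] nz that(2) x by auto
  from this[OF assms(3)] this[OF \<open>above T S K\<close>] show False by simp
qed

text \<open>Stated for a piece \<open>B\<close> of the face, since it is later applied to the intersection of a face with a
cell that does not contain the whole face.\<close>

lemma piece_opposite_sides:
  assumes "K \<in> cells T" "L \<in> cells T" "K \<noteq> L" "S \<in> faces T" "B \<subseteq> S" "closed B"
    "emeasure (surface_measure (fnormal T S) B) B > 0" "B \<subseteq> K" "B \<subseteq> L"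
  shows "below T S K \<and> above T S L \<or> above T S K \<and> below T S L"
proof -
  have "B \<subseteq> {x. fnormal T S \<bullet> x = offset T S}" using face_plane assms(4,5) by blast
  from opposite_sides[OF face_normal[OF assms(4)] assms(6) this assms(7)
      cell_convex[OF assms(1)] cell_closed[OF assms(1)] cell_interior[OF assms(1)] assms(8)
      cell_convex[OF assms(2)] cell_closed[OF assms(2)] cell_interior[OF assms(2)] assms(9)
      cells_disjoint[OF assms(1-3)]]
  show ?thesis by (simp add: on_side_def)
qed

lemma cells_opposite_sides:
  assumes "K \<in> cells T" "L \<in> cells T" "K \<noteq> L" "S \<in> faces T" "S \<subseteq> K" "S \<subseteq> L"
  shows "below T S K \<and> above T S L \<or> above T S K \<and> below T S L"
  by (rule piece_opposite_sides[OF assms(1-4) order_refl face_closed face_pos assms(5,6)]) (fact assms(4))+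

lemma side_unique:
  assumes "K \<in> cells T" "L \<in> cells T" "S \<in> faces T" "S \<subseteq> K" "S \<subseteq> L" "on_side T S \<sigma> K" "on_side T S \<sigma> L"
    and "\<sigma> \<in> {1, - 1}"
  shows "K = L"
  using cells_opposite_sides[OF assms(1,2) _ assms(3-5)] not_below_above assms by blast

lemma interior_face_cells:
  assumes "S \<in> interior_faces T"
  obtains K L where "K \<in> cells T" "L \<in> cells T" "K \<noteq> L" "S \<subseteq> K" "S \<subseteq> L" "below T S K" "above T S L"
proof -
  obtain K L where KL: "K \<in> cells T" "L \<in> cells T" "K \<noteq> L" "S \<subseteq> K" "S \<subseteq> L" and S: "S \<in> faces T"
    using assms unfolding interior_faces_def by blast
  from cells_opposite_sides[OF KL(1-3) S KL(4,5)] show ?thesis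
    using that[of K L] that[of L K] KL by blast
qed

text \<open>Both sides are treated at once by the sign \<open>\<sigma>\<close> of the oriented normal.\<close>

lemma AE_inside_side:
  assumes "K \<in> cells T" "S \<in> faces T" "on_side T S \<sigma> K" "\<sigma> \<in> {1, - 1}"
  shows "AE x in ds T S. x \<in> K \<longrightarrow> (\<exists>\<epsilon>>0. \<forall>t\<in>{0<..<\<epsilon>}.
    x - t *\<^sub>R (\<sigma> *\<^sub>R fnormal T S) \<in> interior K \<and> x + t *\<^sub>R (\<sigma> *\<^sub>R fnormal T S) \<notin> K)"
  using AE_surface_inside[OF oriented_normal(1)[OF assms(4,2)] face_closed[OF assms(2)] oriented_normal(2)[OF assms(4,2)]
    face_ne[OF assms(2)] cell_convex[OF assms(1)] cell_closed[OF assms(1)] cell_interior[OF assms(1)]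
    assms(3)[unfolded on_side_def]]
  unfolding oriented_normal(3)[OF assms(4,2)] .

text \<open>A cell on the outer side would contain short segments in the direction of the outer normal, whose
points are interior to the closure of the domain and thus in the domain.\<close>

lemma AE_boundary_face_misses_above:
  assumes K: "K \<in> cells T" and S: "S \<in> boundary_faces T" and ab: "above T S K"
  shows "AE x in ds T S. x \<notin> K"
proof -
  have Sf: "S \<in> faces T" using S by (simp add: boundary_faces_def)
  have "AE x in ds T S. \<exists>\<epsilon>>0. \<forall>t\<in>{0<..<\<epsilon>}. x - t *\<^sub>R fnormal T S \<in> omega T \<and> x + t *\<^sub>R fnormal T S \<notin> omega T"
    using boundary_normal[OF S] by (simp add: outer_normal_on_def)
  then show ?thesis using AE_inside_side[OF K Sf ab insertI2[OF singletonI]]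
  proof eventually_elim
    case (elim x)
    show ?case
    proof
      assume "x \<in> K"
      then obtain \<epsilon> \<delta> where "\<epsilon> > 0" "\<forall>t\<in>{0<..<\<epsilon>}. x + t *\<^sub>R fnormal T S \<in> interior K"
        and "\<delta> > 0" "\<forall>t\<in>{0<..<\<delta>}. x + t *\<^sub>R fnormal T S \<notin> omega T" using elim by force
      moreover from this have "min \<epsilon> \<delta> / 2 \<in> {0<..<\<epsilon>}" "min \<epsilon> \<delta> / 2 \<in> {0<..<\<delta>}" by auto
      ultimately show False using interior_cell_subset_omega[OF K] by blast
    qed
  qed
qed

lemma face_AE_ex:
  assumes "S \<in> faces T" "AE x in ds T S. P x"
  shows "\<exists>x\<in>S. P x"
proof -
  have "emeasure (ds T S) (space (ds T S)) > 0" using face_pos[OF assms(1)] by simp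
  from AE_ex[OF assms(2) this] show ?thesis by (metis space_surface_measure)
qed

lemma boundary_face_below:
  assumes K: "K \<in> cells T" and S: "S \<in> boundary_faces T" and SK: "S \<subseteq> K"
  shows "below T S K"
proof (rule ccontr)
  assume nb: "\<not> below T S K"
  have Sf: "S \<in> faces T" and Sfr: "S \<subseteq> frontier (omega T)" using S by (auto simp: boundary_faces_def)
  have "S \<inter> interior K = {}"
    using Sfr interior_cell_subset_omega[OF K] open_omega by (auto simp: frontier_def interior_open)
  from one_sided[OF face_normal[OF Sf] face_closed[OF Sf] face_plane[OF Sf] face_pos[OF Sf]
      cell_convex[OF K] cell_closed[OF K] cell_interior[OF K] SK this] nb
  have "above T S K" by (simp add: on_side_def)
  from face_AE_ex[OF Sf AE_boundary_face_misses_above[OF K S this]] SK show False by blast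
qed

text \<open>One of the two cells at an interior face is above it.\<close>

lemma interior_boundary_disjoint: "S \<in> interior_faces T \<Longrightarrow> S \<notin> boundary_faces T"
  using interior_face_cells boundary_face_below not_below_above interior_faces_def
  by (metis (no_types, lifting) mem_Collect_eq)

lemma below_or_above:
  assumes "K \<in> cells T" "S \<in> faces T" "S \<subseteq> K"
  shows "below T S K \<or> above T S K"
proof (cases "S \<in> interior_faces T")
  case True
  then obtain A B where "A \<in> cells T" "B \<in> cells T" "A \<noteq> B" "S \<subseteq> A" "S \<subseteq> B"
    unfolding interior_faces_def by blast
  then obtain L where "L \<in> cells T" "S \<subseteq> L" "K \<noteq> L" by (cases "K = A") auto
  then show ?thesis using cells_opposite_sides[OF assms(1) _ _ assms(2,3)] by blast
next
  case False
  then show ?thesis using face_cases[OF assms(2)] boundary_face_below[OF assms(1) _ assms(3)] by blast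
qed

text \<open>The almost everywhere condition on short normal segments determines the side of the cell because
the face has positive measure.\<close>

lemma outer_normal_iff_side:
  assumes K: "K \<in> cells T" and S: "S \<in> faces T" and SK: "S \<subseteq> K" and \<sigma>: "\<sigma> \<in> {1, - 1}"
  shows "outer_normal_on K S (\<sigma> *\<^sub>R fnormal T S) \<longleftrightarrow> on_side T S \<sigma> K"
proof
  let ?n = "\<sigma> *\<^sub>R fnormal T S"
  note n = oriented_normal[OF \<sigma> S]
  {
    assume b: "on_side T S \<sigma> K"
    have "AE x in ds T S. \<exists>\<epsilon>>0. \<forall>t\<in>{0<..<\<epsilon>}. x - t *\<^sub>R ?n \<in> K \<and> x + t *\<^sub>R ?n \<notin> K"
      using AE_inside_side[OF K S b \<sigma>] AE_space
    proof eventually_elim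
      case (elim x)
      then have "x \<in> K" using SK by auto
      with elim(1) show ?case using interior_subset[of K] by blast
    qed
    then show "outer_normal_on K S ?n" unfolding outer_normal_on_def n(3) using n(1,2) by blast
  }
  assume o: "outer_normal_on K S ?n"
  show "on_side T S \<sigma> K"
  proof (rule ccontr)
    assume "\<not> on_side T S \<sigma> K"
    then have a: "on_side T S (- \<sigma>) K" and \<sigma>': "- \<sigma> \<in> {1, - 1}"
      using below_or_above[OF K S SK] \<sigma> by auto
    have "AE x in ds T S. False"
      using AE_inside_side[OF K S a \<sigma>'] AE_space o[unfolded outer_normal_on_def n(3), THEN conjunct2, THEN conjunct2]
    proof eventually_elim
      case (elim x)
      then have "x \<in> K" using SK by auto
      then obtain \<epsilon> \<delta> where "\<epsilon> > 0" "\<forall>t\<in>{0<..<\<epsilon>}. x - t *\<^sub>R (- \<sigma> *\<^sub>R fnormal T S) \<in> interior K"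
        and "\<delta> > 0" "\<forall>t\<in>{0<..<\<delta>}. x + t *\<^sub>R ?n \<notin> K" using elim by blast
      moreover from this have "min \<epsilon> \<delta> / 2 \<in> {0<..<\<epsilon>}" "min \<epsilon> \<delta> / 2 \<in> {0<..<\<delta>}" by auto
      ultimately have "x - (min \<epsilon> \<delta> / 2) *\<^sub>R (- \<sigma> *\<^sub>R fnormal T S) \<in> interior K"
        "x + (min \<epsilon> \<delta> / 2) *\<^sub>R ?n \<notin> K" by blast+
      then show False using interior_subset[of K] by auto
    qed
    then show False using face_AE_ex[OF S] by blast
  qed
qed

lemma cell_plus_interior:
  assumes "S \<in> interior_faces T" "K \<in> cells T" "S \<subseteq> K" "below T S K"
  shows "cell_plus T S = K"
proof -
  have S: "S \<in> faces T" using assms(1) by (simp add: interior_faces_def)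
  show ?thesis unfolding cell_plus_def
    using assms outer_normal_iff_side[OF _ S, of _ 1] side_unique[OF _ _ S, of _ _ 1] by (intro the_equality) auto
qed

lemma cell_minus_interior:
  assumes "S \<in> interior_faces T" "K \<in> cells T" "S \<subseteq> K" "above T S K"
  shows "cell_minus T S = K"
proof -
  have S: "S \<in> faces T" using assms(1) by (simp add: interior_faces_def)
  show ?thesis unfolding cell_minus_def
    using assms outer_normal_iff_side[OF _ S, of _ "- 1"] side_unique[OF _ _ S, of _ _ "- 1"] by (intro the_equality) auto
qed

lemma cell_plus_boundary:
  assumes "S \<in> boundary_faces T" "K \<in> cells T" "S \<subseteq> K"
  shows "cell_plus T S = K"
proof -
  have S: "S \<in> faces T" using assms(1) by (simp add: boundary_faces_def)
  have "S \<notin> interior_faces T" using interior_boundary_disjoint assms(1) by blast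
  then show ?thesis unfolding cell_plus_def
    using assms boundary_face_below[OF _ assms(1)] side_unique[OF _ _ S, of _ _ 1] by (intro the_equality) auto
qed

text \<open>This form of the jump allows sums over faces to be rearranged into sums over cells.\<close>

lemma jump_eq_sum:
  assumes S: "S \<in> faces T"
  shows "jump T w S x = (\<Sum>K\<in>{K \<in> cells T. S \<subseteq> K}. orient T K S *\<^sub>R w K x)"
proof (cases "S \<in> interior_faces T")
  case True
  obtain K L where KL: "K \<in> cells T" "L \<in> cells T" "K \<noteq> L" "S \<subseteq> K" "S \<subseteq> L" "below T S K" "above T S L"
    using interior_face_cells[OF True] .
  have "M = K \<or> M = L" if "M \<in> cells T" "S \<subseteq> M" for M
    using below_or_above[OF that(1) S that(2)] side_unique[OF that(1) KL(1) S that(2)]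
      side_unique[OF that(1) KL(2) S that(2)] KL by blast
  then have "{K \<in> cells T. S \<subseteq> K} = {K, L}" using KL by blast
  moreover have "\<not> below T S L" using not_below_above[OF KL(2) S] KL(7) by blast
  ultimately show ?thesis
    using KL True by (simp add: jump_def orient_def cell_plus_interior[of S K] cell_minus_interior[of S L])
next
  case False
  then have b: "S \<in> boundary_faces T" using face_cases[OF S] by blast
  obtain K where K: "K \<in> cells T" "S \<subseteq> K" using face_in_cell[OF S] .
  have "{K \<in> cells T. S \<subseteq> K} = {K}"
    using K cell_plus_boundary[OF b] by blast
  then show ?thesis
    using K False boundary_face_below[OF K(1) b K(2)]
    by (simp add: jump_def orient_def cell_plus_boundary[OF b K])
qed

lemma sum_orient:
  assumes S: "S \<in> faces T"
  shows "(\<Sum>K\<in>{K \<in> cells T. S \<subseteq> K}. orient T K S) = (if S \<in> interior_faces T then 0 else 1)"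
  using jump_eq_sum[OF S, of "\<lambda>_ _. 1::real" undefined] by (simp add: jump_def split: if_splits)

lemma abs_orient [simp]: "\<bar>orient T K S\<bar> = 1"
  by (simp add: orient_def)

lemma flat_nullI:
  assumes "norm e = 1" "S \<in> sets borel" "S \<subseteq> {x. e \<bullet> x = c}" "S \<noteq> {}" "B \<in> sets borel" "B \<subseteq> S"
    "emeasure (surface_measure e S) B = 0"
  shows "flat_null B"
  unfolding flat_null_def
proof (intro conjI exI impI)
  show "emeasure (surface_measure e B) B = 0" if "B \<noteq> {}"
    using emeasure_surface_measure[OF assms(2,3,5,6,4)] assms
      emeasure_surface_measure[OF assms(5) _ assms(5) order_refl that, of e c] by auto
qed (use assms in auto)

lemma emeasure_piece:
  assumes "S \<in> faces T" "B \<subseteq> S" "B \<in> sets borel" "B \<noteq> {}"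
  shows "emeasure (surface_measure (fnormal T S) B) B = emeasure (ds T S) B"
proof -
  have "B \<subseteq> {x. fnormal T S \<bullet> x = offset T S}" using face_plane assms by blast
  then show ?thesis
    using emeasure_surface_measure[OF face_borel[OF assms(1)] face_plane[OF assms(1)] assms(3,2) face_ne[OF assms(1)]]
      emeasure_surface_measure[OF assms(3) _ assms(3) order_refl assms(4)] by simp
qed

lemma flat_null_face_overlap:
  assumes "S \<in> faces T" "S' \<in> faces T" "S \<noteq> S'"
  shows "flat_null (S \<inter> S')"
  using assms face_overlap[OF assms]
  by (intro flat_nullI[OF face_normal face_borel face_plane face_ne, of S]) auto

text \<open>If the intersection had positive measure, then \<open>K\<close> would be opposite to every cell containing \<open>S\<close>.
For an interior face there are two of these, on different sides. For a boundary face \<open>K\<close> would be on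
the outer side.\<close>

lemma flat_null_face_of_other_cell:
  assumes S: "S \<in> faces T" and K: "K \<in> cells T" and SK: "\<not> S \<subseteq> K"
  shows "flat_null (S \<inter> K)"
proof -
  have clB: "closed (S \<inter> K)" using face_closed[OF S] cell_closed[OF K] by blast
  have Bb: "S \<inter> K \<in> sets borel" using clB by (rule borel_closed)
  have "emeasure (ds T S) (S \<inter> K) = 0"
  proof (rule ccontr)
    assume nz: "emeasure (ds T S) (S \<inter> K) \<noteq> 0"
    then have "S \<inter> K \<noteq> {}" by auto
    then have pos: "emeasure (surface_measure (fnormal T S) (S \<inter> K)) (S \<inter> K) > 0"
      using emeasure_piece[OF S _ Bb] nz by (simp add: zero_less_iff_neq_zero)
    have opp: "below T S K \<and> above T S L \<or> above T S K \<and> below T S L" if "L \<in> cells T" "S \<subseteq> L" for L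
    proof (rule piece_opposite_sides[OF K that(1) _ S _ clB pos])
      show "K \<noteq> L" using that SK by blast
    qed (use that in auto)
    show False
    proof (cases "S \<in> interior_faces T")
      case True
      obtain A L where AL: "A \<in> cells T" "L \<in> cells T" "S \<subseteq> A" "S \<subseteq> L" "below T S A" "above T S L"
        using interior_face_cells[OF True] .
      show False using opp[OF AL(1,3)] opp[OF AL(2,4)] AL not_below_above[OF _ S] K by blast
    next
      case False
      then have b: "S \<in> boundary_faces T" using face_cases[OF S] by blast
      obtain L where L: "L \<in> cells T" "S \<subseteq> L" using face_in_cell[OF S] .
      have "above T S K" using opp[OF L] boundary_face_below[OF L(1) b L(2)] not_below_above[OF L(1) S] by blast
      from AE_boundary_face_misses_above[OF K b this] have "emeasure (ds T S) (S \<inter> K) = 0"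
        using emeasure_eq_0_AE[of "\<lambda>x. x \<in> K" "ds T S"] by (simp add: Int_def)
      with nz show False by simp
    qed
  qed
  then show ?thesis
    by (intro flat_nullI[OF face_normal[OF S] face_borel[OF S] face_plane[OF S] face_ne[OF S] Bb]) auto
qed

text \<open>The boundary of the cell is covered by all faces. Those not contained in the cell contribute only
null sets.\<close>

lemma cell_divergence:
  fixes f :: "real^'n \<Rightarrow> real"
  assumes K: "K \<in> cells T"
    and D: "\<And>y. (f has_derivative D y) (at y)" and cont: "continuous_on UNIV (\<lambda>y. D y a)"
  shows "(LINT x|lborel. indicator K x * D x a) =
    (\<Sum>S\<in>faces_of_cell T K. orient T K S * (fnormal T S \<bullet> a) * (LINT x|ds T S. f x))"
proof -
  let ?n = "\<lambda>S. orient T K S *\<^sub>R fnormal T S" and ?c = "\<lambda>S. orient T K S * offset T S"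
  have fc: "S \<in> faces T" "S \<subseteq> K" if "S \<in> faces_of_cell T K" for S
    using that by (auto simp: faces_of_cell_def)
  have \<sigma>: "orient T K S \<in> {1, - 1}" for S by (simp add: orient_def)
  note n = oriented_normal[OF \<sigma>]
  have "(LINT x|lborel. indicator K x * D x a) =
    (\<Sum>S\<in>faces_of_cell T K. (?n S \<bullet> a) * (LINT x|surface_measure (?n S) S. f x))"
  proof (rule divergence_theorem_convex[where G = "(\<lambda>S. S \<inter> K) ` {S \<in> faces T. \<not> S \<subseteq> K}" and c = ?c])
    show "finite (faces_of_cell T K)" "finite ((\<lambda>S. S \<inter> K) ` {S \<in> faces T. \<not> S \<subseteq> K})"
      by (auto simp: faces_of_cell_def)
    show "frontier K \<subseteq> \<Union>(faces_of_cell T K) \<union> \<Union>((\<lambda>S. S \<inter> K) ` {S \<in> faces T. \<not> S \<subseteq> K})"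
    proof
      fix x assume x: "x \<in> frontier K"
      then obtain S where S: "S \<in> faces T" "x \<in> S" using skeleton K by blast
      have "x \<in> K" using x cell_closed[OF K] by (simp add: frontier_def)
      then show "x \<in> \<Union>(faces_of_cell T K) \<union> \<Union>((\<lambda>S. S \<inter> K) ` {S \<in> faces T. \<not> S \<subseteq> K})"
        using S by (cases "S \<subseteq> K") (auto simp: faces_of_cell_def)
    qed
    show "flat_null B" if "B \<in> (\<lambda>S. S \<inter> K) ` {S \<in> faces T. \<not> S \<subseteq> K}" for B
      using that flat_null_face_of_other_cell[OF _ K] by blast
    show "flat_null (S \<inter> S')" if "S \<in> faces_of_cell T K" "S' \<in> faces_of_cell T K" "S \<noteq> S'" for S S'
      using flat_null_face_overlap fc that by blast
    show "closed S \<and> S \<noteq> {} \<and> S \<subseteq> K \<and> norm (?n S) = 1 \<and>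
        S \<subseteq> {y. ?n S \<bullet> y = ?c S} \<and> K \<subseteq> {y. ?n S \<bullet> y \<le> ?c S}" if "S \<in> faces_of_cell T K" for S
    proof (intro conjI)
      show "K \<subseteq> {y. ?n S \<bullet> y \<le> ?c S}"
        using below_or_above[OF K fc[OF that]] unfolding on_side_def[symmetric] by (auto simp: orient_def)
    qed (use fc[OF that] face_closed face_ne n in auto)
  qed (use K cell_compact cell_convex cell_interior D cont in auto)
  also have "\<dots> = (\<Sum>S\<in>faces_of_cell T K. orient T K S * (fnormal T S \<bullet> a) * (LINT x|ds T S. f x))"
    by (intro sum.cong refl) (simp add: n(3) fc)
  finally show ?thesis .
qed

text \<open>The choice of a cell is ambiguous only on the frontiers of the cells. The frontier of the domain is
contained in these, as the interior of its closure is the domain itself.\<close>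

lemma integral_by_cells:
  fixes h :: "(real^'n) set \<Rightarrow> real^'n \<Rightarrow> real"
  assumes cont: "\<And>K. K \<in> cells T \<Longrightarrow> continuous_on UNIV (h K)"
  shows "integrable (dx T) (\<lambda>x. h (SOME K. K \<in> cells T \<and> x \<in> K) x)"
    and "(LINT x|dx T. h (SOME K. K \<in> cells T \<and> x \<in> K) x) = (\<Sum>K\<in>cells T. LINT x|lborel. indicator K x * h K x)"
proof -
  let ?f = "\<lambda>x. h (SOME K. K \<in> cells T \<and> x \<in> K) x"
  let ?g = "\<lambda>x. \<Sum>K\<in>cells T. indicator K x * h K x"
  have om: "omega T \<in> sets lebesgue" using open_omega by (simp add: borel_open)
  have intK: "integrable lborel (\<lambda>x. indicator K x * h K x)" if "K \<in> cells T" for K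
    using borel_integrable_compact[OF cell_compact[OF that] continuous_on_subset[OF cont[OF that]]] by simp
  have intg: "integrable lborel ?g" using intK by (intro Bochner_Integration.integrable_sum)
  have intgl: "integrable lebesgue ?g" using intg by (subst integrable_completion) auto
  have "AE x in lborel. \<forall>K\<in>cells T. x \<notin> frontier K"
    by (intro AE_finite_allI finite_cells AE_not_in_closed_negligible negligible_convex_frontier
        cell_convex frontier_closed)
  then have ae: "AE x in lebesgue. ?g x = indicator (omega T) x *\<^sub>R ?f x"
  proof (intro AE_completion, elim eventually_mono)
    fix x assume nf: "\<forall>K\<in>cells T. x \<notin> frontier K"
    have inner: "x \<in> interior K" if "K \<in> cells T" "x \<in> K" for K
      using nf that closure_subset by (auto simp: frontier_def)
    show "?g x = indicator (omega T) x *\<^sub>R ?f x"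
    proof (cases "x \<in> omega T")
      case True
      then have "x \<in> \<Union>(cells T)" using Union_cells closure_subset by blast
      then obtain K where K: "K \<in> cells T" "x \<in> K" by blast
      have uniq: "L = K" if "L \<in> cells T" "x \<in> L" for L
        using cells_disjoint[OF that(1) K(1)] inner[OF that] inner[OF K] by blast
      have "(SOME K. K \<in> cells T \<and> x \<in> K) = K" using K by (intro some_equality) (auto dest: uniq)
      moreover have "?g x = (\<Sum>L\<in>cells T. if L = K then h K x else 0)"
      proof (intro sum.cong refl)
        fix L assume "L \<in> cells T"
        then show "indicator L x * h L x = (if L = K then h K x else 0)"
          using uniq[of L] K by (cases "x \<in> L") auto
      qed
      ultimately show ?thesis using True K by simp
    next
      case False
      then have "x \<notin> K" if "K \<in> cells T" for K
        using inner[OF that] interior_cell_subset_omega[OF that] by blast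
      then show ?thesis using False by simp
    qed
  qed
  have mg: "?g \<in> borel_measurable lebesgue" using intgl by simp
  have mf: "(\<lambda>x. indicator (omega T) x *\<^sub>R ?f x) \<in> borel_measurable lebesgue"
    by (rule borel_measurable_AE[OF mg ae])
  have "integrable lebesgue (\<lambda>x. indicator (omega T) x *\<^sub>R ?f x)"
    by (rule integrable_cong_AE_imp[OF intgl mf]) (use ae in \<open>auto elim: eventually_mono\<close>)
  then show "integrable (dx T) ?f" using om by (simp add: integrable_restrict_space)
  have "(LINT x|dx T. ?f x) = (LINT x|lebesgue. indicator (omega T) x *\<^sub>R ?f x)"
    using om by (simp add: integral_restrict_space)
  also have "\<dots> = (LINT x|lebesgue. ?g x)"
    by (rule integral_cong_AE[OF mf mg]) (use ae in \<open>auto elim: eventually_mono\<close>)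
  also have "\<dots> = (LINT x|lborel. ?g x)" using intg by (subst integral_completion) auto
  also have "\<dots> = (\<Sum>K\<in>cells T. LINT x|lborel. indicator K x * h K x)"
    using intK by (rule Bochner_Integration.integral_sum)
  finally show "(LINT x|dx T. ?f x) = (\<Sum>K\<in>cells T. LINT x|lborel. indicator K x * h K x)" .
qed

lemma integrable_on_face:
  fixes f :: "real^'n \<Rightarrow> real"
  assumes S: "S \<in> faces T" and f: "continuous_on S f"
  shows "integrable (ds T S) f"
proof -
  interpret finite_measure "ds T S" using S by (rule finite_measure_face)
  have "f \<in> borel_measurable (restrict_space borel S)"
    using f by (rule borel_measurable_continuous_on_restrict)
  then have m: "f \<in> borel_measurable (ds T S)"
    by (simp cong: measurable_cong_sets add: sets_surface_measure)
  have "bounded (f ` S)" by (intro compact_imp_bounded compact_continuous_image f face_compact S)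
  then obtain b where "\<And>x. x \<in> S \<Longrightarrow> norm (f x) \<le> b" by (auto simp: bounded_iff)
  then show ?thesis by (intro integrable_const_bound[OF AE_I2 m, of b]) simp
qed

text \<open>The prism over a single point is a segment, which has measure zero in dimension at least two.\<close>

lemma face_diameter:
  assumes S: "S \<in> faces T" and n: "CARD('n) \<ge> 2"
  shows "diameter S > 0"
proof (rule ccontr)
  assume "\<not> diameter S > 0"
  then have d0: "diameter S \<le> 0" by simp
  obtain p where p: "p \<in> S" using face_ne[OF S] by blast
  have "x = p" if "x \<in> S" for x
    using diameter_bounded_bound[OF compact_imp_bounded[OF face_compact[OF S]] that p] d0
    by (metis dist_le_zero_iff order_trans)
  then have Sp: "S = {p}" using p by blast
  let ?e = "fnormal T S"
  have "dim {?e} < DIM(real^'n)" using dim_le_card'[of "{?e}"] n by simp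
  then obtain u where u0: "u \<noteq> 0" and orth: "\<And>y. y \<in> span {?e} \<Longrightarrow> orthogonal u y"
    by (rule orthogonal_to_subspace_exists) blast
  have u: "u \<noteq> 0" "orthogonal u ?e" using u0 orth[OF span_base] by simp_all
  have "emeasure (ds T S) S = emeasure lborel
    {y. offset T S \<le> ?e \<bullet> y \<and> ?e \<bullet> y \<le> offset T S + 1 \<and> foot ?e (offset T S) y \<in> S}"
    using face_borel[OF S] face_plane[OF S] face_ne[OF S] by (intro emeasure_surface_measure) auto
  also have "\<dots> \<le> emeasure lborel {y. u \<bullet> y = u \<bullet> p}"
  proof (rule emeasure_mono)
    show "{y. offset T S \<le> ?e \<bullet> y \<and> ?e \<bullet> y \<le> offset T S + 1 \<and> foot ?e (offset T S) y \<in> S} \<subseteq> {y. u \<bullet> y = u \<bullet> p}"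
    proof (rule subsetI, clarify)
      fix y assume "foot ?e (offset T S) y \<in> S"
      then have "y - (?e \<bullet> y - offset T S) *\<^sub>R ?e = p" using Sp by (simp add: foot_def)
      then have "u \<bullet> (y - (?e \<bullet> y - offset T S) *\<^sub>R ?e) = u \<bullet> p" by simp
      then show "u \<bullet> y = u \<bullet> p" using u(2) by (simp add: orthogonal_def inner_diff_right)
    qed
  qed (auto intro!: borel_closed closed_hyperplane)
  also have "\<dots> = 0"
  proof -
    have "{y. u \<bullet> y = u \<bullet> p} \<in> null_sets lebesgue"
      using negligible_hyperplane[of u] u(1) by (simp add: negligible_iff_null_sets)
    then show ?thesis by (simp add: null_sets_completion_iff null_sets_def borel_closed closed_hyperplane)
  qed
  finally show False using face_pos[OF S] by simp
qed

end

section \<open>Polynomials\<close>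

text \<open>Every line through \<open>x0\<close> contains finitely many zeros of \<open>q\<close>. By Fubini, for almost every \<open>t\<close> the set
of all \<open>y\<close> with \<open>q (x0 + t *\<^sub>R y) = 0\<close> is a null set. One such \<open>t \<noteq> 0\<close> suffices, because this set is an
affine image of the zero set.\<close>

lemma AE_polynomial_nonzero:
  fixes q :: "'a::euclidean_space \<Rightarrow> real"
  assumes q: "real_polynomial_function q" and x0: "q x0 \<noteq> 0"
  shows "AE x in lborel. q x \<noteq> 0"
proof -
  have contq: "continuous_on UNIV q"
    using q by (simp add: continuous_on_polymonial_function real_polynomial_function_eq)
  have [measurable]: "q \<in> borel_measurable borel" using contq by (rule borel_measurable_continuous_onI)
  have roots: "finite {t::real. q (x0 + t *\<^sub>R y) = 0}" for y
  proof -
    have "polynomial_function (\<lambda>t::real. x0 + t *\<^sub>R y)" by (intro polynomial_function_add polynomial_function_mult) auto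
    then have "real_polynomial_function (q \<circ> (\<lambda>t::real. x0 + t *\<^sub>R y))"
      using q by (rule real_polynomial_function_compose)
    then obtain a n where an: "q \<circ> (\<lambda>t::real. x0 + t *\<^sub>R y) = (\<lambda>t. \<Sum>i\<le>n. a i * t ^ i)"
      using real_polynomial_function_imp_sum by blast
    have at: "q (x0 + t *\<^sub>R y) = (\<Sum>i\<le>n. a i * t ^ i)" for t using fun_cong[OF an, of t] by simp
    have "(\<Sum>i\<le>n. a i * 0 ^ i) \<noteq> 0" using at[of 0] x0 by simp
    moreover have "(\<Sum>i\<le>n. a i * 0 ^ i) = 0" if "\<not> (\<exists>i\<le>n. a i \<noteq> 0)"
      using that by (intro sum.neutral) auto
    ultimately have "\<exists>i\<le>n. a i \<noteq> 0" by blast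
    then have "finite {t. (\<Sum>i\<le>n. a i * t ^ i) = 0}" using polyfun_finite_roots by blast
    then show "finite {t::real. q (x0 + t *\<^sub>R y) = 0}" by (simp only: at)
  qed
  have "AE y in lborel. AE t in lborel. q (x0 + t *\<^sub>R y) \<noteq> 0"
  proof (rule AE_I2)
    fix y :: 'a
    have "{t::real. q (x0 + t *\<^sub>R y) = 0} \<in> null_sets lborel"
      using roots by (rule finite_imp_null_set_lborel)
    from AE_not_in[OF this] show "AE t in lborel. q (x0 + t *\<^sub>R y) \<noteq> 0" by simp
  qed
  then have "AE t in (lborel :: real measure). AE y in lborel. q (x0 + t *\<^sub>R y) \<noteq> 0"
    by (subst (asm) lborel_pair.AE_commute) measurable
  moreover have "AE t in (lborel :: real measure). t \<noteq> 0" by (rule AE_lborel_singleton)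
  ultimately have "AE t in (lborel :: real measure). t \<noteq> 0 \<and> (AE y in lborel. q (x0 + t *\<^sub>R y) \<noteq> 0)"
    by eventually_elim simp
  then obtain t :: real where t: "t \<noteq> 0 \<and> (AE y in lborel. q (x0 + t *\<^sub>R y) \<noteq> 0)"
    by (rule AE_ex) auto
  have "AE x in density (distr lborel borel (\<lambda>y. x0 + t *\<^sub>R y)) (\<lambda>_. ennreal (\<bar>t\<bar> ^ DIM('a))). q x \<noteq> 0"
  proof (subst AE_density, simp, rule AE_I2[THEN AE_mp])
    show "AE x in distr lborel borel (\<lambda>y. x0 + t *\<^sub>R y). True \<longrightarrow> 0 < ennreal (\<bar>t\<bar> ^ DIM('a)) \<longrightarrow> q x \<noteq> 0"
      using t by (subst AE_distr_iff) (simp_all, measurable)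
  qed simp
  then show ?thesis using t by (subst lborel_affine[of t x0]) auto
qed

definition multideg_le :: "nat \<Rightarrow> ('n::finite \<Rightarrow> nat) set" where
  "multideg_le k = {\<alpha>. (\<Sum>i\<in>UNIV. \<alpha> i) \<le> k}"

definition monomial :: "('n::finite \<Rightarrow> nat) \<Rightarrow> real^'n \<Rightarrow> real" where
  "monomial \<alpha> x = (\<Prod>i\<in>UNIV. (x $ i) ^ \<alpha> i)"

lemma finite_multideg_le [simp, intro]: "finite (multideg_le k :: ('n::finite \<Rightarrow> nat) set)"
proof (rule finite_subset)
  show "(multideg_le k :: ('n \<Rightarrow> nat) set) \<subseteq> (UNIV \<rightarrow>\<^sub>E {..k})"
  proof
    fix \<alpha> :: "'n \<Rightarrow> nat" assume "\<alpha> \<in> multideg_le k"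
    then have "\<alpha> i \<le> k" for i
      using member_le_sum[of i UNIV \<alpha>] by (auto simp: multideg_le_def)
    then show "\<alpha> \<in> UNIV \<rightarrow>\<^sub>E {..k}" by auto
  qed
  show "finite ((UNIV :: 'n set) \<rightarrow>\<^sub>E {..k})" by (intro finite_PiE) auto
qed

lemma polys_eq: "polys k = {p. \<exists>c. \<forall>x. p x = (\<Sum>\<alpha>\<in>multideg_le k. monomial \<alpha> x *\<^sub>R c \<alpha>)}"
  by (simp add: polys_def multideg_le_def monomial_def)

lemma polys_add: assumes "p \<in> polys k" "q \<in> polys k" shows "(\<lambda>x. p x + q x) \<in> polys k"
proof -
  from assms obtain c d where "\<forall>x. p x = (\<Sum>\<alpha>\<in>multideg_le k. monomial \<alpha> x *\<^sub>R c \<alpha>)"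
    "\<forall>x. q x = (\<Sum>\<alpha>\<in>multideg_le k. monomial \<alpha> x *\<^sub>R d \<alpha>)" by (auto simp: polys_eq)
  then show ?thesis unfolding polys_eq
    by (intro CollectI exI[of _ "\<lambda>\<alpha>. c \<alpha> + d \<alpha>"]) (simp add: sum.distrib scaleR_add_right)
qed

lemma polys_linear: assumes "p \<in> polys k" "linear f" shows "(\<lambda>x. f (p x)) \<in> polys k"
proof -
  from assms obtain c where "\<forall>x. p x = (\<Sum>\<alpha>\<in>multideg_le k. monomial \<alpha> x *\<^sub>R c \<alpha>)" by (auto simp: polys_eq)
  then show ?thesis unfolding polys_eq
    by (intro CollectI exI[of _ "\<lambda>\<alpha>. f (c \<alpha>)"]) (simp add: linear_sum[OF assms(2)] linear_scale[OF assms(2)])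
qed

lemma polys_scaleR: "p \<in> polys k \<Longrightarrow> (\<lambda>x. t *\<^sub>R p x) \<in> polys k"
  by (rule polys_linear) (auto intro!: linearI simp: algebra_simps)

lemma polys_diff: assumes "p \<in> polys k" "q \<in> polys k" shows "(\<lambda>x. p x - q x) \<in> polys k"
  using polys_add[OF assms(1) polys_scaleR[OF assms(2), of "- 1"]] by simp

lemma polys_monomial:
  fixes v :: "'b::real_vector"
  assumes "\<beta> \<in> multideg_le k"
  shows "(\<lambda>x. monomial \<beta> x *\<^sub>R v) \<in> polys k"
  unfolding polys_eq
proof (intro CollectI exI[of _ "\<lambda>\<alpha>. if \<alpha> = \<beta> then v else 0"] allI)
  fix x :: "real^'a"
  have "(\<Sum>\<alpha>\<in>multideg_le k. monomial \<alpha> x *\<^sub>R (if \<alpha> = \<beta> then v else 0))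
    = (\<Sum>\<alpha>\<in>multideg_le k. if \<alpha> = \<beta> then monomial \<beta> x *\<^sub>R v else 0)"
    by (intro sum.cong) auto
  then show "monomial \<beta> x *\<^sub>R v = (\<Sum>\<alpha>\<in>multideg_le k. monomial \<alpha> x *\<^sub>R (if \<alpha> = \<beta> then v else 0))"
    using assms by simp
qed

lemma polys_const: "(\<lambda>x. v) \<in> polys k"
  using polys_monomial[of "\<lambda>_. 0" k v] by (simp add: multideg_le_def monomial_def)

lemma polys_sum: "finite I \<Longrightarrow> (\<And>i. i \<in> I \<Longrightarrow> p i \<in> polys k) \<Longrightarrow> (\<lambda>x. \<Sum>i\<in>I. p i x) \<in> polys k"
  by (induction I rule: finite_induct) (auto intro: polys_const polys_add)

lemma monomial_has_derivative:
  "(monomial \<alpha> has_derivative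
     (\<lambda>h. \<Sum>i\<in>UNIV. real (\<alpha> i) * monomial (\<alpha>(i := \<alpha> i - 1)) x * (h $ i))) (at x)"
proof -
  have "((\<lambda>x. \<Prod>i\<in>UNIV. (x $ i) ^ \<alpha> i) has_derivative
     (\<lambda>h. \<Sum>i\<in>UNIV. (real (\<alpha> i) * (h $ i) * (x $ i) ^ (\<alpha> i - 1)) * (\<Prod>j\<in>UNIV - {i}. (x $ j) ^ \<alpha> j))) (at x)"
    by (rule has_derivative_prod) (auto intro!: derivative_eq_intros bounded_linear.has_derivative[OF bounded_linear_vec_nth])
  moreover have "monomial (\<alpha>(i := \<alpha> i - 1)) x = (x $ i) ^ (\<alpha> i - 1) * (\<Prod>j\<in>UNIV - {i}. (x $ j) ^ \<alpha> j)" for i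
    unfolding monomial_def by (subst prod.remove[of UNIV i]) auto
  ultimately show ?thesis
    unfolding monomial_def[abs_def] by (simp add: mult_ac)
qed

lemma polys_has_derivative:
  fixes p :: "real^'n \<Rightarrow> 'b::euclidean_space"
  assumes "p \<in> polys k"
  shows "(p has_derivative frechet_derivative p (at x)) (at x)"
proof -
  from assms obtain c where c: "\<forall>x. p x = (\<Sum>\<alpha>\<in>multideg_le k. monomial \<alpha> x *\<^sub>R c \<alpha>)" by (auto simp: polys_eq)
  then have "p = (\<lambda>x. \<Sum>\<alpha>\<in>multideg_le k. monomial \<alpha> x *\<^sub>R c \<alpha>)" by auto
  moreover have "(\<lambda>x. \<Sum>\<alpha>\<in>multideg_le k. monomial \<alpha> x *\<^sub>R c \<alpha>) differentiable (at x)"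
  proof (intro differentiable_sum finite_multideg_le ballI)
    show "(\<lambda>x. monomial \<alpha> x *\<^sub>R c \<alpha>) differentiable at x" for \<alpha>
      unfolding differentiable_def by (rule exI, rule has_derivative_scaleR_left, rule monomial_has_derivative)
  qed
  ultimately show ?thesis by (simp add: frechet_derivative_works)
qed

lemma polys_continuous:
  fixes p :: "real^'n \<Rightarrow> 'b::euclidean_space"
  assumes "p \<in> polys k"
  shows "continuous_on S p"
  using has_derivative_continuous[OF polys_has_derivative[OF assms]]
  by (simp add: continuous_at_imp_continuous_on)

text \<open>Differentiating a monomial lowers one exponent, or gives zero if that exponent is zero.\<close>

lemma polys_partial:
  fixes p :: "real^'n \<Rightarrow> 'b::euclidean_space"
  assumes "p \<in> polys (k + 1)"
  shows "(\<lambda>x. frechet_derivative p (at x) (axis j 1)) \<in> polys k"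
proof -
  from assms obtain c where c: "\<forall>x. p x = (\<Sum>\<alpha>\<in>multideg_le (k + 1). monomial \<alpha> x *\<^sub>R c \<alpha>)" by (auto simp: polys_eq)
  have p_eq: "p = (\<lambda>x. \<Sum>\<alpha>\<in>multideg_le (k + 1). monomial \<alpha> x *\<^sub>R c \<alpha>)" using c by auto
  have "(p has_derivative (\<lambda>h. \<Sum>\<alpha>\<in>multideg_le (k + 1).
      (\<Sum>i\<in>UNIV. real (\<alpha> i) * monomial (\<alpha>(i := \<alpha> i - 1)) x * (h $ i)) *\<^sub>R c \<alpha>)) (at x)" for x
    unfolding p_eq by (intro has_derivative_sum has_derivative_scaleR_left monomial_has_derivative)
  then have D: "frechet_derivative p (at x) = (\<lambda>h. \<Sum>\<alpha>\<in>multideg_le (k + 1).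
      (\<Sum>i\<in>UNIV. real (\<alpha> i) * monomial (\<alpha>(i := \<alpha> i - 1)) x * (h $ i)) *\<^sub>R c \<alpha>)" for x
    by (rule frechet_derivative_at[symmetric])
  have "frechet_derivative p (at x) (axis j 1)
    = (\<Sum>\<alpha>\<in>multideg_le (k + 1). real (\<alpha> j) *\<^sub>R (monomial (\<alpha>(j := \<alpha> j - 1)) x *\<^sub>R c \<alpha>))" for x
    unfolding D by (intro sum.cong refl) (simp add: axis_def if_distrib cong: if_cong)
  moreover have "(\<lambda>x. \<Sum>\<alpha>\<in>multideg_le (k + 1). real (\<alpha> j) *\<^sub>R (monomial (\<alpha>(j := \<alpha> j - 1)) x *\<^sub>R c \<alpha>)) \<in> polys k"
  proof (rule polys_sum)
    fix \<alpha> :: "'n \<Rightarrow> nat" assume a: "\<alpha> \<in> multideg_le (k + 1)"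
    show "(\<lambda>x. real (\<alpha> j) *\<^sub>R (monomial (\<alpha>(j := \<alpha> j - 1)) x *\<^sub>R c \<alpha>)) \<in> polys k"
    proof (cases "\<alpha> j = 0")
      case False
      have "(\<Sum>i\<in>UNIV. (\<alpha>(j := \<alpha> j - 1)) i) + 1 = (\<Sum>i\<in>UNIV. \<alpha> i)"
        using False by (simp add: sum.remove[of UNIV j])
      then have "\<alpha>(j := \<alpha> j - 1) \<in> multideg_le k" using a by (simp add: multideg_le_def)
      then show ?thesis by (intro polys_scaleR polys_monomial)
    qed (simp add: polys_const)
  qed simp
  ultimately show ?thesis by simp
qed

lemma polys_mono:
  assumes "p \<in> polys k" "k \<le> l" shows "p \<in> polys l"
proof -
  from assms(1) obtain c where "\<forall>x. p x = (\<Sum>\<alpha>\<in>multideg_le k. monomial \<alpha> x *\<^sub>R c \<alpha>)" by (auto simp: polys_eq)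
  then have "p = (\<lambda>x. \<Sum>\<alpha>\<in>multideg_le k. monomial \<alpha> x *\<^sub>R c \<alpha>)" by auto
  moreover have "multideg_le k \<subseteq> multideg_le l" using assms(2) by (auto simp: multideg_le_def)
  then have "(\<lambda>x. \<Sum>\<alpha>\<in>multideg_le k. monomial \<alpha> x *\<^sub>R c \<alpha>) \<in> polys l"
    by (intro polys_sum polys_monomial) auto
  ultimately show ?thesis by simp
qed

lemma polys_partial_continuous:
  fixes p :: "real^'n \<Rightarrow> 'b::euclidean_space"
  assumes "p \<in> polys k"
  shows "continuous_on S (\<lambda>x. frechet_derivative p (at x) (axis j 1))"
  using polys_partial[OF polys_mono[OF assms, of "k + 1"]] by (intro polys_continuous) auto

lemma jacobian_nth: "jacobian p (at x) $ i $ j = frechet_derivative p (at x) (axis j 1) $ i"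
  by (simp add: jacobian_def matrix_def)

lemma polys_jacobian:
  fixes p :: "real^'n \<Rightarrow> real^'m"
  assumes "p \<in> polys (k + 1)"
  shows "(\<lambda>x. jacobian p (at x)) \<in> polys k"
proof -
  define col :: "'n \<Rightarrow> real^'m \<Rightarrow> real^'n^'m" where "col j v = (\<chi> i l. if l = j then v $ i else 0)" for j v
  have "linear (col j)" for j by (auto intro!: linearI simp: col_def vec_eq_iff)
  then have "(\<lambda>x. \<Sum>j\<in>UNIV. col j (frechet_derivative p (at x) (axis j 1))) \<in> polys k"
    by (intro polys_sum polys_linear[of _ _ "col _"] polys_partial[OF assms]) auto
  moreover have "jacobian p (at x) = (\<Sum>j\<in>UNIV. col j (frechet_derivative p (at x) (axis j 1)))" for x
    by (simp add: vec_eq_iff jacobian_nth col_def)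
  ultimately show ?thesis by simp
qed

lemma polys_jacobian_zero:
  fixes p :: "real^'n \<Rightarrow> real^'m"
  assumes p: "p \<in> polys k" and J: "\<And>x. jacobian p (at x) = 0"
  shows "\<exists>v. p = (\<lambda>x. v)"
proof -
  have "(p has_derivative (\<lambda>h. 0)) (at x)" for x
  proof -
    have "frechet_derivative p (at x) h = jacobian p (at x) *v h" for h
      unfolding jacobian_def using has_derivative_linear[OF polys_has_derivative[OF p]] by (simp add: matrix_works)
    then have "frechet_derivative p (at x) = (\<lambda>h. 0)" by (auto simp: J)
    then show ?thesis using polys_has_derivative[OF p, of x] by simp
  qed
  then have "\<exists>v. \<forall>x\<in>UNIV. p x = v" by (intro has_derivative_zero_constant) auto
  then show ?thesis by auto
qed

lemma frechet_derivative_polys_add: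
  fixes p q :: "real^'n \<Rightarrow> 'b::euclidean_space"
  assumes "p \<in> polys k" "q \<in> polys k"
  shows "frechet_derivative (\<lambda>x. p x + q x) (at x)
    = (\<lambda>h. frechet_derivative p (at x) h + frechet_derivative q (at x) h)"
  by (rule frechet_derivative_at[symmetric]) (intro has_derivative_add polys_has_derivative[OF assms(1)] polys_has_derivative[OF assms(2)])

lemma frechet_derivative_polys_scaleR:
  fixes p :: "real^'n \<Rightarrow> 'b::euclidean_space"
  assumes "p \<in> polys k"
  shows "frechet_derivative (\<lambda>x. t *\<^sub>R p x) (at x) = (\<lambda>h. t *\<^sub>R frechet_derivative p (at x) h)"
  by (rule frechet_derivative_at[symmetric]) (intro has_derivative_scaleR_right polys_has_derivative[OF assms(1)])

lemma jacobian_add: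
  fixes p q :: "real^'n \<Rightarrow> real^'m"
  assumes "p \<in> polys k" "q \<in> polys k"
  shows "jacobian (\<lambda>x. p x + q x) (at x) = jacobian p (at x) + jacobian q (at x)"
  by (simp add: vec_eq_iff jacobian_nth frechet_derivative_polys_add[OF assms])

lemma jacobian_scaleR:
  fixes p :: "real^'n \<Rightarrow> real^'m"
  assumes "p \<in> polys k"
  shows "jacobian (\<lambda>x. t *\<^sub>R p x) (at x) = t *\<^sub>R jacobian p (at x)"
  by (simp add: vec_eq_iff jacobian_nth frechet_derivative_polys_scaleR[OF assms])

lemma polys_norm_square_polynomial:
  fixes p :: "real^'n \<Rightarrow> 'b::euclidean_space"
  assumes "p \<in> polys k"
  shows "real_polynomial_function (\<lambda>x. p x \<bullet> p x)"
proof -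
  from assms obtain c where c: "\<forall>x. p x = (\<Sum>\<alpha>\<in>multideg_le k. monomial \<alpha> x *\<^sub>R c \<alpha>)" by (auto simp: polys_eq)
  have mono_poly: "polynomial_function (monomial \<alpha>)" for \<alpha> :: "'n \<Rightarrow> nat"
    unfolding monomial_def[abs_def] real_polynomial_function_eq[symmetric]
    by (intro real_polynomial_function_prod real_polynomial_function_power)
       (auto intro!: real_polynomial_function.intros bounded_linear_vec_nth)
  have "polynomial_function (\<lambda>x. \<Sum>\<alpha>\<in>multideg_le k. monomial \<alpha> x *\<^sub>R c \<alpha>)"
    by (intro polynomial_function_sum polynomial_function_mult mono_poly) auto
  moreover have "p = (\<lambda>x. \<Sum>\<alpha>\<in>multideg_le k. monomial \<alpha> x *\<^sub>R c \<alpha>)" using c by auto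
  ultimately have pf: "polynomial_function p" by simp
  have "real_polynomial_function (\<lambda>x. p x \<bullet> b)" if "b \<in> Basis" for b
    using pf that unfolding polynomial_function_iff_Basis_inner by blast
  then have "real_polynomial_function (\<lambda>x. \<Sum>b\<in>Basis. (p x \<bullet> b) * (p x \<bullet> b))"
    by (intro real_polynomial_function_sum real_polynomial_function.intros(4)) auto
  then show ?thesis by (subst euclidean_inner)
qed

context admissible
begin

lemma poly_zero_on_cell:
  fixes p :: "real^'n \<Rightarrow> 'b::euclidean_space"
  assumes p: "p \<in> polys k" and K: "K \<in> cells T" and z: "(LINT x|lborel. indicator K x * (p x \<bullet> p x)) = 0"
  shows "p x = 0"
proof (rule ccontr)
  assume "p x \<noteq> 0"
  then have ae: "AE x in lborel. p x \<bullet> p x \<noteq> 0"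
    by (intro AE_polynomial_nonzero[OF polys_norm_square_polynomial[OF p], of x]) simp
  have "integrable lborel (\<lambda>x. indicator K x *\<^sub>R (p x \<bullet> p x))"
    by (intro borel_integrable_compact cell_compact K continuous_intros polys_continuous[OF p])
  then have "AE x in lborel. indicator K x * (p x \<bullet> p x) = 0"
    using z integral_nonneg_eq_0_iff_AE[of lborel "\<lambda>x. indicator K x * (p x \<bullet> p x)"] by simp
  with ae have "AE x in lborel. x \<notin> K" by eventually_elim auto
  then have "emeasure lborel K = 0"
    using emeasure_eq_0_AE[of "\<lambda>x. x \<in> K" lborel] by simp
  then show False using cell_properties(1)[OF K] by simp
qed

text \<open>Composition with the projection onto the hyperplane gives a polynomial on the whole space. If it
were not zero, it would vanish only on a null set of the prism over the face, whereas the face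
has positive measure.\<close>

lemma poly_zero_on_face:
  fixes p :: "real^'n \<Rightarrow> 'b::euclidean_space"
  assumes p: "p \<in> polys k" and S: "S \<in> faces T" and z: "(LINT x|ds T S. p x \<bullet> p x) = 0" and x: "x \<in> S"
  shows "p x = 0"
proof (rule ccontr)
  assume px: "p x \<noteq> 0"
  let ?f = "foot (fnormal T S) (offset T S)"
  let ?q = "\<lambda>x. p x \<bullet> p x"
  have fx: "?f x = x" using face_plane[OF S] x by (auto simp: foot_def)
  have "polynomial_function ?f"
    unfolding foot_def[abs_def]
    by (intro polynomial_function_diff polynomial_function_mult polynomial_function_const polynomial_function_id
        polynomial_function_bounded_linear bounded_linear_inner_right)
  then have "real_polynomial_function (?q \<circ> ?f)"
    using polys_norm_square_polynomial[OF p] by (rule real_polynomial_function_compose)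
  then have ae: "AE y in lborel. (?q \<circ> ?f) y \<noteq> 0"
    by (rule AE_polynomial_nonzero[of _ x]) (use px fx in simp)
  have contq: "continuous_on A ?q" for A by (intro continuous_intros polys_continuous[OF p])
  have "AE x in ds T S. ?q x \<noteq> 0"
  proof (rule AE_surface_measureI[OF face_borel[OF S] face_plane[OF S] face_ne[OF S]])
    show "{x. ?q x = 0} \<in> sets borel"
      using contq by (intro borel_closed closed_Collect_eq continuous_on_const)
  qed (use ae in \<open>auto elim!: eventually_mono\<close>)
  moreover have "AE x in ds T S. ?q x = 0"
    using z integral_nonneg_eq_0_iff_AE[of "ds T S" ?q] integrable_on_face[OF S contq] by simp
  ultimately have "AE x in ds T S. False" by eventually_elim simp
  then show False using face_AE_ex[OF S] by blast
qed

end

section \<open>Riesz representation on piecewise polynomials\<close>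

definition linear_coeff :: "(('i \<Rightarrow> real) \<Rightarrow> real) \<Rightarrow> bool" where
  "linear_coeff l \<longleftrightarrow> (\<forall>c d. l (\<lambda>i. c i + d i) = l c + l d) \<and> (\<forall>t c. l (\<lambda>i. t * c i) = t * l c)"

text \<open>Gram-Schmidt orthogonalization as an induction over the index set. The form may be degenerate, so
the functional is required to vanish on its kernel.\<close>

lemma riesz_coefficients:
  fixes B :: "('i \<Rightarrow> real) \<Rightarrow> ('i \<Rightarrow> real) \<Rightarrow> real"
  assumes "finite I"
    and sym: "\<And>c d. B c d = B d c" and lin: "\<And>d. linear_coeff (\<lambda>c. B c d)" and pos: "\<And>c. 0 \<le> B c c"
    and "linear_coeff l" and "\<And>c. B c c = 0 \<Longrightarrow> l c = 0"
  shows "\<exists>c. (\<forall>i. i \<notin> I \<longrightarrow> c i = 0) \<and> (\<forall>d. (\<forall>i. i \<notin> I \<longrightarrow> d i = 0) \<longrightarrow> B c d = l d)"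
  using assms(1,5,6)
proof (induction I arbitrary: l rule: finite_induct)
  case empty
  have zero: "f (\<lambda>_. 0) = 0" if "linear_coeff f" for f :: "('i \<Rightarrow> real) \<Rightarrow> real"
  proof -
    have "\<forall>t c. f (\<lambda>i. t * c i) = t * f c" using that by (simp add: linear_coeff_def)
    from this[rule_format, of 0 "\<lambda>_. 0"] show ?thesis by simp
  qed
  show ?case
  proof (intro exI[of _ "\<lambda>_. 0"] conjI allI impI)
    fix d :: "'i \<Rightarrow> real" assume "\<forall>i. i \<notin> {} \<longrightarrow> d i = 0"
    then have "d = (\<lambda>_. 0)" by auto
    then show "B (\<lambda>_. 0) d = l d" by (simp only: zero[OF empty(1)] zero[OF lin])
  qed simp
next
  case (insert k I)
  have addB: "B (\<lambda>i. c i + d i) e = B c e + B d e" and scB: "B (\<lambda>i. t * c i) e = t * B c e" for c d e t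
    using lin[of e] by (auto simp: linear_coeff_def)
  have addB': "B e (\<lambda>i. c i + d i) = B e c + B e d" and scB': "B e (\<lambda>i. t * c i) = t * B e c" for c d e t
    using addB scB sym by metis+
  have addl: "l (\<lambda>i. c i + d i) = l c + l d" and scl: "l (\<lambda>i. t * c i) = t * l c" for c d t
    using insert.prems(1) by (auto simp: linear_coeff_def)
  have null: "B c d = 0" if "B c c = 0" for c d
  proof (rule ccontr)
    assume nz: "B c d \<noteq> 0"
    \<comment> \<open>the quadratic form is affine in \<open>t\<close> and takes the value \<open>- 1\<close> here\<close>
    define t where "t = - (B d d + 1) / (2 * B c d)"
    have "B (\<lambda>i. d i + t * c i) (\<lambda>i. d i + t * c i) = B d d + 2 * t * B c d"
      using sym[of d c] that by (simp add: addB scB addB' scB')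
    also have "\<dots> = - 1" using nz by (simp add: t_def field_simps)
    finally show False using pos[of "\<lambda>i. d i + t * c i"] by simp
  qed
  define \<delta> where "\<delta> i = (if i = k then 1 else 0 :: real)" for i
  have lin\<delta>: "linear_coeff (B \<delta>)" unfolding linear_coeff_def by (simp add: addB' scB')
  have "B \<delta> c = 0" if "B c c = 0" for c using null[OF that] sym by simp
  from insert.IH[OF lin\<delta> this] obtain p where p: "\<And>i. i \<notin> I \<Longrightarrow> p i = 0"
    and Bp: "\<And>d. (\<forall>i. i \<notin> I \<longrightarrow> d i = 0) \<Longrightarrow> B p d = B \<delta> d" by blast
  from insert.IH[OF insert.prems] obtain c0 where c0: "\<And>i. i \<notin> I \<Longrightarrow> c0 i = 0"
    and Bc0: "\<And>d. (\<forall>i. i \<notin> I \<longrightarrow> d i = 0) \<Longrightarrow> B c0 d = l d" by blast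
  \<comment> \<open>the part of the new unit vector that is orthogonal to the vectors supported on \<open>I\<close>\<close>
  define q where "q i = \<delta> i + (- 1) * p i" for i
  have qk: "q k = 1" using p[OF insert.hyps(2)] by (simp add: q_def \<delta>_def)
  have q0: "q i = 0" if "i \<notin> insert k I" for i using that p[of i] by (simp add: q_def \<delta>_def)
  have Bq: "B q d = 0" if "\<forall>i. i \<notin> I \<longrightarrow> d i = 0" for d
    using Bp[OF that] unfolding q_def by (simp only: addB scB)
  \<comment> \<open>if \<open>B q q = 0\<close>, both sides of the equation for the new vector vanish\<close>
  define s where "s = (if B q q = 0 then 0 else (l q - B c0 q) / B q q)"
  define c where "c i = c0 i + s * q i" for i
  have Bc: "B c d = B c0 d + s * B q d" for d unfolding c_def by (simp only: addB scB)
  have Bcq: "B c q = l q"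
    using null[of q c0] sym[of c0 q] insert.prems(2)[of q] by (auto simp: Bc s_def)
  show ?case
  proof (intro exI[of _ c] conjI allI impI)
    fix i assume "i \<notin> insert k I"
    then show "c i = 0" using c0 q0 by (simp add: c_def)
  next
    fix d :: "'i \<Rightarrow> real" assume d: "\<forall>i. i \<notin> insert k I \<longrightarrow> d i = 0"
    define d' where "d' i = d i - d k * q i" for i
    have d': "\<forall>i. i \<notin> I \<longrightarrow> d' i = 0" 
    proof (intro allI impI)
      fix i assume "i \<notin> I"
      then show "d' i = 0" using d q0[of i] qk by (cases "i = k") (simp_all add: d'_def)
    qed
    have dd: "d = (\<lambda>i. d' i + d k * q i)" by (simp add: d'_def)
    have "B c d = B c d' + d k * B c q" by (subst dd) (simp only: addB' scB')
    also have "B c d' = l d'" using Bc0[OF d'] Bq[OF d'] by (simp add: Bc)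
    also have "l d' + d k * B c q = l d" unfolding Bcq by (subst (2) dd) (simp only: addl scl)
    finally show "B c d = l d" .
  qed
qed

definition cpoly :: "nat \<Rightarrow> ('k \<times> ('n \<Rightarrow> nat) \<times> 'b \<Rightarrow> real) \<Rightarrow> 'k \<Rightarrow> real^'n \<Rightarrow> 'b::euclidean_space" where
  "cpoly k c \<kappa> x = (\<Sum>\<alpha>\<in>multideg_le k. \<Sum>b\<in>Basis. (c (\<kappa>, \<alpha>, b) * monomial \<alpha> x) *\<^sub>R b)"

lemma cpoly_polys: "cpoly k c \<kappa> \<in> polys k"
proof -
  have "(\<lambda>x. \<Sum>\<alpha>\<in>multideg_le k. \<Sum>b\<in>Basis. monomial \<alpha> x *\<^sub>R (c (\<kappa>, \<alpha>, b) *\<^sub>R b)) \<in> polys k"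
    by (intro polys_sum polys_monomial) auto
  then show ?thesis unfolding cpoly_def[abs_def] by (simp add: mult.commute)
qed

text \<open>Coefficients of vector-valued polynomials are split into real ones along the basis, which makes the
family of all pieces depend linearly on finitely many real numbers.\<close>

lemma polys_cpoly:
  fixes w :: "'k \<Rightarrow> real^'n \<Rightarrow> 'b::euclidean_space"
  assumes "\<And>\<kappa>. \<kappa> \<in> A \<Longrightarrow> w \<kappa> \<in> polys k"
  obtains c where "\<And>\<kappa>. \<kappa> \<in> A \<Longrightarrow> w \<kappa> = cpoly k c \<kappa>"
    and "\<And>i. i \<notin> A \<times> multideg_le k \<times> Basis \<Longrightarrow> c i = 0"
proof -
  have "\<forall>\<kappa>\<in>A. \<exists>C. \<forall>x. w \<kappa> x = (\<Sum>\<alpha>\<in>multideg_le k. monomial \<alpha> x *\<^sub>R C \<alpha>)"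
    using assms by (auto simp: polys_eq)
  then obtain C where C: "\<And>\<kappa> x. \<kappa> \<in> A \<Longrightarrow> w \<kappa> x = (\<Sum>\<alpha>\<in>multideg_le k. monomial \<alpha> x *\<^sub>R C \<kappa> \<alpha>)"
    by metis
  define c where "c = (\<lambda>(\<kappa>, \<alpha>, b). if \<kappa> \<in> A \<and> \<alpha> \<in> multideg_le k \<and> b \<in> Basis then C \<kappa> \<alpha> \<bullet> b else 0)"
  have "w \<kappa> x = cpoly k c \<kappa> x" if "\<kappa> \<in> A" for \<kappa> x
    unfolding C[OF that] cpoly_def
  proof (intro sum.cong refl)
    fix \<alpha> :: "'n \<Rightarrow> nat" assume \<alpha>: "\<alpha> \<in> multideg_le k"
    have "(\<Sum>b\<in>Basis. (c (\<kappa>, \<alpha>, b) * monomial \<alpha> x) *\<^sub>R b) = (\<Sum>b\<in>Basis. monomial \<alpha> x *\<^sub>R ((C \<kappa> \<alpha> \<bullet> b) *\<^sub>R b))"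
      using that \<alpha> by (intro sum.cong) (auto simp: c_def mult.commute)
    also have "\<dots> = monomial \<alpha> x *\<^sub>R C \<kappa> \<alpha>"
      by (simp only: scaleR_sum_right[symmetric] euclidean_representation)
    finally show "monomial \<alpha> x *\<^sub>R C \<kappa> \<alpha> = (\<Sum>b\<in>Basis. (c (\<kappa>, \<alpha>, b) * monomial \<alpha> x) *\<^sub>R b)" ..
  qed
  moreover have "c i = 0" if "i \<notin> A \<times> multideg_le k \<times> Basis" for i
    using that by (cases i) (auto simp: c_def)
  ultimately show ?thesis by (intro that[of c] ext) auto
qed

lemma cpoly_add: "cpoly k (\<lambda>i. c i + d i) = (\<lambda>\<kappa> x. cpoly k c \<kappa> x + cpoly k d \<kappa> x)"
  by (simp add: cpoly_def fun_eq_iff sum.distrib algebra_simps)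

lemma cpoly_scale: "cpoly k (\<lambda>i. t * c i) = (\<lambda>\<kappa> x. t *\<^sub>R cpoly k c \<kappa> x)"
  by (simp add: cpoly_def fun_eq_iff scaleR_sum_right mult.assoc)

text \<open>The functions are unrestricted outside \<open>A\<close>, unlike in \<open>cell_polys\<close>, so that pointwise sums and
multiples stay in the set.\<close>

definition pw_polys :: "'k set \<Rightarrow> nat \<Rightarrow> ('k \<Rightarrow> real^'n \<Rightarrow> 'b::real_vector) set" where
  "pw_polys A k = {w. \<forall>\<kappa>\<in>A. w \<kappa> \<in> polys k}"

text \<open>The third clause makes a functional independent of the values outside \<open>A\<close>.\<close>

definition pw_linear :: "'k set \<Rightarrow> nat \<Rightarrow> (('k \<Rightarrow> real^'n \<Rightarrow> 'b::real_vector) \<Rightarrow> real) \<Rightarrow> bool" where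
  "pw_linear A k l \<longleftrightarrow>
    (\<forall>v\<in>pw_polys A k. \<forall>w\<in>pw_polys A k. l (\<lambda>\<kappa> x. v \<kappa> x + w \<kappa> x) = l v + l w) \<and>
    (\<forall>t. \<forall>v\<in>pw_polys A k. l (\<lambda>\<kappa> x. t *\<^sub>R v \<kappa> x) = t * l v) \<and>
    (\<forall>v\<in>pw_polys A k. \<forall>w\<in>pw_polys A k. (\<forall>\<kappa>\<in>A. v \<kappa> = w \<kappa>) \<longrightarrow> l v = l w)"

lemma pw_linearD:
  assumes "pw_linear A k l"
  shows "v \<in> pw_polys A k \<Longrightarrow> w \<in> pw_polys A k \<Longrightarrow> l (\<lambda>\<kappa> x. v \<kappa> x + w \<kappa> x) = l v + l w"
    and "v \<in> pw_polys A k \<Longrightarrow> l (\<lambda>\<kappa> x. t *\<^sub>R v \<kappa> x) = t * l v"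
    and "v \<in> pw_polys A k \<Longrightarrow> w \<in> pw_polys A k \<Longrightarrow> (\<And>\<kappa>. \<kappa> \<in> A \<Longrightarrow> v \<kappa> = w \<kappa>) \<Longrightarrow> l v = l w"
  using assms unfolding pw_linear_def by blast+

lemma pw_linear_zero:
  assumes l: "pw_linear A k l" and w: "w \<in> pw_polys A k" and z: "\<And>\<kappa> x. \<kappa> \<in> A \<Longrightarrow> w \<kappa> x = 0"
  shows "l w = 0"
proof -
  have "l (\<lambda>\<kappa> x. 0 *\<^sub>R w \<kappa> x) = 0 * l w" using l w by (rule pw_linearD(2))
  moreover have "l (\<lambda>\<kappa> x. 0 *\<^sub>R w \<kappa> x) = l w"
    by (rule pw_linearD(3)[OF l _ w]) (auto simp: pw_polys_def polys_const z)
  ultimately show ?thesis by simp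
qed

text \<open>The semidefinite case covers both the \<open>L\<^sup>2\<close> inner product and the inner product of gradients.\<close>

lemma riesz_pw_polys:
  fixes b :: "('k \<Rightarrow> real^'n \<Rightarrow> 'b::euclidean_space) \<Rightarrow> ('k \<Rightarrow> real^'n \<Rightarrow> 'b) \<Rightarrow> real"
  assumes A: "finite A"
    and sym: "\<And>v w. b v w = b w v"
    and lin: "\<And>w. w \<in> pw_polys A k \<Longrightarrow> pw_linear A k (\<lambda>v. b v w)"
    and pos: "\<And>w. w \<in> pw_polys A k \<Longrightarrow> 0 \<le> b w w"
    and l: "pw_linear A k l" and compat: "\<And>w. w \<in> pw_polys A k \<Longrightarrow> b w w = 0 \<Longrightarrow> l w = 0"
  obtains w where "w \<in> pw_polys A k" "\<And>\<phi>. \<phi> \<in> pw_polys A k \<Longrightarrow> b w \<phi> = l \<phi>"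
proof -
  let ?I = "A \<times> multideg_le k \<times> (Basis :: 'b set)"
  have fin: "finite ?I" using A by (intro finite_cartesian_product) auto
  have mem: "cpoly k c \<in> pw_polys A k" for c by (simp add: pw_polys_def cpoly_polys)
  have linB: "linear_coeff (\<lambda>c. b (cpoly k c) (cpoly k d))" for d
    unfolding linear_coeff_def cpoly_add cpoly_scale
    using pw_linearD(1,2)[OF lin[OF mem[of d]]] mem by blast
  have linl: "linear_coeff (\<lambda>c. l (cpoly k c))"
    unfolding linear_coeff_def cpoly_add cpoly_scale
    using pw_linearD(1,2)[OF l] mem by blast
  have "\<exists>c. (\<forall>i. i \<notin> ?I \<longrightarrow> c i = 0) \<and>
      (\<forall>d. (\<forall>i. i \<notin> ?I \<longrightarrow> d i = 0) \<longrightarrow> b (cpoly k c) (cpoly k d) = l (cpoly k d))"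
    by (rule riesz_coefficients[OF fin _ linB _ linl]) (rule sym, rule pos[OF mem], rule compat[OF mem])
  then obtain c where c: "\<And>d. (\<forall>i. i \<notin> ?I \<longrightarrow> d i = 0) \<Longrightarrow> b (cpoly k c) (cpoly k d) = l (cpoly k d)"
    by blast
  show ?thesis
  proof (rule that[OF mem[of c]])
    fix \<phi> :: "'k \<Rightarrow> real^'n \<Rightarrow> 'b" assume \<phi>: "\<phi> \<in> pw_polys A k"
    then obtain d where d: "\<And>\<kappa>. \<kappa> \<in> A \<Longrightarrow> \<phi> \<kappa> = cpoly k d \<kappa>" "\<And>i. i \<notin> ?I \<Longrightarrow> d i = 0"
      using polys_cpoly[of A \<phi> k] unfolding pw_polys_def by blast
    have "b (cpoly k c) \<phi> = b \<phi> (cpoly k c)" by (rule sym)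
    also have "\<dots> = b (cpoly k d) (cpoly k c)"
      using d(1) by (intro pw_linearD(3)[OF lin[OF mem]] \<phi> mem) auto
    also have "\<dots> = b (cpoly k c) (cpoly k d)" by (rule sym)
    also have "\<dots> = l (cpoly k d)" using c d(2) by blast
    also have "\<dots> = l \<phi>" using d(1) by (intro pw_linearD(3)[OF l] \<phi> mem) auto
    finally show "b (cpoly k c) \<phi> = l \<phi>" .
  qed
qed

lemma pw_polys_add: "v \<in> pw_polys A k \<Longrightarrow> w \<in> pw_polys A k \<Longrightarrow> (\<lambda>\<kappa> x. v \<kappa> x + w \<kappa> x) \<in> pw_polys A k"
  and pw_polys_diff: "v \<in> pw_polys A k \<Longrightarrow> w \<in> pw_polys A k \<Longrightarrow> (\<lambda>\<kappa> x. v \<kappa> x - w \<kappa> x) \<in> pw_polys A k"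
  by (auto simp: pw_polys_def intro: polys_add polys_diff)

lemma pw_linearI:
  assumes "\<And>v w. v \<in> pw_polys A k \<Longrightarrow> w \<in> pw_polys A k \<Longrightarrow> l (\<lambda>\<kappa> x. v \<kappa> x + w \<kappa> x) = l v + l w"
    and "\<And>t v. v \<in> pw_polys A k \<Longrightarrow> l (\<lambda>\<kappa> x. t *\<^sub>R v \<kappa> x) = t * l v"
    and "\<And>v w. v \<in> pw_polys A k \<Longrightarrow> w \<in> pw_polys A k \<Longrightarrow> \<forall>\<kappa>\<in>A. v \<kappa> = w \<kappa> \<Longrightarrow> l v = l w"
  shows "pw_linear A k l"
  using assms unfolding pw_linear_def by blast

lemma pw_linear_combination:
  assumes f: "pw_linear A k f" and g: "pw_linear A k g"
  shows "pw_linear A k (\<lambda>v. a * f v + b * g v)"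
proof (rule pw_linearI)
  fix v w :: "'a \<Rightarrow> real^'b \<Rightarrow> 'c" assume vw: "v \<in> pw_polys A k" "w \<in> pw_polys A k"
  show "a * f (\<lambda>\<kappa> x. v \<kappa> x + w \<kappa> x) + b * g (\<lambda>\<kappa> x. v \<kappa> x + w \<kappa> x) = (a * f v + b * g v) + (a * f w + b * g w)"
    by (simp only: pw_linearD(1)[OF f vw] pw_linearD(1)[OF g vw] distrib_left ac_simps)
  show "a * f v + b * g v = a * f w + b * g w" if eq: "\<forall>\<kappa>\<in>A. v \<kappa> = w \<kappa>"
  proof -
    have "f v = f w" by (rule pw_linearD(3)[OF f vw bspec[OF eq]])
    moreover have "g v = g w" by (rule pw_linearD(3)[OF g vw bspec[OF eq]])
    ultimately show ?thesis by simp
  qed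
next
  fix t and v :: "'a \<Rightarrow> real^'b \<Rightarrow> 'c" assume v: "v \<in> pw_polys A k"
  show "a * f (\<lambda>\<kappa> x. t *\<^sub>R v \<kappa> x) + b * g (\<lambda>\<kappa> x. t *\<^sub>R v \<kappa> x) = t * (a * f v + b * g v)"
    by (simp only: pw_linearD(2)[OF f v] pw_linearD(2)[OF g v] distrib_left ac_simps)
qed

lemma pw_linear_zero_functional: "pw_linear A k (\<lambda>v. 0)"
  by (rule pw_linearI) simp_all

lemma pw_linear_add: "pw_linear A k f \<Longrightarrow> pw_linear A k g \<Longrightarrow> pw_linear A k (\<lambda>v. f v + g v)"
  using pw_linear_combination[of A k f g 1 1] by simp

lemma pw_linear_diff: "pw_linear A k f \<Longrightarrow> pw_linear A k g \<Longrightarrow> pw_linear A k (\<lambda>v. f v - g v)"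
  using pw_linear_combination[of A k f g 1 "- 1"] by simp

lemma pw_linear_cmult: "pw_linear A k f \<Longrightarrow> pw_linear A k (\<lambda>v. t * f v)"
  using pw_linear_combination[of A k f f t 0] by simp

lemma pw_linear_sum: "finite I \<Longrightarrow> (\<And>i. i \<in> I \<Longrightarrow> pw_linear A k (f i)) \<Longrightarrow> pw_linear A k (\<lambda>v. \<Sum>i\<in>I. f i v)"
  by (induction I rule: finite_induct) (simp_all add: pw_linear_zero_functional pw_linear_add)

text \<open>All functionals below are combinations of integrals that depend linearly on one polynomial piece;
\<open>F\<close> maps this piece to the integrand.\<close>

lemma pw_linear_integral:
  fixes F :: "(real^'n \<Rightarrow> 'b::euclidean_space) \<Rightarrow> 'x \<Rightarrow> real"
  assumes K: "K \<in> A"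
    and int: "\<And>p. p \<in> polys k \<Longrightarrow> integrable M (F p)"
    and add: "\<And>p q x. p \<in> polys k \<Longrightarrow> q \<in> polys k \<Longrightarrow> x \<in> space M \<Longrightarrow> F (\<lambda>x. p x + q x) x = F p x + F q x"
    and sc: "\<And>t p x. p \<in> polys k \<Longrightarrow> x \<in> space M \<Longrightarrow> F (\<lambda>x. t *\<^sub>R p x) x = t * F p x"
  shows "pw_linear A k (\<lambda>v. LINT x|M. F (v K) x)"
proof -
  have v: "v K \<in> polys k" if "v \<in> pw_polys A k" for v :: "'a \<Rightarrow> real^'n \<Rightarrow> 'b"
    using that K by (simp add: pw_polys_def)
  show ?thesis
  proof (rule pw_linearI)
    fix v w :: "'a \<Rightarrow> real^'n \<Rightarrow> 'b" assume vw: "v \<in> pw_polys A k" "w \<in> pw_polys A k"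
    have "(LINT x|M. F (\<lambda>x. v K x + w K x) x) = (LINT x|M. F (v K) x + F (w K) x)"
      using vw by (intro Bochner_Integration.integral_cong add v) auto
    also have "\<dots> = (LINT x|M. F (v K) x) + (LINT x|M. F (w K) x)"
      using vw by (intro Bochner_Integration.integral_add int v)
    finally show "(LINT x|M. F (\<lambda>x. v K x + w K x) x) = (LINT x|M. F (v K) x) + (LINT x|M. F (w K) x)" .
    show "(LINT x|M. F (v K) x) = (LINT x|M. F (w K) x)" if "\<forall>\<kappa>\<in>A. v \<kappa> = w \<kappa>"
      using bspec[OF that K] by simp
  next
    fix t and v :: "'a \<Rightarrow> real^'n \<Rightarrow> 'b" assume vw: "v \<in> pw_polys A k"
    have "(LINT x|M. F (\<lambda>x. t *\<^sub>R v K x) x) = (LINT x|M. t * F (v K) x)"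
      using vw by (intro Bochner_Integration.integral_cong sc v) auto
    then show "(LINT x|M. F (\<lambda>x. t *\<^sub>R v K x) x) = t * (LINT x|M. F (v K) x)" by simp
  qed
qed

section \<open>Integration by parts on cells and the discrete gradient\<close>

definition divergence :: "(real^'n \<Rightarrow> real^'n^'m) \<Rightarrow> real^'n \<Rightarrow> real^'m" where
  "divergence p x = (\<chi> i. \<Sum>j\<in>UNIV. frechet_derivative p (at x) (axis j 1) $ i $ j)"

lemma divergence_continuous:
  fixes p :: "real^'n \<Rightarrow> real^'n^'m"
  assumes "p \<in> polys k"
  shows "continuous_on S (divergence p)"
  unfolding divergence_def[abs_def]
  by (intro continuous_on_vec_lambda continuous_on_sum continuous_on_component polys_partial_continuous[OF assms])

lemma divergence_add:
  fixes p q :: "real^'n \<Rightarrow> real^'n^'m"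
  assumes "p \<in> polys k" "q \<in> polys k"
  shows "divergence (\<lambda>x. p x + q x) x = divergence p x + divergence q x"
  unfolding divergence_def frechet_derivative_polys_add[OF assms] by (simp add: vec_eq_iff sum.distrib)

lemma divergence_scaleR:
  fixes p :: "real^'n \<Rightarrow> real^'n^'m"
  assumes "p \<in> polys k"
  shows "divergence (\<lambda>x. t *\<^sub>R p x) x = t *\<^sub>R divergence p x"
  unfolding divergence_def frechet_derivative_polys_scaleR[OF assms] by (simp add: vec_eq_iff sum_distrib_left)

lemma jacobian_continuous:
  fixes p :: "real^'n \<Rightarrow> real^'m"
  assumes "p \<in> polys k"
  shows "continuous_on S (\<lambda>x. jacobian p (at x))"
  using polys_jacobian[OF polys_mono[OF assms, of "k + 1"]] by (intro polys_continuous) auto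

lemma linear_column: "linear (column j :: real^'n^'m \<Rightarrow> real^'m)"
  by (auto intro!: linearI simp: column_def vec_eq_iff)

lemma continuous_on_matrix_vector [continuous_intros]:
  fixes p :: "'a::topological_space \<Rightarrow> real^'n^'m"
  assumes "continuous_on S p"
  shows "continuous_on S (\<lambda>x. p x *v e)"
proof -
  have "linear (\<lambda>A :: real^'n^'m. A *v e)"
    by (auto intro!: linearI simp: matrix_vector_mult_add_rdistrib scaleR_matrix_vector_assoc)
  then have "continuous_on UNIV (\<lambda>A :: real^'n^'m. A *v e)"
    by (simp add: linear_continuous_on linear_linear)
  from continuous_on_compose2[OF this assms] show ?thesis by simp
qed

lemma polys_matrix_vector:
  fixes p :: "real^'n \<Rightarrow> real^'l^'m"
  assumes "p \<in> polys k"
  shows "(\<lambda>x. p x *v e) \<in> polys k"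
  by (rule polys_linear[OF assms])
     (auto intro!: linearI simp: matrix_vector_mult_add_rdistrib scaleR_matrix_vector_assoc)

lemma cell_polys_pw: "w \<in> cell_polys T k \<Longrightarrow> w \<in> pw_polys (cells T) k"
  by (auto simp: cell_polys_def pw_polys_def PiE_def)

lemma cell_polysD: "w \<in> cell_polys T k \<Longrightarrow> K \<in> cells T \<Longrightarrow> w K \<in> polys k"
  by (auto simp: cell_polys_def)

lemma pw_polysD: "w \<in> pw_polys A k \<Longrightarrow> K \<in> A \<Longrightarrow> w K \<in> polys k"
  by (simp add: pw_polys_def)

lemma restrict_cell_polys: "w \<in> pw_polys (cells T) k \<Longrightarrow> restrict w (cells T) \<in> cell_polys T k"
  by (auto simp: cell_polys_def pw_polys_def)

lemma cell_polys_mono: "w \<in> cell_polys T k \<Longrightarrow> k \<le> l \<Longrightarrow> w \<in> cell_polys T l"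
  unfolding cell_polys_def using polys_mono by blast

lemma pw_polys_scale: "v \<in> pw_polys A k \<Longrightarrow> (\<lambda>\<kappa> x. t *\<^sub>R v \<kappa> x) \<in> pw_polys A k"
  by (auto simp: pw_polys_def intro: polys_scaleR)

lemma pw_linear_cong:
  assumes "\<And>v. v \<in> pw_polys A k \<Longrightarrow> f v = g v" and g: "pw_linear A k g"
  shows "pw_linear A k f"
proof (rule pw_linearI)
  fix v w :: "'a \<Rightarrow> real^'b \<Rightarrow> 'c" assume vw: "v \<in> pw_polys A k" "w \<in> pw_polys A k"
  show "f (\<lambda>\<kappa> x. v \<kappa> x + w \<kappa> x) = f v + f w"
    by (simp only: assms(1) vw pw_polys_add[OF vw] pw_linearD(1)[OF g vw])
  show "f v = f w" if eq: "\<forall>\<kappa>\<in>A. v \<kappa> = w \<kappa>"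
    unfolding assms(1)[OF vw(1)] assms(1)[OF vw(2)] by (rule pw_linearD(3)[OF g vw bspec[OF eq]])
next
  fix t and v :: "'a \<Rightarrow> real^'b \<Rightarrow> 'c" assume v: "v \<in> pw_polys A k"
  show "f (\<lambda>\<kappa> x. t *\<^sub>R v \<kappa> x) = t * f v"
    by (simp only: assms(1) v pw_polys_scale[OF v] pw_linearD(2)[OF g v])
qed

context admissible
begin

lemma integrable_on_cell:
  fixes f :: "real^'n \<Rightarrow> real"
  assumes "K \<in> cells T" "continuous_on UNIV f"
  shows "integrable lborel (\<lambda>x. indicator K x * f x)"
  using borel_integrable_compact[OF cell_compact[OF assms(1)] continuous_on_subset[OF assms(2)]] by simp

lemma int_inner_eq:
  fixes v w :: "('n, 'b::euclidean_space) pw"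
  assumes "\<And>K. K \<in> cells T \<Longrightarrow> continuous_on UNIV (v K)" "\<And>K. K \<in> cells T \<Longrightarrow> continuous_on UNIV (w K)"
  shows "int_inner T v w = (\<Sum>K\<in>cells T. LINT x|lborel. indicator K x * (v K x \<bullet> w K x))"
    and "integrable (dx T) (\<lambda>x. glue T v x \<bullet> glue T w x)"
  using integral_by_cells[of "\<lambda>K x. v K x \<bullet> w K x"] assms
  unfolding int_inner_def glue_def by (simp_all add: continuous_on_inner)

lemma int_inner_polys:
  fixes v w :: "('n, 'b::euclidean_space) pw"
  assumes "v \<in> pw_polys (cells T) k" "w \<in> pw_polys (cells T) l"
  shows "int_inner T v w = (\<Sum>K\<in>cells T. LINT x|lborel. indicator K x * (v K x \<bullet> w K x))"
  by (rule int_inner_eq(1)) (use assms in \<open>auto simp: pw_polys_def intro: polys_continuous\<close>)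

lemma int_inner_commute: "int_inner T v w = int_inner T w v"
  by (simp add: int_inner_def inner_commute)

lemma sum_faces_cells:
  "(\<Sum>S\<in>faces T. \<Sum>K\<in>{K \<in> cells T. S \<subseteq> K}. g K S) = (\<Sum>K\<in>cells T. \<Sum>S\<in>faces_of_cell T K. g K S)"
  unfolding faces_of_cell_def by (rule sum.swap_restrict) auto

lemma jump_integral:
  fixes w :: "('n, 'b::euclidean_space) pw"
  assumes S: "S \<in> faces T" and w: "\<And>K. K \<in> cells T \<Longrightarrow> continuous_on UNIV (w K)" and u: "continuous_on S u"
  shows "(LINT x|ds T S. jump T w S x \<bullet> u x)
    = (\<Sum>K\<in>{K \<in> cells T. S \<subseteq> K}. orient T K S * (LINT x|ds T S. w K x \<bullet> u x))"
proof -
  have int: "integrable (ds T S) (\<lambda>x. w K x \<bullet> u x)" if "K \<in> cells T" for K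
    by (intro integrable_on_face[OF S] continuous_on_inner u continuous_on_subset[OF w[OF that]]) simp
  have "(LINT x|ds T S. jump T w S x \<bullet> u x)
    = (LINT x|ds T S. (\<Sum>K\<in>{K \<in> cells T. S \<subseteq> K}. orient T K S * (w K x \<bullet> u x)))"
    by (simp add: jump_eq_sum[OF S] inner_sum_left)
  also have "\<dots> = (\<Sum>K\<in>{K \<in> cells T. S \<subseteq> K}. LINT x|ds T S. orient T K S * (w K x \<bullet> u x))"
    using int by (intro Bochner_Integration.integral_sum integrable_mult_right) auto
  finally show ?thesis by simp
qed

text \<open>Rearranged from faces to cells, so that it can be combined with integration by parts on cells.\<close>

lemma jump_integral_sum:
  fixes w :: "('n, 'b::euclidean_space) pw"
  assumes "\<And>K. K \<in> cells T \<Longrightarrow> continuous_on UNIV (w K)" "\<And>S. S \<in> faces T \<Longrightarrow> continuous_on S (u S)"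
  shows "(\<Sum>S\<in>faces T. LINT x|ds T S. jump T w S x \<bullet> u S x)
    = (\<Sum>K\<in>cells T. \<Sum>S\<in>faces_of_cell T K. orient T K S * (LINT x|ds T S. w K x \<bullet> u S x))"
  unfolding sum_faces_cells[symmetric] using assms by (intro sum.cong refl jump_integral) auto

text \<open>The divergence theorem for the products of \<open>v\<close> with the \<open>j\<close>-th column of \<open>R\<close> in the \<open>j\<close>-th direction,
summed over \<open>j\<close>.\<close>

lemma cell_integration_by_parts:
  fixes v :: "real^'n \<Rightarrow> real^'m" and R :: "real^'n \<Rightarrow> real^'n^'m"
  assumes K: "K \<in> cells T" and v: "v \<in> polys a" and R: "R \<in> polys b"
  shows "(LINT x|lborel. indicator K x * (jacobian v (at x) \<bullet> R x)) + (LINT x|lborel. indicator K x * (v x \<bullet> divergence R x))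
    = (\<Sum>S\<in>faces_of_cell T K. orient T K S * (LINT x|ds T S. v x \<bullet> (R x *v fnormal T S)))"
proof -
  let ?v' = "\<lambda>x. frechet_derivative v (at x)" and ?R' = "\<lambda>x. frechet_derivative R (at x)"
  let ?D = "\<lambda>j x h. v x \<bullet> column j (?R' x h) + ?v' x h \<bullet> column j (R x)"
  have bl: "bounded_linear (column j :: real^'n^'m \<Rightarrow> real^'m)" for j
    using linear_column by (simp add: linear_linear)
  have D: "((\<lambda>x. v x \<bullet> column j (R x)) has_derivative ?D j y) (at y)" for j y
    by (rule has_derivative_inner[OF polys_has_derivative[OF v]
          bounded_linear.has_derivative[OF bl polys_has_derivative[OF R]]])
  have colc: "continuous_on UNIV (\<lambda>x. column j (g x))" if "continuous_on UNIV g" for g :: "real^'n \<Rightarrow> real^'n^'m" and j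
    using bounded_linear.continuous_on[OF bl that] .
  have cont: "continuous_on UNIV (\<lambda>y. ?D j y (axis j 1))" for j
    by (intro continuous_on_add continuous_on_inner colc polys_partial_continuous[OF R] polys_partial_continuous[OF v]
        polys_continuous[OF v] polys_continuous[OF R])
  have fc: "S \<in> faces T" if "S \<in> faces_of_cell T K" for S using that by (simp add: faces_of_cell_def)
  have pointwise: "jacobian v (at x) \<bullet> R x + v x \<bullet> divergence R x = (\<Sum>j\<in>UNIV. ?D j x (axis j 1))" for x
  proof -
    have "jacobian v (at x) \<bullet> R x = (\<Sum>j\<in>UNIV. ?v' x (axis j 1) \<bullet> column j (R x))"
      unfolding inner_vec_def[of "jacobian v (at x)"] inner_vec_def[of "jacobian v (at x) $ _"]
      by (subst sum.swap) (simp add: inner_vec_def jacobian_nth column_def)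
    moreover have "v x \<bullet> divergence R x = (\<Sum>j\<in>UNIV. v x \<bullet> column j (?R' x (axis j 1)))"
      unfolding inner_vec_def[of "v x"] divergence_def
      by (subst sum.swap) (simp add: column_def sum_distrib_left)
    ultimately show ?thesis by (simp add: sum.distrib)
  qed
  have "(LINT x|lborel. indicator K x * (jacobian v (at x) \<bullet> R x)) + (LINT x|lborel. indicator K x * (v x \<bullet> divergence R x))
    = (LINT x|lborel. indicator K x * (jacobian v (at x) \<bullet> R x) + indicator K x * (v x \<bullet> divergence R x))"
    by (intro Bochner_Integration.integral_add[symmetric] integrable_on_cell[OF K] continuous_on_inner
        jacobian_continuous[OF v] polys_continuous[OF R] polys_continuous[OF v] divergence_continuous[OF R])
  also have "\<dots> = (LINT x|lborel. (\<Sum>j\<in>UNIV. indicator K x * ?D j x (axis j 1)))"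
    by (simp only: distrib_left[symmetric] pointwise sum_distrib_left)
  also have "\<dots> = (\<Sum>j\<in>UNIV. LINT x|lborel. indicator K x * ?D j x (axis j 1))"
    by (rule Bochner_Integration.integral_sum) (intro integrable_on_cell[OF K] cont)
  also have "\<dots> = (\<Sum>j\<in>UNIV. \<Sum>S\<in>faces_of_cell T K. orient T K S * (fnormal T S \<bullet> axis j 1) *
      (LINT x|ds T S. v x \<bullet> column j (R x)))"
    by (intro sum.cong refl cell_divergence[OF K D cont])
  also have "\<dots> = (\<Sum>S\<in>faces_of_cell T K. \<Sum>j\<in>UNIV. orient T K S *
      (LINT x|ds T S. (fnormal T S \<bullet> axis j 1) * (v x \<bullet> column j (R x))))"
    by (subst sum.swap) (simp add: mult.assoc)
  also have "\<dots> = (\<Sum>S\<in>faces_of_cell T K. orient T K S * (LINT x|ds T S. v x \<bullet> (R x *v fnormal T S)))"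
  proof (intro sum.cong refl)
    fix S assume S: "S \<in> faces_of_cell T K"
    have int: "integrable (ds T S) (\<lambda>x. (fnormal T S \<bullet> axis j 1) * (v x \<bullet> column j (R x)))" for j
      by (intro integrable_mult_right integrable_on_face[OF fc[OF S]] continuous_on_inner
          polys_continuous[OF v] continuous_on_subset[OF colc[OF polys_continuous[OF R]]]) simp
    have "(\<Sum>j\<in>UNIV. orient T K S * (LINT x|ds T S. (fnormal T S \<bullet> axis j 1) * (v x \<bullet> column j (R x))))
      = orient T K S * (LINT x|ds T S. (\<Sum>j\<in>UNIV. (fnormal T S \<bullet> axis j 1) * (v x \<bullet> column j (R x))))"
      by (subst Bochner_Integration.integral_sum[OF int]) (simp add: sum_distrib_left)
    also have "\<dots> = orient T K S * (LINT x|ds T S. v x \<bullet> (R x *v fnormal T S))"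
    proof -
      have pw: "(\<Sum>j\<in>UNIV. (fnormal T S \<bullet> axis j 1) * (v x \<bullet> column j (R x))) = v x \<bullet> (R x *v fnormal T S)" for x
      proof -
        have "R x *v fnormal T S = (\<Sum>j\<in>UNIV. fnormal T S $ j *\<^sub>R column j (R x))"
          by (simp add: vec_eq_iff matrix_vector_mult_def column_def mult.commute)
        then show ?thesis by (simp add: inner_sum_right inner_axis)
      qed
      show ?thesis by (simp only: pw)
    qed
    finally show "(\<Sum>j\<in>UNIV. orient T K S * (LINT x|ds T S. (fnormal T S \<bullet> axis j 1) * (v x \<bullet> column j (R x))))
      = orient T K S * (LINT x|ds T S. v x \<bullet> (R x *v fnormal T S))" .
  qed
  finally show ?thesis .
qed

lemma pw_linear_cell_inner:
  fixes u :: "real^'n \<Rightarrow> 'b::euclidean_space"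
  assumes "K \<in> cells T" "continuous_on UNIV u"
  shows "pw_linear (cells T) k (\<lambda>v. LINT x|lborel. indicator K x * (v K x \<bullet> u x))"
  by (rule pw_linear_integral[where F = "\<lambda>p x. indicator K x * (p x \<bullet> u x)", OF assms(1)])
     (rule integrable_on_cell[OF assms(1) continuous_on_inner[OF polys_continuous assms(2)]],
      simp_all add: inner_add_left distrib_left)

lemma pw_linear_int_inner:
  fixes w :: "('n, 'b::euclidean_space) pw"
  assumes w: "w \<in> pw_polys (cells T) l"
  shows "pw_linear (cells T) k (\<lambda>v. int_inner T v w)"
  by (rule pw_linear_cong[OF int_inner_polys[OF _ w]])
     (use w in \<open>auto intro!: pw_linear_sum pw_linear_cell_inner polys_continuous simp: pw_polys_def\<close>)

lemma int_inner_combination: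
  fixes u v w :: "('n, 'b::euclidean_space) pw"
  assumes u: "u \<in> pw_polys (cells T) k" and v: "v \<in> pw_polys (cells T) k" and w: "w \<in> pw_polys (cells T) l"
  shows "int_inner T (\<lambda>K\<in>cells T. \<lambda>x. u K x + v K x) w = int_inner T u w + int_inner T v w"
    and "int_inner T (\<lambda>K\<in>cells T. \<lambda>x. u K x - v K x) w = int_inner T u w - int_inner T v w"
proof -
  note lin = pw_linear_int_inner[OF w, of k]
  have restr: "int_inner T (restrict z (cells T)) w = int_inner T z w" if "z \<in> pw_polys (cells T) k" for z
    by (rule pw_linearD(3)[OF lin cell_polys_pw[OF restrict_cell_polys[OF that]] that]) simp
  show "int_inner T (\<lambda>K\<in>cells T. \<lambda>x. u K x + v K x) w = int_inner T u w + int_inner T v w"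
    unfolding restr[OF pw_polys_add[OF u v]] by (rule pw_linearD(1)[OF lin u v])
  have "int_inner T (\<lambda>K x. u K x - v K x) w = int_inner T (\<lambda>K x. u K x + (- 1) *\<^sub>R v K x) w" by simp
  also have "\<dots> = int_inner T u w + (- 1) * int_inner T v w"
    unfolding pw_linearD(1)[OF lin u pw_polys_scale[OF v]] pw_linearD(2)[OF lin v] ..
  finally show "int_inner T (\<lambda>K\<in>cells T. \<lambda>x. u K x - v K x) w = int_inner T u w - int_inner T v w"
    unfolding restr[OF pw_polys_diff[OF u v]] by simp
qed

lemma int_inner_definite:
  fixes w :: "('n, 'b::euclidean_space) pw"
  assumes w: "w \<in> pw_polys (cells T) k" and z: "int_inner T w w = 0" and K: "K \<in> cells T"
  shows "w K x = 0"
proof -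
  have "\<forall>K\<in>cells T. (LINT x|lborel. indicator K x * (w K x \<bullet> w K x)) = 0"
    using z unfolding int_inner_polys[OF w w]
    by (subst (asm) sum_nonneg_eq_0_iff) (auto intro!: Bochner_Integration.integral_nonneg)
  then show ?thesis using poly_zero_on_cell[OF pw_polysD[OF w K] K] K by blast
qed

lemma cell_polys_eqI:
  fixes w w' :: "('n, 'b::euclidean_space) pw"
  assumes w: "w \<in> cell_polys T k" "w' \<in> cell_polys T k"
    and eq: "int_inner T w (\<lambda>K\<in>cells T. \<lambda>x. w K x - w' K x) = int_inner T w' (\<lambda>K\<in>cells T. \<lambda>x. w K x - w' K x)"
  shows "w = w'"
proof -
  let ?d = "\<lambda>K\<in>cells T. \<lambda>x. w K x - w' K x"
  note w' = cell_polys_pw[OF w(1)] cell_polys_pw[OF w(2)]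
  have d: "?d \<in> pw_polys (cells T) k" by (intro cell_polys_pw restrict_cell_polys pw_polys_diff w')
  have "int_inner T ?d ?d = 0" using eq int_inner_combination(2)[OF w' d] by simp
  then have "?d K x = 0" if "K \<in> cells T" for K x using int_inner_definite[OF d _ that] by blast
  then have "w K = w' K" if "K \<in> cells T" for K using that by (auto simp: fun_eq_iff)
  then show ?thesis using w unfolding cell_polys_def by (intro PiE_ext[of w _ _ w']) auto
qed

lemma pw_linear_cell_jacobian:
  fixes u :: "real^'n \<Rightarrow> real^'n^'m"
  assumes "K \<in> cells T" "continuous_on UNIV u"
  shows "pw_linear (cells T) k (\<lambda>v :: ('n, real^'m) pw.
    LINT x|lborel. indicator K x * (jacobian (v K) (at x) \<bullet> u x))"
  by (rule pw_linear_integral[where F = "\<lambda>p x. indicator K x * (jacobian p (at x) \<bullet> u x)", OF assms(1)])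
     (auto intro!: integrable_on_cell assms continuous_on_inner jacobian_continuous
       simp: inner_add_left distrib_left jacobian_add jacobian_scaleR)

lemma pw_linear_cell_divergence:
  fixes u :: "real^'n \<Rightarrow> real^'m"
  assumes "K \<in> cells T" "continuous_on UNIV u"
  shows "pw_linear (cells T) k (\<lambda>v :: ('n, real^'n^'m) pw.
    LINT x|lborel. indicator K x * (u x \<bullet> divergence (v K) x))"
  by (rule pw_linear_integral[where F = "\<lambda>p x. indicator K x * (u x \<bullet> divergence p x)", OF assms(1)])
     (auto intro!: integrable_on_cell assms continuous_on_inner divergence_continuous
       simp: inner_add_right distrib_left divergence_add divergence_scaleR)

lemma pw_linear_face_inner:
  fixes u :: "real^'n \<Rightarrow> 'b::euclidean_space"
  assumes "K \<in> A" "S \<in> faces T" "continuous_on S u"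
  shows "pw_linear A k (\<lambda>v. LINT x|ds T S. v K x \<bullet> u x)"
  by (rule pw_linear_integral[where F = "\<lambda>p x. p x \<bullet> u x", OF assms(1)])
     (rule integrable_on_face[OF assms(2) continuous_on_inner[OF polys_continuous assms(3)]],
      simp_all add: inner_add_left)

lemma pw_linear_face_normal:
  fixes u :: "real^'n \<Rightarrow> real^'m"
  assumes "K \<in> cells T" "S \<in> faces T" "continuous_on S u"
  shows "pw_linear (cells T) k (\<lambda>v :: ('n, real^'n^'m) pw.
    LINT x|ds T S. (v K x *v e) \<bullet> u x)"
  by (rule pw_linear_integral[where F = "\<lambda>p x. (p x *v e) \<bullet> u x", OF assms(1)])
     (rule integrable_on_face[OF assms(2) continuous_on_inner[OF continuous_on_matrix_vector[OF polys_continuous] assms(3)]],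
      simp_all add: inner_add_left matrix_vector_mult_add_rdistrib scaleR_matrix_vector_assoc[symmetric])

text \<open>On piecewise polynomials the \<open>L\<^sup>2\<close> inner product is definite because cells have positive volume.\<close>

lemma cell_riesz:
  fixes l :: "(('n, 'b::euclidean_space) pw) \<Rightarrow> real"
  assumes l: "pw_linear (cells T) k l"
  shows "\<exists>!w. w \<in> cell_polys T k \<and> (\<forall>\<phi>\<in>cell_polys T k. int_inner T w \<phi> = l \<phi>)"
proof -
  have pos: "0 \<le> int_inner T w w" for w :: "('n, 'b) pw"
    unfolding int_inner_def by simp
  have compat: "l w = 0" if w: "w \<in> pw_polys (cells T) k" and z: "int_inner T w w = 0" for w
    by (rule pw_linear_zero[OF l w int_inner_definite[OF w z]])
  obtain w where w: "w \<in> pw_polys (cells T) k" and eq: "\<And>\<phi>. \<phi> \<in> pw_polys (cells T) k \<Longrightarrow> int_inner T w \<phi> = l \<phi>"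
    using riesz_pw_polys[OF finite_cells int_inner_commute pw_linear_int_inner[where l = k] pos l compat] by blast
  let ?w = "restrict w (cells T)"
  have wr: "?w \<in> cell_polys T k" using w by (rule restrict_cell_polys)
  have "int_inner T ?w \<phi> = int_inner T w \<phi>" if "\<phi> \<in> pw_polys (cells T) k" for \<phi>
    unfolding int_inner_polys[OF w that] int_inner_polys[OF cell_polys_pw[OF wr] that] by (intro sum.cong) auto
  then have sol: "int_inner T ?w \<phi> = l \<phi>" if "\<phi> \<in> cell_polys T k" for \<phi>
    using eq cell_polys_pw[OF that] by simp
  show ?thesis
  proof (rule ex1I[of _ ?w])
    fix v assume v: "v \<in> cell_polys T k \<and> (\<forall>\<phi>\<in>cell_polys T k. int_inner T v \<phi> = l \<phi>)"
    have d: "(\<lambda>K\<in>cells T. \<lambda>x. v K x - ?w K x) \<in> cell_polys T k"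
      using v by (intro restrict_cell_polys[OF pw_polys_diff[OF cell_polys_pw cell_polys_pw[OF wr]]]) simp
    show "v = ?w"
      by (rule cell_polys_eqI[OF _ wr]) (use v sol[OF d] d in auto)
  qed (use wr sol in auto)
qed

lemma cell_proj_cell_polys:
  fixes v :: "('n, 'b::euclidean_space) pw"
  assumes v: "v \<in> cell_polys T l"
  shows "cell_proj T (cell_polys T k) v \<in> cell_polys T k"
    and "\<phi> \<in> cell_polys T k \<Longrightarrow> int_inner T (cell_proj T (cell_polys T k) v) \<phi> = int_inner T v \<phi>"
proof -
  have "pw_linear (cells T) k (\<lambda>\<phi>. int_inner T v \<phi>)"
    using pw_linear_int_inner[OF cell_polys_pw[OF v]] by (simp add: int_inner_commute)
  from theI'[OF cell_riesz[OF this]]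
  show "cell_proj T (cell_polys T k) v \<in> cell_polys T k"
    and "\<phi> \<in> cell_polys T k \<Longrightarrow> int_inner T (cell_proj T (cell_polys T k) v) \<phi> = int_inner T v \<phi>"
    unfolding cell_proj_def by blast+
qed

lemma grad_functional_eq:
  fixes vM :: "('n, real^'m) pw" and \<tau> :: "('n, real^'n^'m) pw"
  assumes vM: "vM \<in> cell_polys T l" and vS: "\<And>S. S \<in> faces T \<Longrightarrow> continuous_on S (vS S)"
    and \<tau>: "\<tau> \<in> pw_polys (cells T) k"
  shows "- int_inner T vM (div_pw T \<tau>)
        + (\<Sum>S\<in>faces T. LINT x|ds T S. vS S x \<bullet> jump T (\<lambda>K x. \<tau> K x *v fnormal T S) S x)
    = (\<Sum>K\<in>cells T. (\<Sum>S\<in>faces_of_cell T K. orient T K S * (LINT x|ds T S. (\<tau> K x *v fnormal T S) \<bullet> vS S x))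
        - (LINT x|lborel. indicator K x * (vM K x \<bullet> divergence (\<tau> K) x)))"
proof -
  have c: "continuous_on A (vM K)" "continuous_on A (\<tau> K)" "continuous_on A (divergence (\<tau> K))" if "K \<in> cells T" for K A
    using cell_polysD[OF vM that] pw_polysD[OF \<tau> that] by (auto intro: polys_continuous divergence_continuous)
  have dv: "div_pw T \<tau> K = divergence (\<tau> K)" if "K \<in> cells T" for K
    using that by (simp add: div_pw_def divergence_def fun_eq_iff)
  have "int_inner T vM (div_pw T \<tau>) = (\<Sum>K\<in>cells T. LINT x|lborel. indicator K x * (vM K x \<bullet> divergence (\<tau> K) x))"
    by (subst int_inner_eq(1)) (simp_all add: dv c)
  moreover have "(\<Sum>S\<in>faces T. LINT x|ds T S. vS S x \<bullet> jump T (\<lambda>K x. \<tau> K x *v fnormal T S) S x)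
    = (\<Sum>S\<in>faces T. \<Sum>K\<in>{K \<in> cells T. S \<subseteq> K}. orient T K S * (LINT x|ds T S. (\<tau> K x *v fnormal T S) \<bullet> vS S x))"
    by (intro sum.cong refl) (subst inner_commute, intro jump_integral vS continuous_on_matrix_vector c)
  ultimately show ?thesis by (simp add: sum_faces_cells sum_subtractf)
qed

lemma grad_h_properties:
  fixes v :: "('n, real^'m) pw \<times> ('n, real^'m) pw"
  assumes vM: "fst v \<in> cell_polys T l" and vS0: "\<forall>S\<in>faces T. continuous_on S (snd v S)"
  shows "grad_h T k v \<in> cell_polys T k"
    and "\<tau> \<in> cell_polys T k \<Longrightarrow> int_inner T (grad_h T k v) \<tau> =
      (\<Sum>K\<in>cells T. (\<Sum>S\<in>faces_of_cell T K. orient T K S * (LINT x|ds T S. (\<tau> K x *v fnormal T S) \<bullet> snd v S x))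
        - (LINT x|lborel. indicator K x * (fst v K x \<bullet> divergence (\<tau> K) x)))"
proof -
  note vS = bspec[OF vS0]
  let ?l = "\<lambda>\<tau>. - int_inner T (fst v) (div_pw T \<tau>)
        + (\<Sum>S\<in>faces T. LINT x|ds T S. snd v S x \<bullet> jump T (\<lambda>K x. \<tau> K x *v fnormal T S) S x)"
  have "pw_linear (cells T) k ?l"
    by (rule pw_linear_cong[OF grad_functional_eq[OF vM vS]])
       (auto intro!: pw_linear_sum pw_linear_diff pw_linear_cmult pw_linear_face_normal pw_linear_cell_divergence
          polys_continuous cell_polysD[OF vM] vS simp: faces_of_cell_def)
  from theI'[OF cell_riesz[OF this]]
  have *: "grad_h T k v \<in> cell_polys T k \<and> (\<forall>\<tau>\<in>cell_polys T k. int_inner T (grad_h T k v) \<tau> = ?l \<tau>)"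
    unfolding grad_h_def .
  then show "grad_h T k v \<in> cell_polys T k" ..
  assume t: "\<tau> \<in> cell_polys T k"
  from * t have "int_inner T (grad_h T k v) \<tau> = ?l \<tau>" by blast
  also note grad_functional_eq[OF vM vS cell_polys_pw[OF t]]
  finally show "int_inner T (grad_h T k v) \<tau> =
      (\<Sum>K\<in>cells T. (\<Sum>S\<in>faces_of_cell T K. orient T K S * (LINT x|ds T S. (\<tau> K x *v fnormal T S) \<bullet> snd v S x))
        - (LINT x|lborel. indicator K x * (fst v K x \<bullet> divergence (\<tau> K) x)))" .
qed

end

section \<open>Discrete divergence, stress reconstruction and face projections\<close>

context admissible
begin

lemma grad_pw_cell: "K \<in> cells T \<Longrightarrow> grad_pw T v K = (\<lambda>x. jacobian (v K) (at x))"
  by (simp add: grad_pw_def)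

lemma grad_pw_polys: "v \<in> pw_polys (cells T) (k + 1) \<Longrightarrow> grad_pw T v \<in> cell_polys T k"
  unfolding grad_pw_def cell_polys_def using polys_jacobian by (auto simp: pw_polys_def)

lemma div_functional_eq:
  fixes \<phi> :: "('n, real^'m) pw" and \<tau>M :: "('n, real^'n^'m) pw"
  assumes \<tau>M: "\<tau>M \<in> cell_polys T l" and \<tau>S: "\<And>S. S \<in> faces T \<Longrightarrow> continuous_on S (\<tau>S S)"
    and \<phi>: "\<phi> \<in> pw_polys (cells T) k"
  shows "- int_inner T (grad_pw T \<phi>) \<tau>M + (\<Sum>S\<in>faces T. LINT x|ds T S. jump T \<phi> S x \<bullet> \<tau>S S x)
    = (\<Sum>K\<in>cells T. (\<Sum>S\<in>faces_of_cell T K. orient T K S * (LINT x|ds T S. \<phi> K x \<bullet> \<tau>S S x))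
        - (LINT x|lborel. indicator K x * (jacobian (\<phi> K) (at x) \<bullet> \<tau>M K x)))"
proof -
  have c: "continuous_on A (\<tau>M K)" "continuous_on A (\<phi> K)" "continuous_on A (\<lambda>x. jacobian (\<phi> K) (at x))" if "K \<in> cells T" for K A
    using cell_polysD[OF \<tau>M that] pw_polysD[OF \<phi> that] by (auto intro: polys_continuous jacobian_continuous)
  have "int_inner T (grad_pw T \<phi>) \<tau>M = (\<Sum>K\<in>cells T. LINT x|lborel. indicator K x * (jacobian (\<phi> K) (at x) \<bullet> \<tau>M K x))"
    by (subst int_inner_eq(1)) (simp_all add: grad_pw_cell c)
  moreover have "(\<Sum>S\<in>faces T. LINT x|ds T S. jump T \<phi> S x \<bullet> \<tau>S S x)
    = (\<Sum>K\<in>cells T. \<Sum>S\<in>faces_of_cell T K. orient T K S * (LINT x|ds T S. \<phi> K x \<bullet> \<tau>S S x))"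
    by (intro jump_integral_sum c \<tau>S)
  ultimately show ?thesis by (simp add: sum_subtractf)
qed

lemma div_h_properties:
  fixes \<tau> :: "('n, real^'n^'m) pw \<times> ('n, real^'m) pw"
  assumes \<tau>M: "fst \<tau> \<in> cell_polys T l" and \<tau>S0: "\<forall>S\<in>faces T. continuous_on S (snd \<tau> S)"
  shows "div_h T k \<tau> \<in> cell_polys T k"
    and "\<phi> \<in> cell_polys T k \<Longrightarrow> int_inner T (div_h T k \<tau>) \<phi> =
      - int_inner T (grad_pw T \<phi>) (fst \<tau>) + (\<Sum>S\<in>faces T. LINT x|ds T S. jump T \<phi> S x \<bullet> snd \<tau> S x)"
proof -
  note \<tau>S = bspec[OF \<tau>S0]
  let ?l = "\<lambda>\<phi>. - int_inner T (grad_pw T \<phi>) (fst \<tau>) + (\<Sum>S\<in>faces T. LINT x|ds T S. jump T \<phi> S x \<bullet> snd \<tau> S x)"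
  have "pw_linear (cells T) k ?l"
    by (rule pw_linear_cong[OF div_functional_eq[OF \<tau>M \<tau>S]])
       (auto intro!: pw_linear_sum pw_linear_diff pw_linear_cmult pw_linear_face_inner pw_linear_cell_jacobian
          polys_continuous cell_polysD[OF \<tau>M] \<tau>S simp: faces_of_cell_def)
  from theI'[OF cell_riesz[OF this]]
  have *: "div_h T k \<tau> \<in> cell_polys T k \<and> (\<forall>\<phi>\<in>cell_polys T k. int_inner T (div_h T k \<tau>) \<phi> = ?l \<phi>)"
    unfolding div_h_def .
  then show "div_h T k \<tau> \<in> cell_polys T k"
    and "\<phi> \<in> cell_polys T k \<Longrightarrow> int_inner T (div_h T k \<tau>) \<phi> = ?l \<phi>" by blast+
qed

text \<open>The kernel of the piecewise gradient consists of the piecewise constant functions, so a functional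
that vanishes on them is represented by a gradient.\<close>

lemma gradient_riesz:
  fixes l :: "('n, real^'m) pw \<Rightarrow> real"
  assumes l: "pw_linear (cells T) (k + 1) l"
    and const: "\<And>w. w \<in> cell_polys T 0 \<Longrightarrow> (\<And>K x. K \<in> cells T \<Longrightarrow> jacobian (w K) (at x) = 0) \<Longrightarrow> l w = 0"
  obtains u where "u \<in> cell_polys T (k + 1)"
    and "\<And>v. v \<in> pw_polys (cells T) (k + 1) \<Longrightarrow> int_inner T (grad_pw T u) (grad_pw T v) = l v"
proof -
  let ?X = "pw_polys (cells T) (k + 1) :: ('n, real^'m) pw set"
  let ?b = "\<lambda>v w. int_inner T (grad_pw T v) (grad_pw T w)"
  have b_eq: "?b v w = (\<Sum>K\<in>cells T. LINT x|lborel. indicator K x * (jacobian (v K) (at x) \<bullet> jacobian (w K) (at x)))"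
    if "v \<in> ?X" "w \<in> ?X" for v w
    using int_inner_polys[OF cell_polys_pw[OF grad_pw_polys[OF that(1)]] cell_polys_pw[OF grad_pw_polys[OF that(2)]]]
    by (simp add: grad_pw_cell)
  have lin: "pw_linear (cells T) (k + 1) (\<lambda>v. ?b v w)" if "w \<in> ?X" for w
    by (rule pw_linear_cong[OF b_eq[OF _ that]])
       (use that in \<open>auto intro!: pw_linear_sum pw_linear_cell_jacobian jacobian_continuous simp: pw_polys_def\<close>)
  have pos: "0 \<le> ?b w w" for w unfolding int_inner_def by simp
  have compat: "l w = 0" if w: "w \<in> ?X" and z: "?b w w = 0" for w
  proof -
    have J: "jacobian (w K) (at x) = 0" if "K \<in> cells T" for K x
      using int_inner_definite[OF cell_polys_pw[OF grad_pw_polys[OF w]] z that] that by (simp add: grad_pw_cell)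
    let ?w = "restrict w (cells T)"
    have wr: "?w \<in> cell_polys T (k + 1)" using w by (rule restrict_cell_polys)
    \<comment> \<open>a function with zero piecewise gradient is piecewise constant\<close>
    have "?w \<in> cell_polys T 0"
    proof -
      have "w K \<in> polys 0" if K: "K \<in> cells T" for K
      proof -
        obtain c where "w K = (\<lambda>x. c)" using polys_jacobian_zero[OF pw_polysD[OF w K] J[OF K]] by blast
        then show ?thesis by (simp add: polys_const)
      qed
      then show ?thesis by (intro restrict_cell_polys) (simp add: pw_polys_def)
    qed
    then have "l ?w = 0" by (rule const) (simp add: J)
    moreover have "l ?w = l w" by (rule pw_linearD(3)[OF l cell_polys_pw[OF wr] w]) simp
    ultimately show ?thesis by simp
  qed
  obtain u where u: "u \<in> ?X" "\<And>v. v \<in> ?X \<Longrightarrow> ?b u v = l v"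
    using riesz_pw_polys[OF finite_cells int_inner_commute lin pos l compat] by blast
  have ur: "restrict u (cells T) \<in> cell_polys T (k + 1)" using u(1) by (rule restrict_cell_polys)
  have "grad_pw T (restrict u (cells T)) = grad_pw T u" by (auto simp: grad_pw_def)
  then show ?thesis using that[OF ur] u(2) by simp
qed

lemma Z_space_diffI:
  fixes R R' :: "('n, real^'n^'m) pw"
  assumes R: "R \<in> cell_polys T k" "R' \<in> cell_polys T k"
    and eq: "\<And>v. v \<in> cell_polys T (k + 1) \<Longrightarrow> int_inner T R (grad_pw T v) = int_inner T R' (grad_pw T v)"
  shows "(\<lambda>K\<in>cells T. \<lambda>x. R K x - R' K x) \<in> Z_space T k"
  unfolding Z_space_def
proof (intro CollectI conjI ballI)
  let ?d = "\<lambda>K\<in>cells T. \<lambda>x. R K x - R' K x"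
  show d: "?d \<in> cell_polys T k"
    by (intro restrict_cell_polys[OF pw_polys_diff] cell_polys_pw R)
  fix v :: "('n, real^'m) pw" assume v: "v \<in> cell_polys T (k + 1)"
  have g: "grad_pw T v \<in> cell_polys T k" by (intro grad_pw_polys cell_polys_pw v)
  show "int_inner T ?d (grad_pw T v) = 0"
    using int_inner_combination(2)[OF cell_polys_pw[OF R(1)] cell_polys_pw[OF R(2)] cell_polys_pw[OF g]] eq[OF v] by simp
qed

text \<open>Subtracting from \<open>R\<close> its projection onto the piecewise gradients leaves a function in \<open>Z_space\<close>.\<close>

lemma Z_projection:
  fixes R :: "('n, real^'n^'m) pw"
  assumes R: "R \<in> cell_polys T k"
  shows "cell_proj T (Z_space T k) R \<in> Z_space T k"
    and "\<phi> \<in> Z_space T k \<Longrightarrow> int_inner T (cell_proj T (Z_space T k) R) \<phi> = int_inner T R \<phi>"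
proof -
  let ?l = "\<lambda>v. int_inner T R (grad_pw T v)"
  have R': "R \<in> pw_polys (cells T) k" using R by (rule cell_polys_pw)
  have l_eq: "?l v = (\<Sum>K\<in>cells T. LINT x|lborel. indicator K x * (jacobian (v K) (at x) \<bullet> R K x))"
    if "v \<in> pw_polys (cells T) (k + 1)" for v
    using int_inner_polys[OF R' cell_polys_pw[OF grad_pw_polys[OF that]]]
    by (simp add: grad_pw_cell inner_commute)
  have lin: "pw_linear (cells T) (k + 1) ?l"
    by (rule pw_linear_cong[OF l_eq])
       (auto intro!: pw_linear_sum pw_linear_cell_jacobian polys_continuous cell_polysD[OF R])
  have z: "?l w = 0" if "w \<in> cell_polys T 0" "\<And>K x. K \<in> cells T \<Longrightarrow> jacobian (w K) (at x) = 0" for w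
    using l_eq[OF cell_polys_pw[OF cell_polys_mono[OF that(1)]]] that(2) by simp
  obtain u where u: "u \<in> cell_polys T (k + 1)"
    and bu: "\<And>v. v \<in> pw_polys (cells T) (k + 1) \<Longrightarrow> int_inner T (grad_pw T u) (grad_pw T v) = ?l v"
    using gradient_riesz[OF lin z] by blast
  have gu: "grad_pw T u \<in> cell_polys T k" by (intro grad_pw_polys cell_polys_pw u)
  define \<zeta> where "\<zeta> = (\<lambda>K\<in>cells T. \<lambda>x. R K x - grad_pw T u K x)"
  have \<zeta>: "\<zeta> \<in> cell_polys T k"
    unfolding \<zeta>_def by (intro restrict_cell_polys[OF pw_polys_diff] R' cell_polys_pw gu)
  have inner_\<zeta>: "int_inner T \<zeta> \<phi> = int_inner T R \<phi> - int_inner T (grad_pw T u) \<phi>" if "\<phi> \<in> cell_polys T k" for \<phi>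
    unfolding \<zeta>_def by (rule int_inner_combination(2)[OF R' cell_polys_pw[OF gu] cell_polys_pw[OF that]])
  have \<zeta>Z: "\<zeta> \<in> Z_space T k"
    unfolding Z_space_def
  proof (intro CollectI conjI ballI \<zeta>)
    fix v :: "('n, real^'m) pw" assume "v \<in> cell_polys T (k + 1)"
    then have v: "v \<in> pw_polys (cells T) (k + 1)" by (rule cell_polys_pw)
    show "int_inner T \<zeta> (grad_pw T v) = 0"
      unfolding inner_\<zeta>[OF grad_pw_polys[OF v]] bu[OF v] by simp
  qed
  have sol: "int_inner T \<zeta> \<phi> = int_inner T R \<phi>" if "\<phi> \<in> Z_space T k" for \<phi>
  proof -
    have "\<phi> \<in> cell_polys T k" "int_inner T \<phi> (grad_pw T u) = 0" using that u by (auto simp: Z_space_def)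
    then show ?thesis using inner_\<zeta>[of \<phi>] by (simp add: int_inner_commute)
  qed
  have "\<exists>!w. w \<in> Z_space T k \<and> (\<forall>\<phi>\<in>Z_space T k. int_inner T w \<phi> = int_inner T R \<phi>)"
  proof (rule ex1I[of _ \<zeta>])
    fix w assume w: "w \<in> Z_space T k \<and> (\<forall>\<phi>\<in>Z_space T k. int_inner T w \<phi> = int_inner T R \<phi>)"
    then have w': "w \<in> cell_polys T k" by (simp add: Z_space_def)
    have "(\<lambda>K\<in>cells T. \<lambda>x. w K x - \<zeta> K x) \<in> Z_space T k"
      using w \<zeta>Z by (intro Z_space_diffI) (auto simp: Z_space_def)
    then show "w = \<zeta>" using w sol by (intro cell_polys_eqI[OF w' \<zeta>]) auto
  qed (use \<zeta>Z sol in auto)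
  from theI'[OF this]
  show "cell_proj T (Z_space T k) R \<in> Z_space T k"
    and "\<phi> \<in> Z_space T k \<Longrightarrow> int_inner T (cell_proj T (Z_space T k) R) \<phi> = int_inner T R \<phi>"
    unfolding cell_proj_def by blast+
qed

text \<open>The reconstruction is the cell part of \<open>\<tau>\<close> plus a piecewise gradient. The correction is orthogonal to
\<open>Z_space\<close>, as demanded by the second defining condition. It exists because the right-hand side of the
first condition agrees with the cell part on piecewise constants, which are admissible test
functions for the discrete divergence. Two solutions differ by an element of \<open>Z_space\<close> whose
projection is zero.\<close>

lemma stress_rec_properties:
  fixes \<tau> :: "('n, real^'n^'m) pw \<times> ('n, real^'m) pw"
  assumes \<tau>M: "fst \<tau> \<in> cell_polys T k" and \<tau>S0: "\<forall>S\<in>faces T. continuous_on S (snd \<tau> S)"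
  shows "stress_rec T k \<tau> \<in> cell_polys T k"
    and "v \<in> cell_polys T (k + 1) \<Longrightarrow> int_inner T (stress_rec T k \<tau>) (grad_pw T v) =
      - int_inner T v (div_h T k \<tau>) +
      (\<Sum>K\<in>cells T. \<Sum>S\<in>faces_of_cell T K. orient T K S * (LINT x|ds T S. v K x \<bullet> snd \<tau> S x))"
proof -
  note \<tau>S = bspec[OF \<tau>S0]
  let ?X = "pw_polys (cells T) (k + 1) :: ('n, real^'m) pw set"
  let ?F = "\<lambda>v. - int_inner T v (div_h T k \<tau>) + (\<Sum>S\<in>faces T. LINT x|ds T S. jump T v S x \<bullet> snd \<tau> S x)"
  let ?l = "\<lambda>v. ?F v - int_inner T (grad_pw T v) (fst \<tau>)"
  note d = div_h_properties[where k = k, OF \<tau>M \<tau>S0]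
  have \<tau>M': "fst \<tau> \<in> pw_polys (cells T) k" using \<tau>M by (rule cell_polys_pw)
  have jump_eq: "(\<Sum>S\<in>faces T. LINT x|ds T S. jump T v S x \<bullet> snd \<tau> S x)
      = (\<Sum>K\<in>cells T. \<Sum>S\<in>faces_of_cell T K. orient T K S * (LINT x|ds T S. v K x \<bullet> snd \<tau> S x))"
    if "v \<in> ?X" for v
    by (intro jump_integral_sum \<tau>S polys_continuous[OF pw_polysD[OF that]])
  have l_eq: "?l v = (\<Sum>K\<in>cells T. (\<Sum>S\<in>faces_of_cell T K. orient T K S * (LINT x|ds T S. v K x \<bullet> snd \<tau> S x))
      - (LINT x|lborel. indicator K x * (v K x \<bullet> div_h T k \<tau> K x))
      - (LINT x|lborel. indicator K x * (jacobian (v K) (at x) \<bullet> fst \<tau> K x)))" if v: "v \<in> ?X" for v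
    using int_inner_polys[OF v cell_polys_pw[OF d(1)]]
      int_inner_polys[OF cell_polys_pw[OF grad_pw_polys[OF v]] \<tau>M']
    by (simp add: jump_eq[OF v] sum_subtractf grad_pw_cell)
  have lin: "pw_linear (cells T) (k + 1) ?l"
    by (rule pw_linear_cong[OF l_eq])
       (auto intro!: pw_linear_sum pw_linear_diff pw_linear_cmult pw_linear_face_inner pw_linear_cell_jacobian
         pw_linear_cell_inner polys_continuous cell_polysD[OF \<tau>M] cell_polysD[OF d(1)] \<tau>S simp: faces_of_cell_def)
  have const: "?l w = 0" if w: "w \<in> cell_polys T 0" for w
  proof -
    have "w \<in> cell_polys T k" using w by (rule cell_polys_mono) simp
    from d(2)[OF this] show ?thesis by (simp add: int_inner_commute)
  qed
  obtain u where u: "u \<in> cell_polys T (k + 1)"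
    and bu: "\<And>v. v \<in> ?X \<Longrightarrow> int_inner T (grad_pw T u) (grad_pw T v) = ?l v"
    using gradient_riesz[OF lin const] by blast
  have gu: "grad_pw T u \<in> cell_polys T k" by (intro grad_pw_polys cell_polys_pw u)
  define R where "R = (\<lambda>K\<in>cells T. \<lambda>x. fst \<tau> K x + grad_pw T u K x)"
  have R: "R \<in> cell_polys T k"
    unfolding R_def by (intro restrict_cell_polys[OF pw_polys_add] \<tau>M' cell_polys_pw gu)
  have inner_R: "int_inner T R \<phi> = int_inner T (fst \<tau>) \<phi> + int_inner T (grad_pw T u) \<phi>" if "\<phi> \<in> cell_polys T k" for \<phi>
    unfolding R_def by (rule int_inner_combination(1)[OF \<tau>M' cell_polys_pw[OF gu] cell_polys_pw[OF that]])
  have sol: "int_inner T R (grad_pw T v) = ?F v" if "v \<in> cell_polys T (k + 1)" for v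
  proof -
    have v: "v \<in> ?X" using that by (rule cell_polys_pw)
    show ?thesis unfolding inner_R[OF grad_pw_polys[OF v]] bu[OF v] by (simp add: int_inner_commute)
  qed
  have "int_inner T R \<phi> = int_inner T (fst \<tau>) \<phi>" if "\<phi> \<in> Z_space T k" for \<phi>
  proof -
    have "\<phi> \<in> cell_polys T k" "int_inner T \<phi> (grad_pw T u) = 0" using that u by (auto simp: Z_space_def)
    then show ?thesis using inner_R[of \<phi>] by (simp add: int_inner_commute)
  qed
  then have projR: "cell_proj T (Z_space T k) R = cell_proj T (Z_space T k) (fst \<tau>)"
    unfolding cell_proj_def by (intro arg_cong[of _ _ The] ext) auto
  have "\<exists>!R. R \<in> cell_polys T k \<and> (\<forall>v\<in>cell_polys T (k + 1). int_inner T R (grad_pw T v) = ?F v) \<and>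
     cell_proj T (Z_space T k) R = cell_proj T (Z_space T k) (fst \<tau>)"
  proof (rule ex1I[of _ R])
    fix R' assume R': "R' \<in> cell_polys T k \<and> (\<forall>v\<in>cell_polys T (k + 1). int_inner T R' (grad_pw T v) = ?F v) \<and>
     cell_proj T (Z_space T k) R' = cell_proj T (Z_space T k) (fst \<tau>)"
    then have R'c: "R' \<in> cell_polys T k" by blast
    let ?d = "\<lambda>K\<in>cells T. \<lambda>x. R' K x - R K x"
    have dZ: "?d \<in> Z_space T k"
      using R' R sol by (intro Z_space_diffI) auto
    have "int_inner T R' ?d = int_inner T R ?d"
      using Z_projection(2)[OF R'c dZ] Z_projection(2)[OF R dZ] R' projR by simp
    then show "R' = R" by (rule cell_polys_eqI[OF R'c R])
  qed (use R sol projR in auto)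
  from theI'[OF this]
  have *: "stress_rec T k \<tau> \<in> cell_polys T k \<and>
    (\<forall>v\<in>cell_polys T (k + 1). int_inner T (stress_rec T k \<tau>) (grad_pw T v) = ?F v) \<and>
    cell_proj T (Z_space T k) (stress_rec T k \<tau>) = cell_proj T (Z_space T k) (fst \<tau>)"
    unfolding stress_rec_def .
  then show "stress_rec T k \<tau> \<in> cell_polys T k" by blast
  assume v: "v \<in> cell_polys T (k + 1)"
  then have "int_inner T (stress_rec T k \<tau>) (grad_pw T v) = ?F v" using * by blast
  then show "int_inner T (stress_rec T k \<tau>) (grad_pw T v) =
      - int_inner T v (div_h T k \<tau>) +
      (\<Sum>K\<in>cells T. \<Sum>S\<in>faces_of_cell T K. orient T K S * (LINT x|ds T S. v K x \<bullet> snd \<tau> S x))"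
    unfolding jump_eq[OF cell_polys_pw[OF v]] .
qed

lemma face_proj_properties:
  fixes f :: "real^'n \<Rightarrow> 'b::euclidean_space"
  assumes S: "S \<in> faces T" and f: "continuous_on S f"
  shows "face_proj T k S f \<in> polys_on S k"
    and "p \<in> polys k \<Longrightarrow> (LINT x|ds T S. face_proj T k S f x \<bullet> p x) = (LINT x|ds T S. f x \<bullet> p x)"
proof -
  let ?X = "pw_polys {()} k :: (unit \<Rightarrow> real^'n \<Rightarrow> 'b) set"
  let ?b = "\<lambda>v w. LINT x|ds T S. v () x \<bullet> w () x"
  have lin: "pw_linear {()} k (\<lambda>v. ?b v w)" if "w \<in> ?X" for w
    using that by (intro pw_linear_face_inner S polys_continuous[of _ k]) (auto simp: pw_polys_def)
  have compat: "(LINT x|ds T S. w () x \<bullet> f x) = 0" if "w \<in> ?X" "?b w w = 0" for w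
  proof -
    have "w () x = 0" if "x \<in> S" for x
      using poly_zero_on_face[OF pw_polysD[OF \<open>w \<in> ?X\<close>] S \<open>?b w w = 0\<close> that] by simp
    then have "(LINT x|ds T S. w () x \<bullet> f x) = (LINT x|ds T S. 0)"
      by (intro Bochner_Integration.integral_cong) auto
    then show ?thesis by simp
  qed
  have "\<exists>w. w \<in> ?X \<and> (\<forall>\<phi>\<in>?X. ?b w \<phi> = (LINT x|ds T S. \<phi> () x \<bullet> f x))"
  proof (rule riesz_pw_polys[of "{()}" ?b k "\<lambda>v. LINT x|ds T S. v () x \<bullet> f x"])
    show "pw_linear {()} k (\<lambda>v. LINT x|ds T S. v () x \<bullet> f x)"
      by (intro pw_linear_face_inner S f) simp
  qed (use lin compat in \<open>auto simp: inner_commute\<close>)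
  then obtain w where w: "w \<in> ?X" and bw: "\<And>\<phi>. \<phi> \<in> ?X \<Longrightarrow> ?b w \<phi> = (LINT x|ds T S. \<phi> () x \<bullet> f x)" by blast
  have wp: "w () \<in> polys k" using w by (simp add: pw_polys_def)
  have restr: "(LINT x|ds T S. restrict p S x \<bullet> q x) = (LINT x|ds T S. p x \<bullet> q x)"
    "(LINT x|ds T S. q x \<bullet> restrict p S x) = (LINT x|ds T S. q x \<bullet> p x)" for p q :: "real^'n \<Rightarrow> 'b"
    by (intro Bochner_Integration.integral_cong; simp)+
  have sol: "(LINT x|ds T S. w () x \<bullet> p x) = (LINT x|ds T S. f x \<bullet> p x)" if "p \<in> polys k" for p
    using bw[of "\<lambda>_. p"] that by (simp add: pw_polys_def inner_commute)
  have "\<exists>!w. w \<in> polys_on S k \<and> (\<forall>\<phi>\<in>polys_on S k. (LINT x|ds T S. w x \<bullet> \<phi> x) = (LINT x|ds T S. f x \<bullet> \<phi> x))"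
  proof (rule ex1I[of _ "restrict (w ()) S"])
    show "restrict (w ()) S \<in> polys_on S k \<and> (\<forall>\<phi>\<in>polys_on S k.
        (LINT x|ds T S. restrict (w ()) S x \<bullet> \<phi> x) = (LINT x|ds T S. f x \<bullet> \<phi> x))"
    proof (intro conjI ballI)
      show "restrict (w ()) S \<in> polys_on S k" using wp by (simp add: polys_on_def)
      fix \<phi> :: "real^'n \<Rightarrow> 'b" assume "\<phi> \<in> polys_on S k"
      then obtain q where q: "q \<in> polys k" "\<phi> = restrict q S" by (auto simp: polys_on_def)
      show "(LINT x|ds T S. restrict (w ()) S x \<bullet> \<phi> x) = (LINT x|ds T S. f x \<bullet> \<phi> x)"
        unfolding q(2) restr by (rule sol[OF q(1)])
    qed
  next
    fix v assume v: "v \<in> polys_on S k \<and> (\<forall>\<phi>\<in>polys_on S k. (LINT x|ds T S. v x \<bullet> \<phi> x) = (LINT x|ds T S. f x \<bullet> \<phi> x))"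
    then obtain p where p: "p \<in> polys k" "v = restrict p S" by (auto simp: polys_on_def)
    let ?d = "\<lambda>x. p x - w () x"
    have d: "?d \<in> polys k" by (intro polys_diff p wp)
    have "(LINT x|ds T S. p x \<bullet> ?d x) = (LINT x|ds T S. f x \<bullet> ?d x)"
    proof -
      have "restrict ?d S \<in> polys_on S k" using d by (simp add: polys_on_def)
      then have "(LINT x|ds T S. v x \<bullet> restrict ?d S x) = (LINT x|ds T S. f x \<bullet> restrict ?d S x)" using v by blast
      then show ?thesis unfolding p(2) restr .
    qed
    then have eq: "(LINT x|ds T S. p x \<bullet> ?d x) = (LINT x|ds T S. w () x \<bullet> ?d x)" using sol[OF d] by simp
    have "(LINT x|ds T S. ?d x \<bullet> ?d x) = (LINT x|ds T S. p x \<bullet> ?d x - w () x \<bullet> ?d x)"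
      by (simp add: inner_diff_left)
    also have "\<dots> = (LINT x|ds T S. p x \<bullet> ?d x) - (LINT x|ds T S. w () x \<bullet> ?d x)"
      by (intro Bochner_Integration.integral_diff integrable_on_face[OF S] continuous_on_inner
          polys_continuous[OF p(1)] polys_continuous[OF wp] polys_continuous[OF d])
    also have "\<dots> = 0" using eq by simp
    finally have "?d x = 0" if "x \<in> S" for x using poly_zero_on_face[OF d S _ that] by blast
    then show "v = restrict (w ()) S" unfolding p(2) by (intro restrict_ext) simp
  qed
  from theI'[OF this]
  have *: "face_proj T k S f \<in> polys_on S k \<and>
    (\<forall>\<phi>\<in>polys_on S k. (LINT x|ds T S. face_proj T k S f x \<bullet> \<phi> x) = (LINT x|ds T S. f x \<bullet> \<phi> x))"
    unfolding face_proj_def .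
  then show "face_proj T k S f \<in> polys_on S k" ..
  assume "p \<in> polys k"
  then have "restrict p S \<in> polys_on S k" by (simp add: polys_on_def)
  then show "(LINT x|ds T S. face_proj T k S f x \<bullet> p x) = (LINT x|ds T S. f x \<bullet> p x)"
    using bspec[OF conjunct2[OF *]] unfolding restr(2)[symmetric, of _ p] by blast
qed

end

section \<open>Discrete weak duality\<close>

lemma polys_on_continuous:
  fixes f :: "real^'n \<Rightarrow> 'b::euclidean_space"
  assumes "f \<in> polys_on S k"
  shows "continuous_on S f"
proof -
  obtain p where p: "p \<in> polys k" "f = restrict p S" using assms by (auto simp: polys_on_def)
  have "continuous_on S f = continuous_on S p" by (intro continuous_on_cong) (simp_all add: p(2))
  then show ?thesis using polys_continuous[OF p(1)] by simp
qed

text \<open>At zeros of \<open>g\<close> the exponent \<open>r - 2\<close> may be negative, but the product has norm \<open>norm (g x) powr (r - 1)\<close>.\<close>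

lemma continuous_on_norm_powr_scaleR:
  fixes g :: "'a::topological_space \<Rightarrow> 'b::real_normed_vector"
  assumes r: "r > 1" and g: "continuous_on S g"
  shows "continuous_on S (\<lambda>x. norm (g x) powr (r - 2) *\<^sub>R g x)"
proof -
  have "isCont (\<lambda>u :: 'b. norm u powr (r - 2) *\<^sub>R u) u" for u
  proof (cases "u = 0")
    case True
    have "continuous_on UNIV (\<lambda>u :: 'b. norm u powr (r - 1))"
      using r by (intro continuous_on_powr' continuous_intros) auto
    then have "isCont (\<lambda>u :: 'b. norm u powr (r - 1)) 0" by (simp add: continuous_on_eq_continuous_at)
    then have "((\<lambda>u :: 'b. norm u powr (r - 1)) \<longlongrightarrow> 0) (at 0)" by (simp add: isCont_def)
    moreover have "norm (norm u powr (r - 2) *\<^sub>R u) = norm u powr (r - 1)" for u :: 'b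
    proof (cases "u = 0")
      case False
      have "norm u powr (r - 2) * norm u powr 1 = norm u powr (r - 2 + 1)"
        by (rule powr_add[symmetric])
      moreover have "norm u powr 1 = norm u" by simp
      ultimately show ?thesis by (simp add: algebra_simps)
    qed simp
    ultimately have "((\<lambda>u :: 'b. norm u powr (r - 2) *\<^sub>R u) \<longlongrightarrow> 0) (at 0)"
      by (subst tendsto_norm_zero_iff[symmetric]) (simp only:)
    then show ?thesis using True by (simp add: isCont_def)
  next
    case False
    then show ?thesis unfolding isCont_def
      by (intro tendsto_scaleR tendsto_powr tendsto_norm tendsto_const tendsto_ident_at) simp
  qed
  then have "continuous_on UNIV (\<lambda>u :: 'b. norm u powr (r - 2) *\<^sub>R u)"
    by (simp add: continuous_at_imp_continuous_on)
  from continuous_on_compose2[OF this g] show ?thesis by simp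
qed

text \<open>Young's inequality for \<open>h powr (- s / r) * a\<close> and \<open>h powr (s / r) * b\<close>.\<close>

lemma weighted_young:
  fixes a b h r s :: real
  assumes "r > 1" "h > 0" "a \<ge> 0" "b \<ge> 0"
  shows "a * b \<le> h powr (- s) * a powr r / r + h powr (s / (r - 1)) * b powr (r / (r - 1)) / (r / (r - 1))"
proof -
  let ?q = "r / (r - 1)"
  have q: "?q > 1" "1 / r + 1 / ?q = 1" using assms(1) by (simp_all add: field_simps)
  have "h powr (- s / r) * h powr (s / r) = 1"
    using assms(2) by (simp flip: powr_add)
  then have "a * b = (h powr (- s / r) * a) * (h powr (s / r) * b)" by (simp add: mult_ac)
  also have "\<dots> \<le> (h powr (- s / r) * a) powr r / r + (h powr (s / r) * b) powr ?q / ?q"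
    using assms q by (intro Youngs_inequality) auto
  also have "(h powr (- s / r) * a) powr r = h powr (- s) * a powr r"
    using assms by (simp add: powr_mult powr_powr)
  also have "(h powr (s / r) * b) powr ?q = h powr (s / (r - 1)) * b powr ?q"
    using assms by (simp add: powr_mult powr_powr)
  finally show ?thesis .
qed

text \<open>The upper bound \<open>F\<close> forces both values at the point to be finite, which rules out indeterminate
differences in the conjugates.\<close>

lemma fenchel_young_pointwise:
  fixes \<Psi> :: "'a::real_inner \<Rightarrow> ereal" and \<phi> :: "'b::real_inner \<Rightarrow> ereal"
  assumes "\<Psi> a \<noteq> -\<infinity>" "\<phi> b \<noteq> -\<infinity>"
    and F: "\<Psi> a + \<phi> b \<le> ereal F" and G: "conjugate \<Psi> A + conjugate \<phi> B \<le> ereal G"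
  shows "a \<bullet> A + b \<bullet> B \<le> F + G"
proof -
  obtain \<alpha> \<beta> where \<alpha>: "\<Psi> a = ereal \<alpha>" and \<beta>: "\<phi> b = ereal \<beta>"
    using assms(1,2) F by (cases "\<Psi> a"; cases "\<phi> b") auto
  have "ereal (a \<bullet> A - \<alpha>) \<le> conjugate \<Psi> A"
    unfolding conjugate_def by (rule SUP_upper2[of a]) (simp_all add: \<alpha>)
  moreover have "ereal (b \<bullet> B - \<beta>) \<le> conjugate \<phi> B"
    unfolding conjugate_def by (rule SUP_upper2[of b]) (simp_all add: \<beta>)
  ultimately have "ereal (a \<bullet> A - \<alpha>) + ereal (b \<bullet> B - \<beta>) \<le> conjugate \<Psi> A + conjugate \<phi> B"
    by (rule add_mono)
  with G have "ereal (a \<bullet> A - \<alpha>) + ereal (b \<bullet> B - \<beta>) \<le> ereal G" by (rule order_trans[rotated])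
  moreover have "\<alpha> + \<beta> \<le> F" using F by (simp add: \<alpha> \<beta>)
  ultimately show ?thesis by simp
qed

text \<open>The integral of an extended-real function is an infimum over integrable majorants, so an inequality
for all pairs of majorants passes to the integrals.\<close>

lemma ext_integral_duality:
  fixes f g :: "'a \<Rightarrow> ereal" and Q s t :: real
  assumes FG: "\<And>F G. integrable M F \<Longrightarrow> integrable M G \<Longrightarrow> AE x in M. f x \<le> ereal (F x) \<Longrightarrow>
      AE x in M. g x \<le> ereal (G x) \<Longrightarrow> Q \<le> (LINT x|M. F x) + (LINT x|M. G x)"
    and Q: "- Q \<le> s + t"
  shows "- ext_integral M g - ereal t \<le> ext_integral M f + ereal s"
proof -
  have g_ge: "ereal (Q - (LINT x|M. F x)) \<le> ext_integral M g" if "integrable M F" "AE x in M. f x \<le> ereal (F x)" for F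
    unfolding ext_integral_def using FG[OF that(1) _ that(2)] by (intro INF_greatest) (auto simp: algebra_simps)
  show ?thesis
  proof (cases "ext_integral M g")
    case (real e)
    have "ereal (Q - e) \<le> ext_integral M f"
      unfolding ext_integral_def using g_ge real by (intro INF_greatest) (auto simp: algebra_simps)
    then have "ereal (Q - e) + ereal s \<le> ext_integral M f + ereal s" by (rule add_right_mono)
    moreover have "- ext_integral M g - ereal t \<le> ereal (Q - e) + ereal s" using Q real by simp
    ultimately show ?thesis by (rule order_trans[rotated])
  next
    case MInf
    \<comment> \<open>every majorant of \<open>f\<close> would bound the integral of \<open>g\<close> from below by a real number\<close>
    have no_bound: "{F. integrable M F \<and> (AE x in M. f x \<le> ereal (F x))} = {}" using g_ge MInf by fastforce
    have "ext_integral M f = \<infinity>" unfolding ext_integral_def no_bound by (simp add: top_ereal_def)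
    then show ?thesis by simp
  qed simp
qed

context admissible
begin

text \<open>The four face integrals in the proof belong to the two definitions of reconstructions, to the
integration by parts, and to the product \<open>v\<^sub>S \<bullet> \<tau>\<^sub>S\<close>, whose signed sum is zero by the boundary
conditions.\<close>

lemma discrete_integration_by_parts:
  fixes v :: "('n, real^'m) pw \<times> ('n, real^'m) pw"
    and \<tau> :: "('n, real^'n^'m) pw \<times> ('n, real^'m) pw"
  assumes v: "v \<in> V_D T k" and \<tau>: "\<tau> \<in> W_N T k"
  shows "int_inner T (grad_h T k v) (stress_rec T k \<tau>)
      + int_inner T (cell_proj T (cell_polys T k) (fst v)) (div_h T k \<tau>)
    = - (\<Sum>K\<in>cells T. \<Sum>S\<in>faces_of_cell T K. orient T K S *
        (LINT x|ds T S. face_residual T k v K S x \<bullet> (snd \<tau> S x - stress_rec T k \<tau> K x *v fnormal T S)))"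
proof -
  let ?vM = "fst v" and ?vS = "snd v" and ?\<tau>S = "snd \<tau>" and ?R = "stress_rec T k \<tau>" and ?d = "div_h T k \<tau>"
  have vM: "?vM \<in> cell_polys T (k + 1)" and vS: "\<And>S. S \<in> faces T \<Longrightarrow> ?vS S \<in> polys_on S k"
    and vD: "\<And>S x. S \<in> dirichlet_faces T \<Longrightarrow> x \<in> S \<Longrightarrow> ?vS S x = 0"
    using v by (auto simp: V_D_def face_polys_def)
  have \<tau>M: "fst \<tau> \<in> cell_polys T k" and \<tau>S: "\<And>S. S \<in> faces T \<Longrightarrow> ?\<tau>S S \<in> polys_on S k"
    and \<tau>N: "\<And>S x. S \<in> neumann_faces T \<Longrightarrow> x \<in> S \<Longrightarrow> ?\<tau>S S x = 0"
    using \<tau> by (auto simp: W_N_def face_polys_def)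
  have vSc: "\<forall>S\<in>faces T. continuous_on S (?vS S)" and \<tau>Sc: "\<forall>S\<in>faces T. continuous_on S (?\<tau>S S)"
    using polys_on_continuous[OF vS] polys_on_continuous[OF \<tau>S] by blast+
  note G = grad_h_properties[where k = k, OF vM vSc] and R = stress_rec_properties[OF \<tau>M \<tau>Sc]
    and d = div_h_properties[where k = k, OF \<tau>M \<tau>Sc] and P = cell_proj_cell_polys[where k = k, OF vM]
  have vK: "?vM K \<in> polys (k + 1)" and RK: "?R K \<in> polys k" if "K \<in> cells T" for K
    using cell_polysD[OF vM that] cell_polysD[OF R(1) that] by simp_all
  let ?a = "\<lambda>K S. LINT x|ds T S. ?vM K x \<bullet> (?R K x *v fnormal T S)"
    and ?b = "\<lambda>K S. LINT x|ds T S. ?vM K x \<bullet> ?\<tau>S S x"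
    and ?c = "\<lambda>K S. LINT x|ds T S. (?R K x *v fnormal T S) \<bullet> ?vS S x"
    and ?e = "\<lambda>K S. LINT x|ds T S. ?vS S x \<bullet> ?\<tau>S S x"
  have gradR: "int_inner T ?R (grad_pw T ?vM) = (\<Sum>K\<in>cells T. LINT x|lborel. indicator K x * (jacobian (?vM K) (at x) \<bullet> ?R K x))"
    using int_inner_polys[OF cell_polys_pw[OF R(1)] cell_polys_pw[OF grad_pw_polys[OF cell_polys_pw[OF vM]]]]
    by (simp add: grad_pw_cell inner_commute)
  have "int_inner T (grad_h T k v) ?R
    = (\<Sum>K\<in>cells T. (\<Sum>S\<in>faces_of_cell T K. orient T K S * ?c K S) - (\<Sum>S\<in>faces_of_cell T K. orient T K S * ?a K S)
        + (LINT x|lborel. indicator K x * (jacobian (?vM K) (at x) \<bullet> ?R K x)))"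
    unfolding G(2)[OF R(1)]
    by (intro sum.cong refl) (simp add: cell_integration_by_parts[OF _ vK RK, symmetric])
  also have "\<dots> = (\<Sum>K\<in>cells T. \<Sum>S\<in>faces_of_cell T K. orient T K S * ?c K S)
      - (\<Sum>K\<in>cells T. \<Sum>S\<in>faces_of_cell T K. orient T K S * ?a K S) + int_inner T ?R (grad_pw T ?vM)"
    unfolding gradR by (simp add: sum.distrib sum_subtractf)
  also have "int_inner T ?R (grad_pw T ?vM) = - int_inner T ?vM ?d
      + (\<Sum>K\<in>cells T. \<Sum>S\<in>faces_of_cell T K. orient T K S * ?b K S)"
    by (rule R(2)[OF vM])
  also have "int_inner T ?vM ?d = int_inner T (cell_proj T (cell_polys T k) ?vM) ?d"
    by (rule P(2)[OF d(1), symmetric])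
  finally have sum1: "int_inner T (grad_h T k v) ?R + int_inner T (cell_proj T (cell_polys T k) ?vM) ?d
    = (\<Sum>K\<in>cells T. \<Sum>S\<in>faces_of_cell T K. orient T K S * (?c K S - ?a K S + ?b K S))"
    by (simp add: sum.distrib sum_subtractf algebra_simps)
  have "(\<Sum>K\<in>cells T. \<Sum>S\<in>faces_of_cell T K. orient T K S * ?e K S) = 0"
  proof -
    have "(\<Sum>K\<in>{K \<in> cells T. S \<subseteq> K}. orient T K S * ?e K S) = 0" if S: "S \<in> faces T" for S
    proof (cases "S \<in> interior_faces T")
      case True
      have "(\<Sum>K\<in>{K \<in> cells T. S \<subseteq> K}. orient T K S * ?e K S) = (\<Sum>K\<in>{K \<in> cells T. S \<subseteq> K}. orient T K S) * ?e undefined S"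
        by (simp add: sum_distrib_right)
      then show ?thesis using sum_orient[OF S] True by simp
    next
      case False
      then have "S \<in> dirichlet_faces T \<or> S \<in> neumann_faces T"
        using face_cases[OF S] by (auto simp: neumann_faces_def)
      then have "?vS S x \<bullet> ?\<tau>S S x = 0" if "x \<in> S" for x using vD \<tau>N that by fastforce
      then have "?e undefined S = (LINT x|ds T S. 0)" by (intro Bochner_Integration.integral_cong) auto
      then show ?thesis by simp
    qed
    then show ?thesis unfolding sum_faces_cells[symmetric] by (intro sum.neutral) blast
  qed
  then have "int_inner T (grad_h T k v) ?R + int_inner T (cell_proj T (cell_polys T k) ?vM) ?d
    = (\<Sum>K\<in>cells T. \<Sum>S\<in>faces_of_cell T K. orient T K S * (?c K S - ?a K S + ?b K S - ?e K S))"
    unfolding sum1 by (simp add: right_diff_distrib sum_subtractf)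
  also have "\<dots> = (\<Sum>K\<in>cells T. \<Sum>S\<in>faces_of_cell T K. - (orient T K S *
        (LINT x|ds T S. face_residual T k v K S x \<bullet> (?\<tau>S S x - ?R K x *v fnormal T S))))"
  proof (intro sum.cong refl)
    fix K S assume K: "K \<in> cells T" and "S \<in> faces_of_cell T K"
    then have S: "S \<in> faces T" by (simp add: faces_of_cell_def)
    let ?n = "fnormal T S" and ?p = "face_proj T k S (?vM K)"
    have vc: "continuous_on S (?vM K)" by (rule polys_continuous[OF vK[OF K]])
    have Rc: "continuous_on S (\<lambda>x. ?R K x *v ?n)" by (intro continuous_on_matrix_vector polys_continuous[OF RK[OF K]])
    note p = face_proj_properties[where k = k, OF S vc]
    have pc: "continuous_on S ?p" by (rule polys_on_continuous[OF p(1)])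
    obtain t where t: "t \<in> polys k" "?\<tau>S S = restrict t S" using \<tau>S[OF S] by (auto simp: polys_on_def)
    have tR: "(\<lambda>x. t x - ?R K x *v ?n) \<in> polys k"
      by (intro polys_diff t(1) polys_matrix_vector RK[OF K])
    have "(LINT x|ds T S. ?p x \<bullet> (?\<tau>S S x - ?R K x *v ?n)) = (LINT x|ds T S. ?p x \<bullet> (t x - ?R K x *v ?n))"
      by (intro Bochner_Integration.integral_cong) (auto simp: t(2))
    also have "\<dots> = (LINT x|ds T S. ?vM K x \<bullet> (t x - ?R K x *v ?n))" by (rule p(2)[OF tR])
    also have "\<dots> = (LINT x|ds T S. ?vM K x \<bullet> ?\<tau>S S x - ?vM K x \<bullet> (?R K x *v ?n))"
      by (intro Bochner_Integration.integral_cong) (auto simp: t(2) inner_diff_right)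
    also have "\<dots> = ?b K S - ?a K S"
      by (intro Bochner_Integration.integral_diff integrable_on_face[OF S] continuous_on_inner vc Rc bspec[OF \<tau>Sc S])
    finally have proj: "(LINT x|ds T S. ?p x \<bullet> (?\<tau>S S x - ?R K x *v ?n)) = ?b K S - ?a K S" .
    have "(LINT x|ds T S. face_residual T k v K S x \<bullet> (?\<tau>S S x - ?R K x *v ?n))
      = (LINT x|ds T S. (?vS S x \<bullet> ?\<tau>S S x - (?R K x *v ?n) \<bullet> ?vS S x) - ?p x \<bullet> (?\<tau>S S x - ?R K x *v ?n))"
      by (intro Bochner_Integration.integral_cong)
         (auto simp: face_residual_def inner_diff_left inner_diff_right inner_commute)
    also have "\<dots> = (LINT x|ds T S. ?vS S x \<bullet> ?\<tau>S S x - (?R K x *v ?n) \<bullet> ?vS S x)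
        - (LINT x|ds T S. ?p x \<bullet> (?\<tau>S S x - ?R K x *v ?n))"
      by (intro Bochner_Integration.integral_diff integrable_on_face[OF S] continuous_on_diff continuous_on_inner
          Rc pc bspec[OF \<tau>Sc S] bspec[OF vSc S])
    also have "(LINT x|ds T S. ?vS S x \<bullet> ?\<tau>S S x - (?R K x *v ?n) \<bullet> ?vS S x) = ?e K S - ?c K S"
      by (intro Bochner_Integration.integral_diff integrable_on_face[OF S] continuous_on_inner
          Rc bspec[OF \<tau>Sc S] bspec[OF vSc S])
    finally have residual: "(LINT x|ds T S. face_residual T k v K S x \<bullet> (?\<tau>S S x - ?R K x *v ?n))
      = ?e K S - ?c K S - (?b K S - ?a K S)" unfolding proj .
    show "orient T K S * (?c K S - ?a K S + ?b K S - ?e K S)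
      = - (orient T K S * (LINT x|ds T S. face_residual T k v K S x \<bullet> (?\<tau>S S x - ?R K x *v ?n)))"
      unfolding residual by (simp add: algebra_simps)
  qed
  finally show ?thesis by (simp add: sum_negf)
qed

lemma face_residual_polynomial:
  fixes v :: "('n, real^'m) pw \<times> ('n, real^'m) pw"
  assumes v: "v \<in> V_D T k" and K: "K \<in> cells T" and S: "S \<in> faces T"
  obtains p where "p \<in> polys k" "\<And>x. x \<in> S \<Longrightarrow> face_residual T k v K S x = p x"
proof -
  have vM: "fst v K \<in> polys (k + 1)" and vS: "snd v S \<in> polys_on S k"
    using v K S by (auto simp: V_D_def face_polys_def dest: cell_polysD)
  have "face_proj T k S (fst v K) \<in> polys_on S k"
    by (rule face_proj_properties(1)[OF S polys_continuous[OF vM]])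
  then obtain p q where "p \<in> polys k" "snd v S = restrict p S" "q \<in> polys k" "face_proj T k S (fst v K) = restrict q S"
    using vS by (auto simp: polys_on_def)
  then show ?thesis
    by (intro that[of "\<lambda>x. p x - q x"] polys_diff) (auto simp: face_residual_def)
qed

text \<open>Testing the outer projection in \<open>T_stab\<close> with a polynomial amounts to testing its argument, and the
residual is a polynomial on the face.\<close>

lemma stabilization_eq_norm:
  fixes v :: "('n, real^'m) pw \<times> ('n, real^'m) pw"
  assumes r: "r > 1" and v: "v \<in> V_D T k" and K: "K \<in> cells T" and S: "S \<in> faces T"
  shows "(LINT x|ds T S. T_stab T k r v K S x \<bullet> face_residual T k v K S x)
    = (LINT x|ds T S. norm (face_residual T k v K S x) powr r)"
proof -
  obtain p where p: "p \<in> polys k" and eq: "\<And>x. x \<in> S \<Longrightarrow> face_residual T k v K S x = p x"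
    by (rule face_residual_polynomial[OF v K S]) blast
  let ?f = "\<lambda>x. norm (face_residual T k v K S x) powr (r - 2) *\<^sub>R face_residual T k v K S x"
  have rc: "continuous_on S (face_residual T k v K S)"
    using polys_continuous[OF p, of S] continuous_on_cong[of S S "face_residual T k v K S" p] eq by simp
  have "(LINT x|ds T S. T_stab T k r v K S x \<bullet> face_residual T k v K S x) = (LINT x|ds T S. T_stab T k r v K S x \<bullet> p x)"
    by (intro Bochner_Integration.integral_cong) (auto simp: eq)
  also have "\<dots> = (LINT x|ds T S. ?f x \<bullet> p x)"
    unfolding T_stab_def by (rule face_proj_properties(2)[OF S continuous_on_norm_powr_scaleR[OF r rc] p])
  also have "\<dots> = (LINT x|ds T S. norm (face_residual T k v K S x) powr r)"
  proof (intro Bochner_Integration.integral_cong refl)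
    fix x assume "x \<in> space (ds T S)"
    then have x: "face_residual T k v K S x = p x" by (simp add: eq)
    have "norm (p x) powr (r - 2) * (norm (p x))\<^sup>2 = norm (p x) powr r"
    proof (cases "p x = 0")
      case False
      then have sq: "(norm (p x))\<^sup>2 = norm (p x) powr 2" by simp
      show ?thesis unfolding sq powr_add[symmetric] by (simp only: diff_add_cancel)
    qed simp
    then show "?f x \<bullet> p x = norm (face_residual T k v K S x) powr r"
      by (simp add: x power2_norm_eq_inner)
  qed
  finally show ?thesis .
qed

text \<open>The Cauchy-Schwarz inequality and the weighted Young inequality bound the absolute value of each face
integral, whatever the sign of the normal.\<close>

lemma stabilization_bound:
  fixes v :: "('n, real^'m) pw \<times> ('n, real^'m) pw"
    and \<tau> :: "('n, real^'n^'m) pw \<times> ('n, real^'m) pw"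
  assumes n: "CARD('n) \<ge> 2" and r: "r > 1" and v: "v \<in> V_D T k" and \<tau>: "\<tau> \<in> W_N T k"
  shows "(\<Sum>K\<in>cells T. \<Sum>S\<in>faces_of_cell T K. orient T K S *
        (LINT x|ds T S. face_residual T k v K S x \<bullet> (snd \<tau> S x - stress_rec T k \<tau> K x *v fnormal T S)))
    \<le> s_h T k r s v / r + gamma_h T k r s \<tau> / (r / (r - 1))"
proof -
  have "orient T K S * (LINT x|ds T S. face_residual T k v K S x \<bullet> (snd \<tau> S x - stress_rec T k \<tau> K x *v fnormal T S))
    \<le> diameter S powr (- s) * (LINT x|ds T S. T_stab T k r v K S x \<bullet> face_residual T k v K S x) / r
      + diameter S powr (s / (r - 1)) *
        (LINT x|ds T S. norm (snd \<tau> S x - stress_rec T k \<tau> K x *v fnormal T S) powr (r / (r - 1))) / (r / (r - 1))"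
    (is "_ * (LINT x|_. ?w x \<bullet> ?\<rho> x) \<le> _")
    if K: "K \<in> cells T" and "S \<in> faces_of_cell T K" for K S
  proof -
    have S: "S \<in> faces T" using that(2) by (simp add: faces_of_cell_def)
    have h: "diameter S > 0" by (rule face_diameter[OF S n])
    obtain p where "p \<in> polys k" "\<And>x. x \<in> S \<Longrightarrow> ?w x = p x"
      by (rule face_residual_polynomial[OF v K S]) blast
    then have wc: "continuous_on S ?w"
      using polys_continuous[of p k S] continuous_on_cong[of S S "face_residual T k v K S" p] by simp
    have \<tau>M: "fst \<tau> \<in> cell_polys T k" and \<tau>Sc: "\<forall>S\<in>faces T. continuous_on S (snd \<tau> S)"
      using \<tau> by (auto simp: W_N_def face_polys_def intro!: polys_on_continuous)
    have \<rho>c: "continuous_on S ?\<rho>"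
      by (intro continuous_on_diff bspec[OF \<tau>Sc S] continuous_on_matrix_vector
          polys_continuous[OF cell_polysD[OF stress_rec_properties(1)[OF \<tau>M \<tau>Sc] K]])
    have int_w: "integrable (ds T S) (\<lambda>x. norm (?w x) powr r)"
      using r by (intro integrable_on_face[OF S] continuous_on_powr' continuous_intros wc) auto
    have int_\<rho>: "integrable (ds T S) (\<lambda>x. norm (?\<rho> x) powr (r / (r - 1)))"
      using r by (intro integrable_on_face[OF S] continuous_on_powr' continuous_on_norm continuous_on_const \<rho>c) auto
    have "orient T K S * (LINT x|ds T S. ?w x \<bullet> ?\<rho> x) \<le> \<bar>orient T K S * (LINT x|ds T S. ?w x \<bullet> ?\<rho> x)\<bar>" by simp
    also have "\<dots> = \<bar>LINT x|ds T S. ?w x \<bullet> ?\<rho> x\<bar>" by (simp add: abs_mult)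
    also have "\<dots> \<le> (LINT x|ds T S. \<bar>?w x \<bullet> ?\<rho> x\<bar>)" by (rule integral_abs_bound)
    also have "\<dots> \<le> (LINT x|ds T S. diameter S powr (- s) * norm (?w x) powr r / r
        + diameter S powr (s / (r - 1)) * norm (?\<rho> x) powr (r / (r - 1)) / (r / (r - 1)))"
    proof (rule integral_mono)
      show "integrable (ds T S) (\<lambda>x. \<bar>?w x \<bullet> ?\<rho> x\<bar>)"
        by (intro integrable_on_face[OF S] continuous_on_rabs continuous_on_inner wc \<rho>c)
      show "integrable (ds T S) (\<lambda>x. diameter S powr (- s) * norm (?w x) powr r / r
        + diameter S powr (s / (r - 1)) * norm (?\<rho> x) powr (r / (r - 1)) / (r / (r - 1)))"
        by (intro Bochner_Integration.integrable_add integrable_divide_zero integrable_mult_right int_w int_\<rho>)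
      fix x
      have "\<bar>?w x \<bullet> ?\<rho> x\<bar> \<le> norm (?w x) * norm (?\<rho> x)" by (rule Cauchy_Schwarz_ineq2)
      also have "\<dots> \<le> diameter S powr (- s) * norm (?w x) powr r / r
        + diameter S powr (s / (r - 1)) * norm (?\<rho> x) powr (r / (r - 1)) / (r / (r - 1))"
        by (rule weighted_young[OF r h]) simp_all
      finally show "\<bar>?w x \<bullet> ?\<rho> x\<bar> \<le> diameter S powr (- s) * norm (?w x) powr r / r
        + diameter S powr (s / (r - 1)) * norm (?\<rho> x) powr (r / (r - 1)) / (r / (r - 1))" .
    qed
    also have "\<dots> = (LINT x|ds T S. diameter S powr (- s) * norm (?w x) powr r / r)
        + (LINT x|ds T S. diameter S powr (s / (r - 1)) * norm (?\<rho> x) powr (r / (r - 1)) / (r / (r - 1)))"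
      by (intro Bochner_Integration.integral_add integrable_divide_zero integrable_mult_right int_w int_\<rho>)
    also have "\<dots> = diameter S powr (- s) * (LINT x|ds T S. norm (?w x) powr r) / r
        + diameter S powr (s / (r - 1)) * (LINT x|ds T S. norm (?\<rho> x) powr (r / (r - 1))) / (r / (r - 1))"
      by simp
    finally show ?thesis unfolding stabilization_eq_norm[OF r v K S] .
  qed
  then have "(\<Sum>K\<in>cells T. \<Sum>S\<in>faces_of_cell T K. orient T K S *
        (LINT x|ds T S. face_residual T k v K S x \<bullet> (snd \<tau> S x - stress_rec T k \<tau> K x *v fnormal T S)))
    \<le> (\<Sum>K\<in>cells T. \<Sum>S\<in>faces_of_cell T K.
      diameter S powr (- s) * (LINT x|ds T S. T_stab T k r v K S x \<bullet> face_residual T k v K S x) / r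
      + diameter S powr (s / (r - 1)) *
        (LINT x|ds T S. norm (snd \<tau> S x - stress_rec T k \<tau> K x *v fnormal T S) powr (r / (r - 1))) / (r / (r - 1)))"
    by (intro sum_mono)
  also have "\<dots> = s_h T k r s v / r + gamma_h T k r s \<tau> / (r / (r - 1))"
    unfolding s_h_def gamma_h_def sum_divide_distrib sum.distrib ..
  finally show ?thesis .
qed

lemma discrete_weak_duality:
  fixes v :: "('n, real^'m) pw \<times> ('n, real^'m) pw"
    and \<tau> :: "('n, real^'n^'m) pw \<times> ('n, real^'m) pw"
  assumes n: "CARD('n) \<ge> 2" and r: "r > 1" and v: "v \<in> V_D T k" and \<tau>: "\<tau> \<in> W_N T k"
    and \<Psi>: "\<And>a. \<Psi> a \<noteq> -\<infinity>" and \<psi>\<^sub>h: "\<And>x b. x \<in> omega T \<Longrightarrow> \<psi>\<^sub>h x b \<noteq> -\<infinity>"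
  shows "E_h_dual T k r s \<Psi> \<psi>\<^sub>h \<tau> \<le> E_h T k r s \<Psi> \<psi>\<^sub>h v"
proof -
  let ?D = "grad_h T k v" and ?R = "stress_rec T k \<tau>" and ?d = "div_h T k \<tau>"
    and ?P = "cell_proj T (cell_polys T k) (fst v)"
  define Q where "Q = int_inner T ?D ?R + int_inner T ?P ?d"
  have vM: "fst v \<in> cell_polys T (k + 1)" and vSc: "\<forall>S\<in>faces T. continuous_on S (snd v S)"
    using v by (auto simp: V_D_def face_polys_def intro!: polys_on_continuous)
  have \<tau>M: "fst \<tau> \<in> cell_polys T k" and \<tau>Sc: "\<forall>S\<in>faces T. continuous_on S (snd \<tau> S)"
    using \<tau> by (auto simp: W_N_def face_polys_def intro!: polys_on_continuous)
  note mem = grad_h_properties(1)[where k = k, OF vM vSc] stress_rec_properties(1)[OF \<tau>M \<tau>Sc]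
    cell_proj_cell_polys(1)[where k = k, OF vM] div_h_properties(1)[where k = k, OF \<tau>M \<tau>Sc]
  have int1: "integrable (dx T) (\<lambda>x. glue T ?D x \<bullet> glue T ?R x)"
    by (intro int_inner_eq(2) polys_continuous[OF cell_polysD[OF mem(1)]] polys_continuous[OF cell_polysD[OF mem(2)]])
  have int2: "integrable (dx T) (\<lambda>x. glue T ?P x \<bullet> glue T ?d x)"
    by (intro int_inner_eq(2) polys_continuous[OF cell_polysD[OF mem(3)]] polys_continuous[OF cell_polysD[OF mem(4)]])
  have "- Q \<le> s_h T k r s v / r + gamma_h T k r s \<tau> / (r / (r - 1))"
    unfolding Q_def discrete_integration_by_parts[OF v \<tau>] using stabilization_bound[OF n r v \<tau>] by simp
  moreover have "Q \<le> (LINT x|dx T. F x) + (LINT x|dx T. G x)"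
    if FG: "integrable (dx T) F" "integrable (dx T) G"
      and F: "AE x in dx T. \<Psi> (glue T ?D x) + \<psi>\<^sub>h x (glue T ?P x) \<le> ereal (F x)"
      and G: "AE x in dx T. conjugate \<Psi> (glue T ?R x) + conjugate (\<psi>\<^sub>h x) (glue T ?d x) \<le> ereal (G x)" for F G
  proof -
    have "AE x in dx T. glue T ?D x \<bullet> glue T ?R x + glue T ?P x \<bullet> glue T ?d x \<le> F x + G x"
      using F G AE_space
    proof eventually_elim
      case (elim x)
      then have "x \<in> omega T" by simp
      then show ?case by (intro fenchel_young_pointwise[OF \<Psi> \<psi>\<^sub>h elim(1,2)])
    qed
    then have "(LINT x|dx T. glue T ?D x \<bullet> glue T ?R x + glue T ?P x \<bullet> glue T ?d x) \<le> (LINT x|dx T. F x + G x)"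
      using int1 int2 FG by (intro integral_mono_AE Bochner_Integration.integrable_add)
    then show ?thesis using int1 int2 FG by (simp add: Q_def int_inner_def)
  qed
  ultimately show ?thesis
    unfolding E_h_dual_def E_h_def by (intro ext_integral_duality)
qed

end

theorem theorem3p1:
  fixes T :: "'n::finite mesh"
    and \<Psi> :: "real^'n^'m::finite \<Rightarrow> ereal"
    and \<psi> \<psi>\<^sub>h :: "real^'n \<Rightarrow> real^'m \<Rightarrow> ereal"
    and k :: nat and r s :: real
  assumes "CARD('n) \<ge> 2"
    and "admissible_mesh T"
    and "energy_density \<Psi>"
    and "(\<lambda>(x, a). \<psi> x a) \<in> borel_measurable (dx T \<Otimes>\<^sub>M borel)"
    and "\<forall>x\<in>omega T. \<forall>a. \<psi> x a \<noteq> -\<infinity>"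
    and "AE x in dx T. energy_density (\<psi> x)"
    and "\<forall>x\<in>omega T. \<forall>a. \<psi>\<^sub>h x a \<noteq> -\<infinity>"
    and "r > 1"
  shows "(SUP \<tau>\<in>W_N T k. E_h_dual T k r s \<Psi> \<psi>\<^sub>h \<tau>) \<le> (INF v\<in>V_D T k. E_h T k r s \<Psi> \<psi>\<^sub>h v)"
proof -
  interpret admissible T by unfold_locales (fact assms(2))
  have "\<Psi> a \<noteq> -\<infinity>" for a using assms(3) by (simp add: energy_density_def proper_fun_def)
  then show ?thesis
    using assms(7) by (intro SUP_least INF_greatest discrete_weak_duality[OF assms(1,8)]) auto
qed

end
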